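(* Let $\beta>0$ and $\gamma\ge 1$, and set $L_\pm:=\beta(1\pm\sqrt\gamma)^2$. For each $n\ge1$ put $\alpha:=\beta\gamma(n-1)/2$ and let $L_\beta^{(n)}$ be an $n\times n$ random matrix from the $\beta$-Laguerre ensemble, i.e. the real symmetric tridiagonal matrix with diagonal entries $a_0^{\mathrm L},a_1^{\mathrm L},\dots,a_{n-1}^{\mathrm L}$ (in this order) and off-diagonal entries $b_1^{\mathrm L},\dots,b_{n-1}^{\mathrm L}$ (in this order), where the random entries are $$a_0^{\mathrm L}\sim\chi^2_{2\alpha}/n,\qquad a_j^{\mathrm L}\sim\chi^2_{2\alpha+\beta(n-2j)}/n,\qquad b_j^{\mathrm L}\sim\chi_{2\alpha-\beta(j-1)}\,\chi_{\beta(n-j)}/n\qquad(1\le j\le n-1).$$ Regard $L_\beta^{(n)}$ as the adjacency matrix of the graph $L_n$ on the vertex set $\{0,\dots,n-1\}$ in which $j-1$ and $j$ are joined by an edge of weight $b_j^{\mathrm L}$ ($1\le j\le n-1$) and each vertex $j$ is joined to itself by an edge of weight $a_j^{\mathrm L}$, with a root chosen uniformly at random from the vertices. Then the sequence of random rooted graphs obtained from the adjacency matrices $\{L_\beta^{(n)}\}_{n=1}^\infty$ is Benjamini-Schramm convergent in the limit $n\to\infty$, and the expected measure of the limiting adjacency operator is $$\mu_L(\mathrm dx)=\mathbf 1\big[x\in[L_-,L_+]\big]\,\frac{\sqrt{(x-L_-)(L_+-x)}}{2\pi\beta x}\,\mathrm dx .$$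
   Context: $\chi_k$ and $\chi^2_k$ ($k>0$ real) are the chi and chi-square distributions with $k$ degrees of freedom. $\mathbf 1[\cdot]$ is the indicator function. Random rooted graphs: a rooted graph $(G,o)$ is a connected, locally finite graph $G=(V,E)$ of bounded degree with a distinguished vertex $o\in V$, the root; rooted graphs are considered up to isomorphism ($\simeq$), and $B_r(G,o)$ is the subgraph of radius $r$ around the root. A random rooted graph is obtained by choosing the root uniformly at random from the vertices of $G$; $\mathbb P_G$ and $\mathbb E_G$ are the corresponding probability and expectation. If $G$ is finite, each vertex is the root with probability $1/\sharp V$; if $G$ is infinite, the choice of root is labeled by a continuous parameter in $[0,1]$ with Lebesgue measure. Benjamini-Schramm convergence: a random rooted graph $(G,o)$ is the distributional limit of a sequence $(G_n,o_n)$ of rooted graphs with uniformly random roots if for every $r>0$ and every finite rooted graph $(K,o')$, $$\mathbb P_{G_n}[(K,o')\simeq (B_r(G_n,o_n),o_n)]\longrightarrow \mathbb P_{G}[(K,o')\simeq (B_r(G,o),o)]\qquad(n\to\infty),$$ that is, if the law of $(G_n,o_n)$ tends locally weakly to the law of $(G,o)$. The sequence is Benjamini-Schramm convergent if it has such a limit. Adjacency operator: for $G=(V,E)$ with real, symmetric, bounded edge weights $l((v,u))=l((u,v))$, the adjacency operator $A$ acts on the square-summable functions on $V$, with inner product $\langle f,g\rangle=\sum_{v\in V}\overline{f(v)}g(v)$, by $[Af](v)=\sum_{u:(v,u)\in E}l((v,u))f(u)$. Spectral measure and expected measure: the spectral measure of $A$ with respect to the root $o$ is $\mu_{G,o}(X)=\langle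 P_X\chi_o,\chi_o\rangle$ for Borel $X\subset\mathbb R$, where $P_X$ is the projection-valued spectral measure of $A$ and $\chi_o$ is the function equal to $1$ at $o$ and $0$ elsewhere. The expected measure is $\mu_G(X)=\mathbb E_G[\mu_{G,o}(X)]$. Limiting graph and operator: the limit is taken with root labeled $j_n$, where $j_n\to\infty$ and $j_n/n\to u$, and the uniform choice of root amounts to $u\sim\mathrm{Unif}[0,1]$. The edge weights of the limiting graph $L$ are the limits of the weights of $L_n$ around the root; thus $L$ has vertices labeled by the integers and the limiting adjacency operator is $A_Lf(v)=\beta\sqrt{\gamma-u}\sqrt{1-u}\,[f(v-1)+f(v+1)]+\beta(\gamma+1-2u)f(v)$. The expected measure $\mu_L$ is the expectation over $u$ of the spectral measure at the root. *)

theory Defs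
  imports "HOL-Probability.Probability"
begin

section \<open>Chi and chi-square distributions\<close>

text \<open>For zero degrees of freedom we use the standard convention that the distribution is the
  point mass at \<open>0\<close>. This degenerate case only occurs for \<open>1 \<times> 1\<close> Laguerre matrices.\<close>

definition chi_square :: "real \<Rightarrow> real measure" where
  "chi_square k =
     (if k = 0 then return borel 0
      else density lborel (\<lambda>x. ennreal (if 0 < x
             then x powr (k / 2 - 1) * exp (- x / 2) / (2 powr (k / 2) * Gamma (k / 2)) else 0)))"

definition chi :: "real \<Rightarrow> real measure" where
  "chi k = distr (chi_square k) borel sqrt"

definition has_law :: "'a measure \<Rightarrow> ('a \<Rightarrow> real) \<Rightarrow> real measure \<Rightarrow> bool" where
  "has_law M X \<mu> \<longleftrightarrow> X \<in> borel_measurable M \<and> distr M borel X = \<mu>"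


section \<open>The beta-Laguerre ensemble in tridiagonal form\<close>

text \<open>\<open>T \<omega> i j\<close>, \<open>0 \<le> i, j < n\<close>, are the entries of the random matrix, so \<open>a\<^sub>j = T \<omega> j j\<close> and
  \<open>b\<^sub>j = T \<omega> (j - 1) j\<close>. A product of two chi distributions is the law of the product of two
  independent variables. Only the laws of the individual entries are prescribed: their joint law
  is left arbitrary. In particular this covers the matrices \<open>B B\<^sup>T\<close> with \<open>B\<close> bidiagonal with
  independent chi entries as well as tridiagonal matrices with independent entries.\<close>

definition beta_laguerre ::
    "'a measure \<Rightarrow> real \<Rightarrow> real \<Rightarrow> nat \<Rightarrow> ('a \<Rightarrow> int \<Rightarrow> int \<Rightarrow> real) \<Rightarrow> bool" where
  "beta_laguerre M \<beta> \<gamma> n T \<longleftrightarrow>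
     prob_space M \<and>
     (\<forall>\<omega>\<in>space M. \<forall>i\<in>{0..<int n}. \<forall>j\<in>{0..<int n}.
        T \<omega> i j = T \<omega> j i \<and> (\<bar>i - j\<bar> > 1 \<longrightarrow> T \<omega> i j = 0)) \<and>
     (let \<alpha> = \<beta> * \<gamma> * (real n - 1) / 2 in
        has_law M (\<lambda>\<omega>. T \<omega> 0 0) (distr (chi_square (2 * \<alpha>)) borel (\<lambda>x. x / n)) \<and>
        (\<forall>j\<in>{1..int n - 1}.
           has_law M (\<lambda>\<omega>. T \<omega> j j)
             (distr (chi_square (2 * \<alpha> + \<beta> * (real n - 2 * real_of_int j))) borel (\<lambda>x. x / n)) \<and>
           has_law M (\<lambda>\<omega>. T \<omega> (j - 1) j)
             (distr (chi (2 * \<alpha> - \<beta> * (real_of_int j - 1))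
                       \<Otimes>\<^sub>M chi (\<beta> * (real n - real_of_int j)))
                borel (\<lambda>(x, y). x * y / n))))"


section \<open>Rooted graphs with weighted edges\<close>

record 'v wgraph =
  verts :: "'v set"
  edges :: "('v \<times> 'v) set"
  weight :: "'v \<Rightarrow> 'v \<Rightarrow> real"

definition rooted_graph :: "'v wgraph \<Rightarrow> 'v \<Rightarrow> bool" where
  "rooted_graph G x \<longleftrightarrow>
     x \<in> verts G \<and>
     edges G \<subseteq> verts G \<times> verts G \<and> sym (edges G) \<and>
     (\<forall>v\<in>verts G. \<forall>w\<in>verts G. (v, w) \<in> (edges G)\<^sup>*) \<and>
     (\<exists>D. \<forall>v\<in>verts G. finite {w. (v, w) \<in> edges G} \<and> card {w. (v, w) \<in> edges G} \<le> D) \<and>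
     (\<forall>(v, w)\<in>edges G. weight G v w = weight G w v) \<and>
     (\<exists>C. \<forall>(v, w)\<in>edges G. \<bar>weight G v w\<bar> \<le> C)"

text \<open>The graph distance is integer valued, so natural radii suffice.\<close>

definition graph_ball :: "'v wgraph \<Rightarrow> 'v \<Rightarrow> nat \<Rightarrow> 'v wgraph" where
  "graph_ball G x r =
     (let S = {v. \<exists>k\<le>r. (x, v) \<in> edges G ^^ k}
      in \<lparr>verts = S, edges = edges G \<inter> S \<times> S, weight = weight G\<rparr>)"

definition rooted_iso :: "('v \<Rightarrow> 'w) \<Rightarrow> 'v wgraph \<Rightarrow> 'v \<Rightarrow> 'w wgraph \<Rightarrow> 'w \<Rightarrow> bool" where
  "rooted_iso \<phi> G x H y \<longleftrightarrow>
     bij_betw \<phi> (verts G) (verts H) \<and> \<phi> x = y \<and>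
     (\<forall>v\<in>verts G. \<forall>w\<in>verts G. (v, w) \<in> edges G \<longleftrightarrow> (\<phi> v, \<phi> w) \<in> edges H)"

definition isomorphic_rooted :: "'v wgraph \<Rightarrow> 'v \<Rightarrow> 'w wgraph \<Rightarrow> 'w \<Rightarrow> bool" where
  "isomorphic_rooted G x H y \<longleftrightarrow> (\<exists>\<phi>. rooted_iso \<phi> G x H y)"


section \<open>Benjamini-Schramm convergence\<close>

text \<open>The topology of local convergence of rooted weighted graphs: \<open>(H, y)\<close> is near \<open>(G, x)\<close> if some
  rooted isomorphism between large balls almost preserves the weights. A function that is continuous
  for it is automatically invariant under weight-preserving rooted isomorphisms.\<close>

definition locally_close :: "nat \<Rightarrow> real \<Rightarrow> 'v wgraph \<Rightarrow> 'v \<Rightarrow> 'v wgraph \<Rightarrow> 'v \<Rightarrow> bool" where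
  "locally_close r \<delta> G x H y \<longleftrightarrow>
     (\<exists>\<phi>. rooted_iso \<phi> (graph_ball G x r) x (graph_ball H y r) y \<and>
          (\<forall>(v, w)\<in>edges (graph_ball G x r). \<bar>weight H (\<phi> v) (\<phi> w) - weight G v w\<bar> < \<delta>))"

definition bounded_locally_continuous :: "('v wgraph \<Rightarrow> 'v \<Rightarrow> real) \<Rightarrow> bool" where
  "bounded_locally_continuous F \<longleftrightarrow>
     (\<exists>C. \<forall>G x. rooted_graph G x \<longrightarrow> \<bar>F G x\<bar> \<le> C) \<and>
     (\<forall>G x. rooted_graph G x \<longrightarrow>
        (\<forall>\<epsilon>>0. \<exists>r. \<exists>\<delta>>0. \<forall>H y. rooted_graph H y \<longrightarrow> locally_close r \<delta> G x H y \<longrightarrow>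
           \<bar>F H y - F G x\<bar> < \<epsilon>))"

text \<open>A random rooted graph is given by its graph and its root, as functions on a probability space.\<close>

definition random_rooted_graph :: "'a measure \<Rightarrow> ('a \<Rightarrow> 'v wgraph) \<Rightarrow> ('a \<Rightarrow> 'v) \<Rightarrow> bool" where
  "random_rooted_graph M G x \<longleftrightarrow>
     prob_space M \<and> (\<forall>\<omega>\<in>space M. rooted_graph (G \<omega>) (x \<omega>)) \<and>
     (\<forall>F. bounded_locally_continuous F \<longrightarrow> (\<lambda>\<omega>. F (G \<omega>) (x \<omega>)) \<in> borel_measurable M)"

text \<open>The first limit says that the underlying graphs, without the weights, converge; test graphs
  carry weights only because of their type. Since the probability that a ball has exactly
  prescribed weights is in general \<open>0\<close> when the weights are continuously distributed, the
  weights enter through the second limit, which is weak convergence of the laws of the rooted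
  weighted graphs for the local topology. Sequences are indexed by \<open>n \<ge> 1\<close>.\<close>

definition bs_limit ::
    "(nat \<Rightarrow> 'a measure) \<Rightarrow> (nat \<Rightarrow> 'a \<Rightarrow> 'v wgraph) \<Rightarrow> (nat \<Rightarrow> 'a \<Rightarrow> 'v) \<Rightarrow>
     'b measure \<Rightarrow> ('b \<Rightarrow> 'v wgraph) \<Rightarrow> ('b \<Rightarrow> 'v) \<Rightarrow> bool" where
  "bs_limit M G x N H y \<longleftrightarrow>
     (\<forall>n\<ge>1. random_rooted_graph (M n) (G n) (x n)) \<and> random_rooted_graph N H y \<and>
     (\<forall>r. \<forall>(K :: 'v wgraph) z. rooted_graph K z \<longrightarrow> finite (verts K) \<longrightarrow>
        (\<lambda>n. measure (M n) {\<omega>\<in>space (M n).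
               isomorphic_rooted K z (graph_ball (G n \<omega>) (x n \<omega>) r) (x n \<omega>)})
          \<longlonglongrightarrow> measure N {\<omega>\<in>space N. isomorphic_rooted K z (graph_ball (H \<omega>) (y \<omega>) r) (y \<omega>)}) \<and>
     (\<forall>F. bounded_locally_continuous F \<longrightarrow>
        (\<lambda>n. \<integral>\<omega>. F (G n \<omega>) (x n \<omega>) \<partial>M n) \<longlonglongrightarrow> (\<integral>\<omega>. F (H \<omega>) (y \<omega>) \<partial>N))"


section \<open>Adjacency operator and spectral measures\<close>

text \<open>Square-summable functions on \<open>V\<close> are represented by functions vanishing outside \<open>V\<close>.\<close>

definition l2 :: "'v set \<Rightarrow> ('v \<Rightarrow> complex) set" where
  "l2 V = {f. (\<forall>v. v \<notin> V \<longrightarrow> f v = 0) \<and> (\<lambda>v. (cmod (f v))\<^sup>2) summable_on V}"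

definition l2_inner :: "'v set \<Rightarrow> ('v \<Rightarrow> complex) \<Rightarrow> ('v \<Rightarrow> complex) \<Rightarrow> complex" where
  "l2_inner V f g = (\<Sum>\<^sub>\<infinity>v\<in>V. cnj (f v) * g v)"

definition adjacency :: "'v wgraph \<Rightarrow> ('v \<Rightarrow> complex) \<Rightarrow> ('v \<Rightarrow> complex)" where
  "adjacency G f v = (\<Sum>w | (v, w) \<in> edges G. of_real (weight G v w) * f w)"

definition orthogonal_projection ::
    "'v set \<Rightarrow> (('v \<Rightarrow> complex) \<Rightarrow> ('v \<Rightarrow> complex)) \<Rightarrow> bool" where
  "orthogonal_projection V Q \<longleftrightarrow>
     (\<forall>f\<in>l2 V. Q f \<in> l2 V \<and> Q (Q f) = Q f) \<and>
     (\<forall>f\<in>l2 V. \<forall>g\<in>l2 V. \<forall>c d.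
        Q (\<lambda>v. c * f v + d * g v) = (\<lambda>v. c * Q f v + d * Q g v)) \<and>
     (\<forall>f\<in>l2 V. \<forall>g\<in>l2 V. l2_inner V (Q f) g = l2_inner V f (Q g))"

definition projection_valued_measure ::
    "'v set \<Rightarrow> (real set \<Rightarrow> ('v \<Rightarrow> complex) \<Rightarrow> ('v \<Rightarrow> complex)) \<Rightarrow> bool" where
  "projection_valued_measure V P \<longleftrightarrow>
     (\<forall>X\<in>sets borel. orthogonal_projection V (P X)) \<and>
     (\<forall>f\<in>l2 V. P {} f = (\<lambda>v. 0) \<and> P UNIV f = f) \<and>
     (\<forall>X\<in>sets borel. \<forall>Y\<in>sets borel. \<forall>f\<in>l2 V. P (X \<inter> Y) f = P X (P Y f)) \<and>
     (\<forall>X :: nat \<Rightarrow> real set. range X \<subseteq> sets borel \<longrightarrow> disjoint_family X \<longrightarrow>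
        (\<forall>f\<in>l2 V. \<forall>g\<in>l2 V.
           (\<lambda>i. l2_inner V (P (X i) f) g) sums l2_inner V (P (\<Union>i. X i) f) g))"

text \<open>The measure \<open>X \<mapsto> \<langle>P\<^sub>X f, f\<rangle>\<close>, whose values are real and nonnegative.\<close>

definition pvm_diagonal ::
    "'v set \<Rightarrow> (real set \<Rightarrow> ('v \<Rightarrow> complex) \<Rightarrow> ('v \<Rightarrow> complex)) \<Rightarrow> ('v \<Rightarrow> complex) \<Rightarrow> real measure"
  where "pvm_diagonal V P f =
    measure_of UNIV (sets borel) (\<lambda>X. ennreal (Re (l2_inner V (P X f) f)))"

text \<open>The spectral resolution of a bounded self-adjoint operator: \<open>P\<close> has bounded support
  and \<open>A = \<integral>x dP\<^sub>x\<close>, expressed through quadratic forms (which determine an operator, by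
  polarization).\<close>

definition is_spectral_pvm :: "'v set \<Rightarrow> (('v \<Rightarrow> complex) \<Rightarrow> ('v \<Rightarrow> complex)) \<Rightarrow>
    (real set \<Rightarrow> ('v \<Rightarrow> complex) \<Rightarrow> ('v \<Rightarrow> complex)) \<Rightarrow> bool" where
  "is_spectral_pvm V A P \<longleftrightarrow>
     projection_valued_measure V P \<and>
     (\<exists>R. \<forall>f\<in>l2 V. P {-R..R} f = f) \<and>
     (\<forall>f\<in>l2 V. l2_inner V (A f) f = of_real (\<integral>x. x \<partial>pvm_diagonal V P f))"

text \<open>By the spectral theorem, the projection-valued spectral measure of the adjacency operator
  exists and is unique on Borel sets and square-summable functions.\<close>

definition spectral_pvm :: "'v wgraph \<Rightarrow> real set \<Rightarrow> ('v \<Rightarrow> complex) \<Rightarrow> ('v \<Rightarrow> complex)" where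
  "spectral_pvm G = (SOME P. is_spectral_pvm (verts G) (adjacency G) P)"

definition spectral_measure :: "'v wgraph \<Rightarrow> 'v \<Rightarrow> real measure" where
  "spectral_measure G x =
     pvm_diagonal (verts G) (spectral_pvm G) (\<lambda>v. if v = x then 1 else 0)"

definition expected_measure ::
    "'a measure \<Rightarrow> ('a \<Rightarrow> 'v wgraph) \<Rightarrow> ('a \<Rightarrow> 'v) \<Rightarrow> real measure" where
  "expected_measure M G x =
     measure_of UNIV (sets borel) (\<lambda>X. \<integral>\<^sup>+\<omega>. emeasure (spectral_measure (G \<omega>) (x \<omega>)) X \<partial>M)"


section \<open>The graphs of tridiagonal matrices and the limiting graph\<close>

definition tridiagonal_graph :: "nat \<Rightarrow> (int \<Rightarrow> int \<Rightarrow> real) \<Rightarrow> int wgraph" where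
  "tridiagonal_graph n T =
     \<lparr>verts = {0..<int n},
      edges = {(i, j). i \<in> {0..<int n} \<and> j \<in> {0..<int n} \<and> \<bar>i - j\<bar> \<le> 1},
      weight = T\<rparr>"

definition laguerre_limit_graph :: "real \<Rightarrow> real \<Rightarrow> real \<Rightarrow> int wgraph" where
  "laguerre_limit_graph \<beta> \<gamma> u =
     \<lparr>verts = UNIV,
      edges = {(i, j). \<bar>i - j\<bar> \<le> 1},
      weight = (\<lambda>i j. if i = j then \<beta> * (\<gamma> + 1 - 2 * u)
                      else \<beta> * sqrt (\<gamma> - u) * sqrt (1 - u))\<rparr>"

lemma adjacency_laguerre_limit_graph:
  "adjacency (laguerre_limit_graph \<beta> \<gamma> u) f v =
     of_real (\<beta> * sqrt (\<gamma> - u) * sqrt (1 - u)) * (f (v - 1) + f (v + 1))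
     + of_real (\<beta> * (\<gamma> + 1 - 2 * u)) * f v"
proof -
  have "{w. (v, w) \<in> edges (laguerre_limit_graph \<beta> \<gamma> u)} = {v - 1, v, v + 1}"
    by (auto simp: laguerre_limit_graph_def)
  then show ?thesis
    by (simp add: adjacency_def) (simp add: laguerre_limit_graph_def algebra_simps)
qed

lemma adjacency_tridiagonal_graph:
  assumes "\<And>i j. i \<in> {0..<int n} \<Longrightarrow> j \<in> {0..<int n} \<Longrightarrow> \<bar>i - j\<bar> > 1 \<Longrightarrow> T i j = 0"
    and "i \<in> {0..<int n}"
  shows "adjacency (tridiagonal_graph n T) f i = (\<Sum>j = 0..<int n. of_real (T i j) * f j)"
proof -
  have "(\<Sum>j\<in>{j \<in> {0..<int n}. \<bar>i - j\<bar> \<le> 1}. of_real (T i j) * f j)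
      = (\<Sum>j = 0..<int n. of_real (T i j) * f j)"
    using assms(2) by (intro sum.mono_neutral_left) (auto, metis assms(1) atLeastLessThan_iff not_le)
  moreover have "{j. (i, j) \<in> edges (tridiagonal_graph n T)} = {j \<in> {0..<int n}. \<bar>i - j\<bar> \<le> 1}"
    using assms(2) by (auto simp: tridiagonal_graph_def)
  ultimately show ?thesis
    by (simp add: adjacency_def) (simp add: tridiagonal_graph_def)
qed

end

theory Submission
  imports Defs
begin

text \<open>The diagonal entries have mean and variance of order \<open>1\<close> and \<open>1/n\<close>, and the squares of
  the off-diagonal entries likewise, so by Chebyshev's inequality the entries near row
  \<open>\<lfloor>n u\<rfloor>\<close> converge in probability to the weights of the limiting graph; since only finitely many
  entries matter for a ball, no information on their joint law is needed. A uniform root is \<open>\<lfloor>n u\<rfloor>\<close> with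
  \<open>u\<close> uniform, and dominated convergence in \<open>u\<close> gives the local weak limit.

  For fixed \<open>u\<close> the limiting operator becomes multiplication by \<open>a + 2 b cos t\<close> under Fourier series,
  which provides a projection-valued spectral measure; any other one has the same moments
  at the root. So the spectral measure at the root is an arcsine law with density
  \<open>1 / (\<pi> sqrt (4 b\<^sup>2 - (x - a)\<^sup>2))\<close>. With \<open>a = \<beta> (\<gamma> + 1 - 2 u)\<close> and \<open>b\<^sup>2 = \<beta>\<^sup>2 (\<gamma> - u) (1 - u)\<close> the
  radicand is \<open>(x - L\<^sub>-) (L\<^sub>+ - x) - 4 \<beta> x u\<close>, affine in \<open>u\<close>, and integrating over \<open>u\<close> yields the
  claimed density.\<close>

section \<open>Chi and chi-square variables\<close>

text \<open>Two obstacles shape the proof. First, a test function in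
  \<open>bounded_locally_continuous\<close> is known only through balls, so the measurability of its
  value at a random graph has to be derived: the graph is factored through a countable product of
  coordinates, on which the value depends continuously. Second, \<open>spectral_pvm\<close> is an
  arbitrary choice, and \<open>is_spectral_pvm\<close> ties the operator to the measures only
  through first moments. A concrete witness makes the choice legitimate; this needs the Fourier
  transform to map onto \<open>l2 UNIV\<close>, that is, completeness (Riesz-Fischer). To identify
  an arbitrary choice, the higher moments have to be recovered from the first ones: a symmetric
  operator is controlled in norm by its quadratic form, so the operator is close to step operators,
  whose powers are explicit. Bounded support then turns equality of moments into equality of
  measures.\<close>

lemma sets_chi_square [measurable_cong, simp]: "sets (chi_square k) = sets borel"
  by (simp add: chi_square_def)

lemma sets_chi [measurable_cong, simp]: "sets (chi k) = sets borel"
  by (simp add: chi_def)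

lemma space_chi_square [simp]: "space (chi_square k) = UNIV"
  by (simp add: chi_square_def)

lemma AE_chi_square_pos:
  assumes "k > 0" shows "AE x in chi_square k. 0 < x"
  using assms unfolding chi_square_def by (simp add: AE_density)

text \<open>The substitution \<open>x = 2 * t\<close> turns the moment into a Gamma integral, and
  \<open>Gamma (k / 2 + m) / Gamma (k / 2)\<close> is a Pochhammer symbol. Computing in
  \<open>ennreal\<close> yields integrability along with the value, and \<open>m = 0\<close> gives
  total mass 1.\<close>

lemma nn_integral_chi_square_power:
  assumes k: "k > 0"
  shows "(\<integral>\<^sup>+x. ennreal (x ^ m) \<partial>chi_square k) = ennreal (2 ^ m * pochhammer (k / 2) m)"
proof -
  define c where "c = 2 powr (k / 2) * Gamma (k / 2)"
  have G: "Gamma (k / 2) > 0" using k by simp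
  have c: "c > 0" unfolding c_def using G by simp
  define p where "p = (\<lambda>x. if 0 < x then x powr (k / 2 - 1) * exp (- x / 2) / c else 0)"
  have [measurable]: "p \<in> borel_measurable borel" unfolding p_def by measurable
  have p: "p x \<ge> 0" for x using c by (simp add: p_def)
  have "(\<integral>\<^sup>+x. ennreal (x ^ m) \<partial>chi_square k) = (\<integral>\<^sup>+x. ennreal (p x) * ennreal (x ^ m) \<partial>lborel)"
    unfolding chi_square_def using k
    by (simp add: nn_integral_density p_def c_def if_distrib cong: if_cong)
  also have "\<dots> = (\<integral>\<^sup>+x. ennreal (if 0 < x then x powr (k / 2 + m - 1) * exp (- x / 2) / c else 0) \<partial>lborel)"
  proof (rule nn_integral_cong)
    fix x
    show "ennreal (p x) * ennreal (x ^ m) = ennreal (if 0 < x then x powr (k / 2 + m - 1) * exp (- x / 2) / c else 0)"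
    proof (cases "0 < x")
      case True
      have "x powr (k / 2 + m - 1) = x powr (k / 2 - 1) * x ^ m"
        using True by (simp add: powr_add[symmetric] powr_realpow[symmetric] algebra_simps)
      then show ?thesis using True p[of x]
        by (simp add: p_def ennreal_mult[symmetric] mult_ac)
    qed (simp add: p_def)
  qed
  also have "\<dots> = 2 * (\<integral>\<^sup>+t. ennreal (if 0 < 2 * t then (2 * t) powr (k / 2 + m - 1) * exp (- (2 * t) / 2) / c else 0) \<partial>lborel)"
    by (subst nn_integral_real_affine[where c=2 and t=0]) (simp_all cong: if_cong)
  also have "\<dots> = 2 * (\<integral>\<^sup>+t. ennreal (2 powr (k / 2 + m - 1) / c) * ennreal (indicator {0..} t * t powr (k / 2 + m - 1) / exp t) \<partial>lborel)"
  proof (rule arg_cong[where f="\<lambda>x. 2 * x"], rule nn_integral_cong)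
    fix t :: real
    show "ennreal (if 0 < 2 * t then (2 * t) powr (k / 2 + m - 1) * exp (- (2 * t) / 2) / c else 0)
       = ennreal (2 powr (k / 2 + m - 1) / c) * ennreal (indicator {0..} t * t powr (k / 2 + m - 1) / exp t)"
    proof (cases "0 < t")
      case True
      have e: "(2 * t) powr (k / 2 + m - 1) * exp (- (2 * t) / 2) / c
          = 2 powr (k / 2 + m - 1) / c * (t powr (k / 2 + m - 1) / exp t)"
      proof -
        have "(2 * t) powr (k / 2 + m - 1) = 2 powr (k / 2 + m - 1) * t powr (k / 2 + m - 1)"
          by (rule powr_mult)
        moreover have "exp (- (2 * t) / 2) = 1 / exp t" by (simp add: exp_minus inverse_eq_divide)
        ultimately show ?thesis by (simp only: times_divide_eq_left times_divide_eq_right mult_1_right divide_divide_eq_left mult.commute)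
      qed
      have "ennreal (2 powr (k / 2 + m - 1) / c * (t powr (k / 2 + m - 1) / exp t))
          = ennreal (2 powr (k / 2 + m - 1) / c) * ennreal (t powr (k / 2 + m - 1) / exp t)"
        by (rule ennreal_mult; intro divide_nonneg_nonneg powr_ge_zero exp_ge_zero less_imp_le[OF c])
      moreover have "indicator {0..} t = (1::real)" using True by simp
      ultimately show ?thesis
        using True unfolding e by (simp only: mult_1_left) simp
    next
      case False
      \<comment> \<open>The indicator leaves only \<open>t = 0\<close> here, where both sides vanish
        since \<open>0 powr a = 0\<close>.\<close>
      then show ?thesis by (cases "t = 0") auto
    qed
  qed
  also have "\<dots> = 2 * (ennreal (2 powr (k / 2 + m - 1) / c) * ennreal (Gamma (k / 2 + m)))"
    using k by (subst nn_integral_cmult) (simp_all add: Gamma_conv_nn_integral_real)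
  also have "\<dots> = ennreal (2 * (2 powr (k / 2 + m - 1) / c * Gamma (k / 2 + m)))"
  proof -
    have A: "0 \<le> 2 powr (k / 2 + m - 1) / c" using c by (intro divide_nonneg_nonneg) auto
    have B: "0 \<le> Gamma (k / 2 + m)" using k by (intro less_imp_le Gamma_real_pos) simp
    show ?thesis
      by (simp only: ennreal_mult[OF zero_le_numeral mult_nonneg_nonneg[OF A B]] ennreal_mult[OF A B] ennreal_numeral)
  qed
  also have "2 * (2 powr (k / 2 + m - 1) / c * Gamma (k / 2 + m)) = 2 ^ m * pochhammer (k / 2) m"
  proof -
    have "Gamma (k / 2 + m) = pochhammer (k / 2) m * Gamma (k / 2)"
    proof -
      have "k / 2 \<notin> \<int>\<^sub>\<le>\<^sub>0" using nonpos_Ints_nonpos[of "k / 2"] k by linarith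
      then show ?thesis using pochhammer_Gamma[of "k / 2" m] G by simp
    qed
    moreover have "2 * 2 powr (k / 2 + m - 1) = 2 powr (k / 2) * 2 ^ m"
      by (simp add: powr_diff powr_add powr_realpow)
    ultimately show ?thesis using G by (simp add: c_def field_simps)
  qed
  finally show ?thesis .
qed

lemma prob_space_chi_square:
  assumes "k > 0" shows "prob_space (chi_square k)"
  by (rule prob_spaceI) (use nn_integral_chi_square_power[OF assms, of 0] in simp)

lemma has_bochner_integral_chi_square_power:
  assumes k: "k > 0"
  shows "has_bochner_integral (chi_square k) (\<lambda>x. x ^ m) (2 ^ m * pochhammer (k / 2) m)"
proof (rule has_bochner_integral_nn_integral)
  show "AE x in chi_square k. 0 \<le> x ^ m"
    using AE_chi_square_pos[OF k] by eventually_elim simp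
qed (use k in \<open>auto simp: nn_integral_chi_square_power pochhammer_nonneg\<close>)

lemma AE_chi_square_pair_pos:
  assumes a: "a > 0" and b: "b > 0"
  shows "AE z in chi_square a \<Otimes>\<^sub>M chi_square b. 0 < fst z \<and> 0 < snd z"
proof -
  interpret A: prob_space "chi_square a" by (rule prob_space_chi_square[OF a])
  interpret B: prob_space "chi_square b" by (rule prob_space_chi_square[OF b])
  interpret AB: pair_sigma_finite "chi_square a" "chi_square b" ..
  show ?thesis
  proof (rule AB.AE_pair_measure)
    show "{z \<in> space (chi_square a \<Otimes>\<^sub>M chi_square b). 0 < fst z \<and> 0 < snd z}
        \<in> sets (chi_square a \<Otimes>\<^sub>M chi_square b)" by measurable
    show "AE x in chi_square a. AE y in chi_square b. 0 < fst (x, y) \<and> 0 < snd (x, y)"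
      using AE_chi_square_pos[OF a]
    proof eventually_elim
      case (elim x)
      show ?case using AE_chi_square_pos[OF b] by eventually_elim (simp add: elim)
    qed
  qed
qed

lemma has_bochner_integral_chi_square_prod_power:
  assumes a: "a > 0" and b: "b > 0"
  shows "has_bochner_integral (chi_square a \<Otimes>\<^sub>M chi_square b) (\<lambda>(x, y). (x * y) ^ m)
    ((2 ^ m * pochhammer (a / 2) m) * (2 ^ m * pochhammer (b / 2) m))"
proof -
  interpret A: prob_space "chi_square a" by (rule prob_space_chi_square[OF a])
  interpret B: prob_space "chi_square b" by (rule prob_space_chi_square[OF b])
  interpret pair_sigma_finite "chi_square a" "chi_square b" ..
  note pos = AE_chi_square_pair_pos[OF a b]
  show ?thesis
  proof (rule has_bochner_integral_nn_integral)
    show "AE z in chi_square a \<Otimes>\<^sub>M chi_square b. 0 \<le> (case z of (x, y) \<Rightarrow> (x * y) ^ m)"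
      using pos by eventually_elim (auto simp: split_beta)
    have "(\<integral>\<^sup>+z. ennreal (case z of (x, y) \<Rightarrow> (x * y) ^ m) \<partial>(chi_square a \<Otimes>\<^sub>M chi_square b))
      = (\<integral>\<^sup>+z. ennreal (fst z ^ m) * ennreal (snd z ^ m) \<partial>(chi_square a \<Otimes>\<^sub>M chi_square b))"
      by (rule nn_integral_cong_AE)
         (use pos in eventually_elim, auto simp: split_beta power_mult_distrib ennreal_mult)
    also have "\<dots> = (\<integral>\<^sup>+x. (\<integral>\<^sup>+y. ennreal (x ^ m) * ennreal (y ^ m) \<partial>chi_square b) \<partial>chi_square a)"
      by (subst B.nn_integral_fst[symmetric]) auto
    also have "\<dots> = (\<integral>\<^sup>+x. ennreal (x ^ m) * ennreal (2 ^ m * pochhammer (b / 2) m) \<partial>chi_square a)"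
      by (subst nn_integral_cmult) (simp_all add: nn_integral_chi_square_power b)
    also have "\<dots> = ennreal (2 ^ m * pochhammer (a / 2) m) * ennreal (2 ^ m * pochhammer (b / 2) m)"
      by (subst nn_integral_multc) (simp_all add: nn_integral_chi_square_power a)
    also have "\<dots> = ennreal ((2 ^ m * pochhammer (a / 2) m) * (2 ^ m * pochhammer (b / 2) m))"
      using a b by (simp add: ennreal_mult pochhammer_nonneg)
    finally show "(\<integral>\<^sup>+z. ennreal (case z of (x, y) \<Rightarrow> (x * y) ^ m) \<partial>(chi_square a \<Otimes>\<^sub>M chi_square b))
      = ennreal ((2 ^ m * pochhammer (a / 2) m) * (2 ^ m * pochhammer (b / 2) m))" .
  qed (use a b in \<open>auto simp: pochhammer_nonneg split_beta\<close>)
qed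

section \<open>Second moments and tail bounds\<close>

lemma pochhammer_half_2: "2\<^sup>2 * pochhammer (k / 2) 2 = k * (k + 2)" for k :: real
  by (simp add: pochhammer_Suc numeral_2_eq_2 field_simps)

text \<open>Chebyshev's inequality centred at an arbitrary \<open>e\<close> rather than at the mean,
  so that \<open>e\<close> can be the limiting weight and the drift of the mean is absorbed. The
  event \<open>S\<close> only has to imply a deviation of \<open>u\<close>: for products of chi
  variables it is an event about the square root of \<open>u\<close>.\<close>

lemma second_moment_tail:
  assumes "prob_space M" and d: "d > 0"
    and u1: "has_bochner_integral M u m1" and u2: "has_bochner_integral M (\<lambda>x. (u x)\<^sup>2) m2"
    and S: "S \<in> sets M" "AE x in M. x \<in> S \<longrightarrow> d \<le> \<bar>u x / r - e\<bar>"
  shows "measure M S \<le> (m2 / r\<^sup>2 - 2 * e * m1 / r + e\<^sup>2) / d\<^sup>2"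
proof -
  interpret prob_space M by fact
  have eq: "(\<lambda>x. (u x / r - e)\<^sup>2) = (\<lambda>x. (u x)\<^sup>2 / r\<^sup>2 - 2 * e / r * u x + e\<^sup>2)"
    by (auto simp: power2_diff power_divide)
  have i: "has_bochner_integral M (\<lambda>x. (u x / r - e)\<^sup>2) (m2 / r\<^sup>2 - 2 * e / r * m1 + e\<^sup>2)"
    unfolding eq using u1 u2 prob_space
    by (auto simp: has_bochner_integral_iff)
  have "measure M S = (LINT x|M. indicator S x)" using S(1) by simp
  also have "\<dots> \<le> (LINT x|M. (u x / r - e)\<^sup>2 / d\<^sup>2)"
  proof (rule integral_mono_AE)
    show "AE x in M. indicator S x \<le> (u x / r - e)\<^sup>2 / d\<^sup>2"
      using S(2)
    proof eventually_elim
      case (elim x)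
      have "1 \<le> (u x / r - e)\<^sup>2 / d\<^sup>2" if "x \<in> S"
        using d power_mono[of d "\<bar>u x / r - e\<bar>" 2] elim that by simp
      then show ?case by (auto simp: indicator_def)
    qed
  qed (use i S in \<open>auto simp: has_bochner_integral_iff integrable_indicator_iff emeasure_eq_measure\<close>)
  also have "\<dots> = (m2 / r\<^sup>2 - 2 * e / r * m1 + e\<^sup>2) / d\<^sup>2"
    using i by (simp add: has_bochner_integral_iff)
  finally show ?thesis by simp
qed

lemma chi_square_tail:
  assumes law: "has_law M X (distr (chi_square k) borel (\<lambda>x. x / real n))" and k: "k > 0" and d: "d > 0"
  shows "measure M {\<omega>\<in>space M. d \<le> \<bar>X \<omega> - c\<bar>} \<le> (k * (k + 2) / (real n)\<^sup>2 - 2 * c * k / real n + c\<^sup>2) / d\<^sup>2"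
proof -
  have [measurable]: "X \<in> borel_measurable M" using law by (simp add: has_law_def)
  have "measure M {\<omega>\<in>space M. d \<le> \<bar>X \<omega> - c\<bar>} = measure (distr M borel X) {x. d \<le> \<bar>x - c\<bar>}"
    by (subst measure_distr) (auto intro!: arg_cong[where f="measure M"])
  also have "\<dots> = measure (chi_square k) {x. d \<le> \<bar>x / real n - c\<bar>}"
    using law unfolding has_law_def by (simp add: measure_distr vimage_def)
  also have "\<dots> \<le> (k * (k + 2) / (real n)\<^sup>2 - 2 * c * k / real n + c\<^sup>2) / d\<^sup>2"
  proof (rule second_moment_tail[OF prob_space_chi_square[OF k] d, where u="\<lambda>x. x"])
    show "has_bochner_integral (chi_square k) (\<lambda>x. x) k"
      using has_bochner_integral_chi_square_power[OF k, of 1] by simp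
    show "has_bochner_integral (chi_square k) (\<lambda>x. x\<^sup>2) (k * (k + 2))"
      using has_bochner_integral_chi_square_power[OF k, of 2] unfolding pochhammer_half_2 .
  qed auto
  finally show ?thesis .
qed

text \<open>Chebyshev's inequality is applied to the square of the product, whose moments are rational;
  a deviation of at least \<open>d\<close> of the product from \<open>c \<ge> 0\<close> forces one of at least
  \<open>d\<^sup>2\<close> of its square from \<open>c\<^sup>2\<close>.\<close>

lemma chi_prod_tail:
  assumes law: "has_law M X (distr (chi a \<Otimes>\<^sub>M chi b) borel (\<lambda>(x, y). x * y / real n))"
    and a: "a > 0" and b: "b > 0" and d: "d > 0" and c: "c \<ge> 0"
  shows "measure M {\<omega>\<in>space M. d \<le> \<bar>X \<omega> - c\<bar>}
    \<le> (a * (a + 2) * (b * (b + 2)) / ((real n)\<^sup>2)\<^sup>2 - 2 * c\<^sup>2 * (a * b) / (real n)\<^sup>2 + (c\<^sup>2)\<^sup>2) / (d\<^sup>2)\<^sup>2"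
proof -
  interpret A: prob_space "chi_square a" by (rule prob_space_chi_square[OF a])
  interpret B: prob_space "chi_square b" by (rule prob_space_chi_square[OF b])
  interpret AB: pair_prob_space "chi_square a" "chi_square b" ..
  let ?P = "chi_square a \<Otimes>\<^sub>M chi_square b"
  have [measurable]: "X \<in> borel_measurable M" using law by (simp add: has_law_def)
  \<comment> \<open>Chi variables are square roots of chi-square variables, so the law is pulled
    back to a chi-square pair, whose moments are known.\<close>
  have "chi a \<Otimes>\<^sub>M chi b = distr ?P (borel \<Otimes>\<^sub>M borel) (\<lambda>(x, y). (sqrt x, sqrt y))"
    unfolding chi_def
    by (rule pair_measure_distr) (auto intro!: prob_space_imp_sigma_finite B.prob_space_distr)
  then have D: "distr M borel X = distr ?P borel (\<lambda>(x, y). sqrt x * sqrt y / real n)"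
    using law unfolding has_law_def by (simp add: distr_distr comp_def split_beta')
  have "measure M {\<omega>\<in>space M. d \<le> \<bar>X \<omega> - c\<bar>} = measure (distr M borel X) {x. d \<le> \<bar>x - c\<bar>}"
    by (subst measure_distr) (auto intro!: arg_cong[where f="measure M"])
  also have "\<dots> = measure ?P {z. d \<le> \<bar>sqrt (fst z) * sqrt (snd z) / real n - c\<bar>}"
    unfolding D by (subst measure_distr) (auto simp: vimage_def split_beta space_pair_measure)
  also have "\<dots> \<le> (a * (a + 2) * (b * (b + 2)) / ((real n)\<^sup>2)\<^sup>2 - 2 * c\<^sup>2 * (a * b) / (real n)\<^sup>2 + (c\<^sup>2)\<^sup>2) / (d\<^sup>2)\<^sup>2"
  proof (rule second_moment_tail[where u="\<lambda>(x, y). x * y"])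
    show "prob_space ?P" by (rule AB.prob_space_axioms)
    show "has_bochner_integral ?P (\<lambda>(x, y). x * y) (a * b)"
      using has_bochner_integral_chi_square_prod_power[OF a b, of 1] by simp
    show "has_bochner_integral ?P (\<lambda>z. (case z of (x, y) \<Rightarrow> x * y)\<^sup>2) (a * (a + 2) * (b * (b + 2)))"
      using has_bochner_integral_chi_square_prod_power[OF a b, of 2]
      unfolding pochhammer_half_2 by (simp add: split_beta')
    have "{z \<in> space ?P. d \<le> \<bar>sqrt (fst z) * sqrt (snd z) / real n - c\<bar>} \<in> sets ?P" by measurable
    then show "{z. d \<le> \<bar>sqrt (fst z) * sqrt (snd z) / real n - c\<bar>} \<in> sets ?P"
      by (simp add: space_pair_measure)
    show "AE z in ?P. z \<in> {z. d \<le> \<bar>sqrt (fst z) * sqrt (snd z) / real n - c\<bar>}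
        \<longrightarrow> d\<^sup>2 \<le> \<bar>(case z of (x, y) \<Rightarrow> x * y) / (real n)\<^sup>2 - c\<^sup>2\<bar>"
      using AE_chi_square_pair_pos[OF a b]
    proof eventually_elim
      case (elim z)
      define w where "w = sqrt (fst z) * sqrt (snd z) / real n"
      have w: "w \<ge> 0" "w\<^sup>2 = fst z * snd z / (real n)\<^sup>2"
        using elim by (auto simp: w_def power_mult_distrib power_divide)
      have "d\<^sup>2 \<le> \<bar>w\<^sup>2 - c\<^sup>2\<bar>" if "d \<le> \<bar>w - c\<bar>"
      proof -
        \<comment> \<open>For nonnegative \<open>w\<close> and \<open>c\<close> the sum
          \<open>w + c\<close> is at least \<open>\<bar>w - c\<bar>\<close>, hence at least
          \<open>d\<close>.\<close>
        have "d * d \<le> \<bar>w - c\<bar> * (w + c)"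
          using that d w(1) c by (intro mult_mono) auto
        also have "\<dots> = \<bar>(w - c) * (w + c)\<bar>" using w(1) c by (simp add: abs_mult)
        finally show ?thesis by (simp add: power2_eq_square algebra_simps)
      qed
      then show ?case using w by (simp add: w_def[symmetric] split_beta)
    qed
  qed (use d in simp)
  finally show ?thesis .
qed

section \<open>Graphs of banded matrices\<close>

text \<open>Contains both the matrix graphs and the limiting graph, so that one computation of balls
  and one family of isomorphisms, the translations, serve for both.\<close>

definition band_graph :: "int set \<Rightarrow> (int \<Rightarrow> int \<Rightarrow> real) \<Rightarrow> int wgraph" where
  "band_graph I w = \<lparr>verts = I, edges = {(i, j). i \<in> I \<and> j \<in> I \<and> \<bar>i - j\<bar> \<le> 1}, weight = w\<rparr>"

text \<open>Order-convexity: it keeps the shortest path between two vertices inside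
  \<open>I\<close>, so that the graph distance is \<open>\<bar>i - j\<bar>\<close>.\<close>

definition int_interval :: "int set \<Rightarrow> bool" where
  "int_interval I \<longleftrightarrow> (\<forall>i\<in>I. \<forall>k\<in>I. {i..k} \<subseteq> I)"

lemma int_interval_UNIV [simp]: "int_interval UNIV"
  and int_interval_atLeastLessThan [simp]: "int_interval {a..<b}"
  by (auto simp: int_interval_def)

lemma tridiagonal_band: "tridiagonal_graph n T = band_graph {0..<int n} T"
  by (simp add: tridiagonal_graph_def band_graph_def)

lemma laguerre_band: "laguerre_limit_graph \<beta> \<gamma> u = band_graph UNIV
   (\<lambda>i j. if i = j then \<beta> * (\<gamma> + 1 - 2 * u) else \<beta> * sqrt (\<gamma> - u) * sqrt (1 - u))"
  by (simp add: laguerre_limit_graph_def band_graph_def)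

text \<open>The loops allow walks that stand still, so a walk of \<open>k\<close> steps gives an
  upper bound on the distance only.\<close>

lemma band_relpow_dist:
  assumes "(x, v) \<in> edges (band_graph I w) ^^ k" "x \<in> I"
  shows "v \<in> I \<and> \<bar>v - x\<bar> \<le> int k"
  using assms(1)
proof (induction k arbitrary: v)
  case 0
  then show ?case using assms(2) by simp
next
  case (Suc k)
  then obtain y where y: "(x, y) \<in> edges (band_graph I w) ^^ k" "(y, v) \<in> edges (band_graph I w)"
    by auto
  show ?case using Suc.IH[OF y(1)] y(2) by (auto simp: band_graph_def)
qed

lemma band_relpow:
  assumes I: "int_interval I" and x: "x \<in> I"
  shows "v \<in> I \<Longrightarrow> \<bar>v - x\<bar> = int k \<Longrightarrow> (x, v) \<in> edges (band_graph I w) ^^ k"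
proof (induction k arbitrary: v)
  case (Suc k)
  \<comment> \<open>The neighbour of \<open>v\<close> one step closer to \<open>x\<close>; convexity
    keeps it inside \<open>I\<close>.\<close>
  define y where "y = (if v > x then v - 1 else v + 1)"
  have "y \<in> I"
  proof (cases "v > x")
    case True
    then have "y \<in> {x..v}" by (simp add: y_def)
    then show ?thesis using I x Suc.prems(1) unfolding int_interval_def by blast
  next
    case False
    then have "y \<in> {v..x}" using Suc.prems(2) by (simp add: y_def)
    then show ?thesis using I x Suc.prems(1) unfolding int_interval_def by blast
  qed
  moreover have "\<bar>y - x\<bar> = int k" using Suc.prems(2) by (auto simp: y_def)
  ultimately have "(x, y) \<in> edges (band_graph I w) ^^ k" by (rule Suc.IH)
  moreover have "(y, v) \<in> edges (band_graph I w)"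
    using \<open>y \<in> I\<close> Suc.prems(1) by (auto simp: band_graph_def y_def)
  ultimately show ?case by (rule relpow_Suc_I)
qed simp

lemma graph_ball_band:
  assumes "int_interval I" "x \<in> I"
  shows "graph_ball (band_graph I w) x r = band_graph {v \<in> I. \<bar>v - x\<bar> \<le> int r} w"
proof -
  have "{v. \<exists>k\<le>r. (x, v) \<in> edges (band_graph I w) ^^ k} = {v \<in> I. \<bar>v - x\<bar> \<le> int r}"
  proof (intro set_eqI iffI)
    fix v assume "v \<in> {v. \<exists>k\<le>r. (x, v) \<in> edges (band_graph I w) ^^ k}"
    then obtain k where "k \<le> r" "(x, v) \<in> edges (band_graph I w) ^^ k" by blast
    then show "v \<in> {v \<in> I. \<bar>v - x\<bar> \<le> int r}" using band_relpow_dist assms(2) by fastforce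
  next
    fix v assume "v \<in> {v \<in> I. \<bar>v - x\<bar> \<le> int r}"
    then have "(x, v) \<in> edges (band_graph I w) ^^ nat \<bar>v - x\<bar>" "nat \<bar>v - x\<bar> \<le> r"
      using band_relpow[OF assms] by auto
    then show "v \<in> {v. \<exists>k\<le>r. (x, v) \<in> edges (band_graph I w) ^^ k}" by blast
  qed
  then show ?thesis by (auto simp: graph_ball_def Let_def) (auto simp: band_graph_def)
qed

lemma card_3_le: "card {a, b, c} \<le> 3"
  by (auto intro!: order.trans[OF card_insert_le_m1])

lemma rooted_graph_band:
  assumes I: "int_interval I" and x: "x \<in> I"
    and w: "\<And>i j. i \<in> I \<Longrightarrow> j \<in> I \<Longrightarrow> \<bar>i - j\<bar> \<le> 1 \<Longrightarrow> w i j = w j i"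
    and bd: "\<And>i j. i \<in> I \<Longrightarrow> j \<in> I \<Longrightarrow> \<bar>i - j\<bar> \<le> 1 \<Longrightarrow> \<bar>w i j\<bar> \<le> C"
  shows "rooted_graph (band_graph I w) x"
  unfolding rooted_graph_def
proof (intro conjI)
  let ?G = "band_graph I w"
  have V: "verts ?G = I" by (simp add: band_graph_def)
  show "x \<in> verts ?G" using x by (simp add: V)
  show "edges ?G \<subseteq> verts ?G \<times> verts ?G" "sym (edges ?G)"
    by (auto simp: band_graph_def sym_def)
  show "\<forall>v\<in>verts ?G. \<forall>y\<in>verts ?G. (v, y) \<in> (edges ?G)\<^sup>*"
  proof (intro ballI)
    fix v y assume "v \<in> verts ?G" "y \<in> verts ?G"
    then have "(v, y) \<in> edges ?G ^^ nat \<bar>y - v\<bar>" using band_relpow[OF I] by (simp add: V)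
    then show "(v, y) \<in> (edges ?G)\<^sup>*" by (rule relpow_imp_rtrancl)
  qed
  have "finite {y. (v, y) \<in> edges ?G} \<and> card {y. (v, y) \<in> edges ?G} \<le> 3" for v
  proof -
    have sub: "{y. (v, y) \<in> edges ?G} \<subseteq> {v - 1, v, v + 1}" by (auto simp: band_graph_def)
    have "card {y. (v, y) \<in> edges ?G} \<le> card {v - 1, v, v + 1}" by (rule card_mono[OF _ sub]) simp
    also have "\<dots> \<le> 3" by (rule card_3_le)
    finally show ?thesis using finite_subset[OF sub] by blast
  qed
  then show "\<exists>D. \<forall>v\<in>verts ?G. finite {y. (v, y) \<in> edges ?G} \<and> card {y. (v, y) \<in> edges ?G} \<le> D" by blast
  show "\<forall>(v, y)\<in>edges ?G. weight ?G v y = weight ?G y v"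
    using w by (auto simp: band_graph_def)
  show "\<exists>C. \<forall>(v, y)\<in>edges ?G. \<bar>weight ?G v y\<bar> \<le> C"
    using bd by (intro exI[of _ C]) (auto simp: band_graph_def)
qed

lemma rooted_iso_band_shift:
  assumes "\<And>v. v \<in> B \<longleftrightarrow> v + s \<in> B'"
  shows "rooted_iso (\<lambda>v. v + s) (band_graph B w) x (band_graph B' w') (x + s)"
proof -
  have "bij_betw (\<lambda>v. v + s) B B'"
  proof (rule bij_betw_byWitness[where f'="\<lambda>v. v - s"])
    show "(\<lambda>v. v + s) ` B \<subseteq> B'" using assms by blast
    show "(\<lambda>v. v - s) ` B' \<subseteq> B"
    proof clarify
      fix v assume "v \<in> B'"
      then show "v - s \<in> B" using assms[of "v - s"] by simp
    qed
  qed auto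
  then show ?thesis
    unfolding rooted_iso_def band_graph_def using assms[THEN iffD1] by auto
qed

text \<open>The isomorphism is a translation. With \<open>s = 0\<close> two weightings of the same
  vertices are compared; with \<open>s\<close> the root of a matrix graph, that graph is compared
  with the limit at 0.\<close>

lemma locally_close_band:
  assumes I: "int_interval I" "x \<in> I" and I': "int_interval I'" "x + s \<in> I'"
    and ball: "\<And>v. \<bar>v - x\<bar> \<le> int r \<Longrightarrow> v \<in> I \<longleftrightarrow> v + s \<in> I'"
    and w: "\<And>i j. i \<in> I \<Longrightarrow> j \<in> I \<Longrightarrow> \<bar>i - x\<bar> \<le> int r \<Longrightarrow> \<bar>j - x\<bar> \<le> int r \<Longrightarrow> \<bar>i - j\<bar> \<le> 1 \<Longrightarrow>
        \<bar>w' (i + s) (j + s) - w i j\<bar> < \<delta>"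
  shows "locally_close r \<delta> (band_graph I w) x (band_graph I' w') (x + s)"
  unfolding locally_close_def graph_ball_band[OF I] graph_ball_band[OF I']
proof (intro exI conjI)
  show "rooted_iso (\<lambda>v. v + s) (band_graph {v \<in> I. \<bar>v - x\<bar> \<le> int r} w) x
      (band_graph {v \<in> I'. \<bar>v - (x + s)\<bar> \<le> int r} w') (x + s)"
    by (rule rooted_iso_band_shift) (use ball in \<open>auto simp: algebra_simps\<close>)
  show "\<forall>(v, y)\<in>edges (band_graph {v \<in> I. \<bar>v - x\<bar> \<le> int r} w).
      \<bar>weight (band_graph I' w') (v + s) (y + s) - weight (band_graph I w) v y\<bar> < \<delta>"
    using w by (auto simp: band_graph_def)
qed

lemma isomorphic_rooted_cong:
  assumes \<phi>: "rooted_iso \<phi> G x H y" and x: "x \<in> verts G"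
  shows "isomorphic_rooted K z G x \<longleftrightarrow> isomorphic_rooted K z H y"
proof
  assume "isomorphic_rooted K z G x"
  then obtain \<psi> where \<psi>: "rooted_iso \<psi> K z G x" by (auto simp: isomorphic_rooted_def)
  have "rooted_iso (\<phi> \<circ> \<psi>) K z H y"
    using \<phi> \<psi> unfolding rooted_iso_def
    by (auto intro: bij_betw_trans dest: bij_betwE)
  then show "isomorphic_rooted K z H y" by (auto simp: isomorphic_rooted_def)
next
  assume "isomorphic_rooted K z H y"
  then obtain \<psi> where \<psi>: "rooted_iso \<psi> K z H y" by (auto simp: isomorphic_rooted_def)
  define \<phi>' where "\<phi>' = inv_into (verts G) \<phi>"
  have b: "bij_betw \<phi> (verts G) (verts H)" using \<phi> by (simp add: rooted_iso_def)
  have b': "bij_betw \<phi>' (verts H) (verts G)" unfolding \<phi>'_def by (rule bij_betw_inv_into[OF b])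
  have c: "\<phi> (\<phi>' h) = h" if "h \<in> verts H" for h
    unfolding \<phi>'_def by (rule bij_betw_inv_into_right[OF b that])
  have "\<phi>' y = x" using \<phi> bij_betw_inv_into_left[OF b x] by (auto simp: rooted_iso_def \<phi>'_def)
  moreover have "(v, u) \<in> edges H \<longleftrightarrow> (\<phi>' v, \<phi>' u) \<in> edges G" if "v \<in> verts H" "u \<in> verts H" for v u
  proof -
    have "\<phi>' v \<in> verts G" "\<phi>' u \<in> verts G" using b' that by (auto dest: bij_betwE)
    then show ?thesis using \<phi> c that by (simp add: rooted_iso_def)
  qed
  ultimately have "rooted_iso (\<phi>' \<circ> \<psi>) K z G x"
    using \<psi> b' unfolding rooted_iso_def
    by (auto intro: bij_betw_trans dest: bij_betwE)
  then show "isomorphic_rooted K z G x" by (auto simp: isomorphic_rooted_def)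
qed

text \<open>\<open>rooted_iso\<close> ignores weights, so \<open>w\<close> and \<open>w'\<close> are
  unrelated; this allows random weights to be traded for zero weights.\<close>

lemma isomorphic_rooted_ball_band:
  assumes I: "int_interval I" "x \<in> I" and I': "int_interval I'" "x + s \<in> I'"
    and ball: "\<And>v. \<bar>v - x\<bar> \<le> int r \<Longrightarrow> v \<in> I \<longleftrightarrow> v + s \<in> I'"
  shows "isomorphic_rooted K z (graph_ball (band_graph I w) x r) x
    \<longleftrightarrow> isomorphic_rooted K z (graph_ball (band_graph I' w') (x + s) r) (x + s)"
  unfolding graph_ball_band[OF I] graph_ball_band[OF I']
proof (rule isomorphic_rooted_cong)
  show "rooted_iso (\<lambda>v. v + s) (band_graph {v \<in> I. \<bar>v - x\<bar> \<le> int r} w) x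
      (band_graph {v \<in> I'. \<bar>v - (x + s)\<bar> \<le> int r} w') (x + s)"
    by (rule rooted_iso_band_shift) (use ball in \<open>auto simp: algebra_simps\<close>)
qed (use I in \<open>auto simp: band_graph_def\<close>)

text \<open>\<open>weight\<close> is a total function, so graphs that agree on all edges may still
  differ as records; test functions cannot see the difference.\<close>

lemma bounded_locally_continuous_eq:
  assumes F: "bounded_locally_continuous F" and "rooted_graph G x" "rooted_graph H y"
    and close: "\<And>r \<delta>. \<delta> > 0 \<Longrightarrow> locally_close r \<delta> G x H y"
  shows "F H y = F G x"
proof -
  have "\<bar>F H y - F G x\<bar> < e" if "e > 0" for e
    using F assms(2,3) close that unfolding bounded_locally_continuous_def by meson
  then have "\<bar>F H y - F G x\<bar> \<le> 0" by (metis less_irrefl not_le)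
  then show ?thesis by simp
qed

text \<open>Translates the condition on balls into convergence along a filter, from which continuity
  in parameters of the weights follows.\<close>

lemma bounded_locally_continuous_limit:
  assumes F: "bounded_locally_continuous F" and G: "rooted_graph G x"
    and H: "\<forall>\<^sub>F p in \<F>. rooted_graph (H p) (y p)"
    and close: "\<And>r \<delta>. \<delta> > 0 \<Longrightarrow> \<forall>\<^sub>F p in \<F>. locally_close r \<delta> G x (H p) (y p)"
  shows "((\<lambda>p. F (H p) (y p)) \<longlongrightarrow> F G x) \<F>"
proof (rule tendstoI)
  fix e :: real assume "e > 0"
  then obtain r \<delta> where "\<delta> > 0" and *: "\<And>H y. rooted_graph H y \<Longrightarrow> locally_close r \<delta> G x H y \<Longrightarrow> \<bar>F H y - F G x\<bar> < e"
    using F G unfolding bounded_locally_continuous_def by meson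
  show "\<forall>\<^sub>F p in \<F>. dist (F (H p) (y p)) (F G x) < e"
    using H close[OF \<open>\<delta> > 0\<close>, of r] by eventually_elim (simp add: * dist_real_def)
qed

section \<open>Local weak convergence\<close>

lemma beta_laguerreD:
  assumes "beta_laguerre M \<beta> \<gamma> n T"
  shows "prob_space M"
    and "\<omega> \<in> space M \<Longrightarrow> i \<in> {0..<int n} \<Longrightarrow> j \<in> {0..<int n} \<Longrightarrow> T \<omega> i j = T \<omega> j i"
    and "has_law M (\<lambda>\<omega>. T \<omega> 0 0) (distr (chi_square (2 * (\<beta> * \<gamma> * (real n - 1) / 2))) borel (\<lambda>x. x / n))"
    and "j \<in> {1..int n - 1} \<Longrightarrow> has_law M (\<lambda>\<omega>. T \<omega> j j)
       (distr (chi_square (\<beta> * \<gamma> * (real n - 1) + \<beta> * (real n - 2 * real_of_int j))) borel (\<lambda>x. x / n))"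
    and "j \<in> {1..int n - 1} \<Longrightarrow> has_law M (\<lambda>\<omega>. T \<omega> (j - 1) j)
       (distr (chi (\<beta> * \<gamma> * (real n - 1) - \<beta> * (real_of_int j - 1)) \<Otimes>\<^sub>M chi (\<beta> * (real n - real_of_int j)))
          borel (\<lambda>(x, y). x * y / n))"
  using assms unfolding beta_laguerre_def Let_def by auto

section \<open>The random rooted graphs and measurability of test functions\<close>

lemma rooted_graph_tridiagonal:
  assumes T: "beta_laguerre M \<beta> \<gamma> n T" and \<omega>: "\<omega> \<in> space M" and j: "j \<in> {0..<int n}"
  shows "rooted_graph (tridiagonal_graph n (T \<omega>)) j"
  unfolding tridiagonal_band
proof (rule rooted_graph_band)
  show "T \<omega> i k = T \<omega> k i" if "i \<in> {0..<int n}" "k \<in> {0..<int n}" for i k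
    using beta_laguerreD(2)[OF T \<omega> that] .
  show "\<bar>T \<omega> i k\<bar> \<le> Max ((\<lambda>(i, k). \<bar>T \<omega> i k\<bar>) ` ({0..<int n} \<times> {0..<int n}))"
    if "i \<in> {0..<int n}" "k \<in> {0..<int n}" for i k
    using that by (intro Max_ge) force+
qed (use j in auto)

lemma rooted_graph_laguerre: "rooted_graph (laguerre_limit_graph \<beta> \<gamma> u) v"
  unfolding laguerre_band
  by (rule rooted_graph_band[where C="max \<bar>\<beta> * (\<gamma> + 1 - 2 * u)\<bar> \<bar>\<beta> * sqrt (\<gamma> - u) * sqrt (1 - u)\<bar>"]) auto

text \<open>Laws are prescribed on the diagonal and just above it; entries below the diagonal are
  recovered from symmetry on \<open>space M\<close>.\<close>

lemma measurable_entry: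
  assumes T: "beta_laguerre M \<beta> \<gamma> n T" and i: "i \<in> {0..<int n}" and k: "k \<in> {0..<int n}" and "k = i \<or> k = i + 1"
  shows "(\<lambda>\<omega>. T \<omega> i k) \<in> borel_measurable M"
proof (cases "k = i")
  case True
  show ?thesis
  proof (cases "i = 0")
    case True
    then show ?thesis using beta_laguerreD(3)[OF T] \<open>k = i\<close> by (simp add: has_law_def)
  next
    case False
    then show ?thesis using beta_laguerreD(4)[OF T, of i] i \<open>k = i\<close> by (simp add: has_law_def)
  qed
next
  case False
  then show ?thesis using beta_laguerreD(5)[OF T, of k] i k assms(4) by (simp add: has_law_def)
qed

text \<open>The graph is factored through functions on \<open>int \<times> int\<close> with the
  product topology. The map \<open>S\<close> into them is measurable coordinatewise, and the test
  value is continuous there because only finitely many coordinates matter.\<close>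

lemma measurable_tridiagonal:
  assumes T: "beta_laguerre M \<beta> \<gamma> n T" and F: "bounded_locally_continuous F" and j: "j \<in> {0..<int n}"
  shows "(\<lambda>\<omega>. F (tridiagonal_graph n (T \<omega>)) j) \<in> borel_measurable M"
proof -
  let ?I = "{0..<int n}"
  \<comment> \<open>Reading only positions on or above the diagonal makes every coordinate function
    \<open>p\<close> a symmetric weighting, so that the test value is controlled on the whole
    parameter space.\<close>
  define sym :: "(int \<times> int \<Rightarrow> real) \<Rightarrow> int \<Rightarrow> int \<Rightarrow> real"
    where "sym p i k = p (min i k, max i k)" for p i k
  \<comment> \<open>Entries outside the two diagonals with prescribed laws are set to 0, so that
    every coordinate is measurable.\<close>
  define S where "S \<omega> = (\<lambda>(i, k). if i \<in> ?I \<and> k \<in> ?I \<and> (k = i \<or> k = i + 1) then T \<omega> i k else 0)" for \<omega>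
  have S_m: "S \<in> borel_measurable M"
  proof (rule measurable_coordinatewise_then_product)
    fix e :: "int \<times> int"
    obtain i k where e: "e = (i, k)" by (cases e)
    show "(\<lambda>\<omega>. S \<omega> e) \<in> borel_measurable M"
    proof (cases "i \<in> ?I \<and> k \<in> ?I \<and> (k = i \<or> k = i + 1)")
      case True
      then have "(\<lambda>\<omega>. T \<omega> i k) \<in> borel_measurable M" using measurable_entry[OF T, of i k] by blast
      moreover have "(\<lambda>\<omega>. S \<omega> e) = (\<lambda>\<omega>. T \<omega> i k)" using True by (auto simp: S_def e)
      ultimately show ?thesis by simp
    next
      case False
      then have "(\<lambda>\<omega>. S \<omega> e) = (\<lambda>\<omega>. 0)" by (auto simp: S_def e)
      then show ?thesis by simp
    qed
  qed
  have rooted: "rooted_graph (band_graph ?I (sym p)) j" for p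
  proof (rule rooted_graph_band)
    show "\<bar>sym p i k\<bar> \<le> Max ((\<lambda>(i, k). \<bar>sym p i k\<bar>) ` (?I \<times> ?I))"
      if "i \<in> ?I" "k \<in> ?I" for i k
      using that by (intro Max_ge) force+
  qed (use j in \<open>auto simp: sym_def min.commute max.commute\<close>)
  have "isCont (\<lambda>p. F (band_graph ?I (sym p)) j) p" for p
    unfolding isCont_def
  proof (rule bounded_locally_continuous_limit[OF F rooted])
    fix r and \<delta> :: real assume "\<delta> > 0"
    have "\<forall>\<^sub>F q in at p. \<bar>q e - p e\<bar> < \<delta>" for e
    proof -
      have "continuous_on UNIV (\<lambda>q :: int \<times> int \<Rightarrow> real. q e)"
        by (rule continuous_on_product_coordinates)
      then have "((\<lambda>q. q e) \<longlongrightarrow> p e) (at p)"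
        unfolding continuous_on_eq_continuous_at[OF open_UNIV] isCont_def by blast
      from tendstoD[OF this \<open>\<delta> > 0\<close>] show ?thesis by (simp add: dist_real_def)
    qed
    then have "\<forall>\<^sub>F q in at p. \<forall>e\<in>?I \<times> ?I. \<bar>q e - p e\<bar> < \<delta>"
      by (intro eventually_ball_finite) auto
    then show "\<forall>\<^sub>F q in at p. locally_close r \<delta> (band_graph ?I (sym p)) j (band_graph ?I (sym q)) j"
    proof eventually_elim
      case (elim q)
      have "locally_close r \<delta> (band_graph ?I (sym p)) j (band_graph ?I (sym q)) (j + 0)"
        by (rule locally_close_band) (use j elim in \<open>auto simp: sym_def min_def max_def\<close>)
      then show ?case by simp
    qed
  qed (simp add: rooted)
  then have "(\<lambda>p. F (band_graph ?I (sym p)) j) \<in> borel_measurable borel"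
    by (intro borel_measurable_continuous_onI continuous_at_imp_continuous_on) auto
  then have m: "(\<lambda>\<omega>. F (band_graph ?I (sym (S \<omega>))) j) \<in> borel_measurable M"
    by (rule measurable_compose[OF S_m])
  \<comment> \<open>The two weight functions may differ away from the band, so equality is claimed
    only after applying \<open>F\<close>.\<close>
  have "F (band_graph ?I (sym (S \<omega>))) j = F (tridiagonal_graph n (T \<omega>)) j" if \<omega>: "\<omega> \<in> space M" for \<omega>
  proof (rule bounded_locally_continuous_eq[OF F rooted_graph_tridiagonal[OF T \<omega> j] rooted])
    fix r and \<delta> :: real assume "\<delta> > 0"
    have "sym (S \<omega>) i k = T \<omega> i k" if "i \<in> ?I" "k \<in> ?I" "\<bar>i - k\<bar> \<le> 1" for i k
    proof -
      have "max i k = min i k \<or> max i k = min i k + 1" using that(3) by auto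
      moreover have "min i k \<in> ?I" "max i k \<in> ?I" using that(1,2) by (auto simp: min_def max_def)
      ultimately have "sym (S \<omega>) i k = T \<omega> (min i k) (max i k)" by (simp add: sym_def S_def)
      then show ?thesis using beta_laguerreD(2)[OF T \<omega> that(1,2)] by (auto simp: min_def max_def)
    qed
    then have "locally_close r \<delta> (tridiagonal_graph n (T \<omega>)) j (band_graph ?I (sym (S \<omega>))) (j + 0)"
      unfolding tridiagonal_band by (intro locally_close_band) (use j \<open>\<delta> > 0\<close> in auto)
    then show "locally_close r \<delta> (tridiagonal_graph n (T \<omega>)) j (band_graph ?I (sym (S \<omega>))) j" by simp
  qed
  then show ?thesis using m by (simp cong: measurable_cong)
qed

lemma measurable_tridiagonal_pair:
  assumes T: "beta_laguerre M \<beta> \<gamma> n T" and F: "bounded_locally_continuous F"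
  shows "(\<lambda>(\<omega>, j). F (tridiagonal_graph n (T \<omega>)) j) \<in> borel_measurable (M \<Otimes>\<^sub>M uniform_count_measure {0..<int n})"
proof -
  have "(\<lambda>z. F (tridiagonal_graph n (T (fst z))) (snd z)) \<in> borel_measurable (M \<Otimes>\<^sub>M count_space {0..<int n})"
  proof (rule measurable_compose_countable'[where f="\<lambda>j z. F (tridiagonal_graph n (T (fst z))) j" and I="{0..<int n}"])
    show "(\<lambda>z. F (tridiagonal_graph n (T (fst z))) j) \<in> borel_measurable (M \<Otimes>\<^sub>M count_space {0..<int n})"
      if "j \<in> {0..<int n}" for j
      by (rule measurable_compose[OF measurable_fst measurable_tridiagonal[OF T F that]])
  qed auto
  also have "borel_measurable (M \<Otimes>\<^sub>M count_space {0..<int n}) = borel_measurable (M \<Otimes>\<^sub>M uniform_count_measure {0..<int n})"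
    by (intro measurable_cong_sets sets_pair_measure_cong refl
        sets_uniform_count_measure_count_space[symmetric])
  finally show ?thesis by (simp add: split_beta')
qed

lemma prob_space_tridiagonal_pair:
  assumes T: "beta_laguerre M \<beta> \<gamma> n T" and n: "n \<ge> 1"
  shows "prob_space (M \<Otimes>\<^sub>M uniform_count_measure {0..<int n})"
proof -
  interpret M: prob_space M by (rule beta_laguerreD[OF T])
  interpret U: prob_space "uniform_count_measure {0..<int n}"
    using n by (intro prob_space_uniform_count_measure) auto
  interpret pair_prob_space M "uniform_count_measure {0..<int n}" ..
  show ?thesis by (rule prob_space_axioms)
qed

lemma random_rooted_graph_tridiagonal:
  assumes T: "beta_laguerre M \<beta> \<gamma> n T" and n: "n \<ge> 1"
  shows "random_rooted_graph (M \<Otimes>\<^sub>M uniform_count_measure {0..<int n})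
    (\<lambda>(\<omega>, j). tridiagonal_graph n (T \<omega>)) (\<lambda>(\<omega>, j). j)"
  unfolding random_rooted_graph_def
  using prob_space_tridiagonal_pair[OF assms] measurable_tridiagonal_pair[OF T] rooted_graph_tridiagonal[OF T]
  by (auto simp: space_pair_measure space_uniform_count_measure split_beta')

text \<open>Both weights are continuous in \<open>u\<close> on the whole real line,
  \<open>sqrt\<close> being continuous at negative arguments too; hence so is the test
  value.\<close>

lemma random_rooted_graph_laguerre:
  "random_rooted_graph (uniform_measure lborel {0..1::real}) (laguerre_limit_graph \<beta> \<gamma>) (\<lambda>u. 0)"
  unfolding random_rooted_graph_def
proof (intro conjI allI impI ballI rooted_graph_laguerre)
  show "prob_space (uniform_measure lborel {0..1::real})"
    by (rule prob_space_uniform_measure) auto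
  fix F :: "int wgraph \<Rightarrow> int \<Rightarrow> real" assume F: "bounded_locally_continuous F"
  have "isCont (\<lambda>u. F (laguerre_limit_graph \<beta> \<gamma> u) 0) u" for u
    unfolding isCont_def
  proof (rule bounded_locally_continuous_limit[OF F rooted_graph_laguerre])
    fix r and \<delta> :: real assume "\<delta> > 0"
    have "((\<lambda>u. \<beta> * (\<gamma> + 1 - 2 * u)) \<longlongrightarrow> \<beta> * (\<gamma> + 1 - 2 * u)) (at u)"
      "((\<lambda>u. \<beta> * sqrt (\<gamma> - u) * sqrt (1 - u)) \<longlongrightarrow> \<beta> * sqrt (\<gamma> - u) * sqrt (1 - u)) (at u)"
      by (intro tendsto_intros)+
    from tendstoD[OF this(1) \<open>\<delta> > 0\<close>] tendstoD[OF this(2) \<open>\<delta> > 0\<close>]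
    show "\<forall>\<^sub>F v in at u. locally_close r \<delta> (laguerre_limit_graph \<beta> \<gamma> u) 0 (laguerre_limit_graph \<beta> \<gamma> v) 0"
    proof eventually_elim
      case (elim v)
      have "locally_close r \<delta> (laguerre_limit_graph \<beta> \<gamma> u) 0 (laguerre_limit_graph \<beta> \<gamma> v) (0 + 0)"
        unfolding laguerre_band by (rule locally_close_band) (use elim in \<open>auto simp: dist_real_def\<close>)
      then show ?case by simp
    qed
  qed (simp add: rooted_graph_laguerre)
  then have "(\<lambda>u. F (laguerre_limit_graph \<beta> \<gamma> u) 0) \<in> borel_measurable borel"
    by (intro borel_measurable_continuous_onI continuous_at_imp_continuous_on) auto
  then show "(\<lambda>u. F (laguerre_limit_graph \<beta> \<gamma> u) 0) \<in> borel_measurable (uniform_measure lborel {0..1})"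
    by simp
qed

text \<open>The underlying ball is the same path for all roots at distance at least \<open>r\<close> from both ends.\<close>

lemma unweighted_limit:
  assumes T: "\<And>n. n \<ge> 1 \<Longrightarrow> beta_laguerre (M n) \<beta> \<gamma> n (T n)"
  shows "(\<lambda>n. measure (M n \<Otimes>\<^sub>M uniform_count_measure {0..<int n})
      {z \<in> space (M n \<Otimes>\<^sub>M uniform_count_measure {0..<int n}).
        isomorphic_rooted K z0 (graph_ball (tridiagonal_graph n (T n (fst z))) (snd z) r) (snd z)})
    \<longlonglongrightarrow> measure (uniform_measure lborel {0..1::real})
         {u \<in> space (uniform_measure lborel {0..1::real}).
           isomorphic_rooted K z0 (graph_ball (laguerre_limit_graph \<beta> \<gamma> u) 0 r) 0}"
    (is "?P \<longlonglongrightarrow> ?L")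
proof -
  \<comment> \<open>Zero weights stand in for the random ones, so that \<open>Q\<close> depends on
    \<open>n\<close> and the root alone.\<close>
  define Q where "Q n j \<longleftrightarrow> isomorphic_rooted K z0 (graph_ball (band_graph {0..<int n} (\<lambda>_ _. 0)) j r) j" for n j
  define Q0 where "Q0 \<longleftrightarrow> isomorphic_rooted K z0 (graph_ball (band_graph UNIV (\<lambda>_ _. 0)) 0 r) 0"
  define c :: real where "c = (if Q0 then 1 else 0)"
  interpret N: prob_space "uniform_measure lborel {0..1::real}"
    by (rule prob_space_uniform_measure) auto
  have "isomorphic_rooted K z0 (graph_ball (laguerre_limit_graph \<beta> \<gamma> u) 0 r) 0 \<longleftrightarrow> Q0" for u
    using isomorphic_rooted_ball_band[where I=UNIV and I'=UNIV and x=0 and s=0 and r=r and K=K and z=z0]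
    unfolding Q0_def laguerre_band by simp
  then have L: "?L = c" using N.prob_space by (simp add: c_def)
  have Q_eq: "Q n j = Q0" if "int r \<le> j" "j + int r < int n" for n j
  proof -
    have "isomorphic_rooted K z0 (graph_ball (band_graph UNIV (\<lambda>_ _. 0)) 0 r) 0 \<longleftrightarrow>
        isomorphic_rooted K z0 (graph_ball (band_graph {0..<int n} (\<lambda>_ _. 0)) (0 + j) r) (0 + j)"
      by (rule isomorphic_rooted_ball_band) (use that in auto)
    then show ?thesis by (simp add: Q_def Q0_def)
  qed
  have P: "?P n = real (card {j \<in> {0..<int n}. Q n j}) / real n" if n: "n \<ge> 1" for n
  proof -
    interpret M: prob_space "M n" by (rule beta_laguerreD[OF T[OF n]])
    interpret U: prob_space "uniform_count_measure {0..<int n}"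
      using n by (intro prob_space_uniform_count_measure) auto
    have iso: "isomorphic_rooted K z0 (graph_ball (tridiagonal_graph n w) j r) j \<longleftrightarrow> Q n j"
      if "j \<in> {0..<int n}" for w j
      using isomorphic_rooted_ball_band[where I="{0..<int n}" and I'="{0..<int n}" and x=j and s=0 and r=r and K=K and z=z0] that
      unfolding Q_def tridiagonal_band by simp
    \<comment> \<open>As the unweighted ball does not depend on the matrix, the event is a rectangle
      and its probability is a proportion of roots.\<close>
    have "{z \<in> space (M n \<Otimes>\<^sub>M uniform_count_measure {0..<int n}).
        isomorphic_rooted K z0 (graph_ball (tridiagonal_graph n (T n (fst z))) (snd z) r) (snd z)}
       = space (M n) \<times> {j \<in> {0..<int n}. Q n j}"
      using iso by (auto simp: space_pair_measure space_uniform_count_measure)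
    moreover have "emeasure (M n \<Otimes>\<^sub>M uniform_count_measure {0..<int n}) (space (M n) \<times> {j \<in> {0..<int n}. Q n j})
       = emeasure (M n) (space (M n)) * emeasure (uniform_count_measure {0..<int n}) {j \<in> {0..<int n}. Q n j}"
      by (rule U.emeasure_pair_measure_Times[OF sets.top])
         (auto simp: sets_uniform_count_measure_count_space)
    ultimately have "?P n = measure (M n) (space (M n)) * measure (uniform_count_measure {0..<int n}) {j \<in> {0..<int n}. Q n j}"
      by (simp only: measure_def enn2real_mult)
    also have "\<dots> = real (card {j \<in> {0..<int n}. Q n j}) / real n"
      using M.prob_space by (subst measure_uniform_count_measure) auto
    finally show ?thesis .
  qed
  have bound: "\<bar>?P n - c\<bar> \<le> 2 * real r / real n" if n: "n \<ge> 1" for n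
  proof -
    \<comment> \<open>\<open>?E\<close> holds the at most \<open>2 * r\<close> roots near the ends;
      elsewhere \<open>Q n j\<close> agrees with \<open>Q0\<close>.\<close>
    let ?A = "{j \<in> {0..<int n}. Q n j}" and ?E = "{0..<int r} \<union> {int n - int r..<int n}"
    have fin: "finite ?A" by (rule finite_subset[of _ "{0..<int n}"]) auto
    have E: "card ?E \<le> 2 * r"
      by (rule order.trans[OF card_Un_le]) simp
    have "\<bar>real (card ?A) - c * real n\<bar> \<le> 2 * real r"
    proof (cases Q0)
      case True
      have "{0..<int n} \<subseteq> ?A \<union> ?E" using Q_eq True by force
      then have "card {0..<int n} \<le> card (?A \<union> ?E)" by (intro card_mono) (use fin in auto)
      also have "\<dots> \<le> card ?A + card ?E" by (rule card_Un_le)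
      finally have "n \<le> card ?A + 2 * r" using E by simp
      moreover have "card ?A \<le> card {0..<int n}" by (rule card_mono) auto
      ultimately show ?thesis using True by (simp add: c_def)
    next
      case False
      have "?A \<subseteq> ?E"
      proof
        fix j assume j: "j \<in> ?A"
        then have "\<not> (int r \<le> j \<and> j + int r < int n)" using Q_eq[of j n] False by auto
        then show "j \<in> ?E" using j by auto
      qed
      then have "card ?A \<le> card ?E" by (intro card_mono) auto
      then show ?thesis using E False by (simp add: c_def)
    qed
    then have "\<bar>real (card ?A) - c * real n\<bar> / real n \<le> 2 * real r / real n"
      by (rule divide_right_mono) simp
    moreover have "real (card ?A) / real n - c = (real (card ?A) - c * real n) / real n"
      using n by (simp add: field_simps)
    ultimately show ?thesis unfolding P[OF n] by (simp add: abs_divide)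
  qed
  have "(\<lambda>n. ?P n - c) \<longlonglongrightarrow> 0"
  proof (rule Lim_null_comparison)
    show "\<forall>\<^sub>F n in sequentially. norm (?P n - c) \<le> 2 * real r / real n"
      using bound by (intro eventually_sequentiallyI[of 1]) simp
    show "(\<lambda>n. 2 * real r / real n) \<longlonglongrightarrow> 0" by (rule lim_const_over_n)
  qed
  then show ?thesis unfolding L by (simp add: LIM_zero_iff)
qed

section \<open>Entries near the root, in probability\<close>

lemma floor_ratio_limit: "(\<lambda>n. real_of_int (\<lfloor>real n * u\<rfloor> + s) / real n) \<longlonglongrightarrow> u"
proof -
  have "(\<lambda>n. real_of_int (\<lfloor>real n * u\<rfloor> + s) / real n - u) \<longlonglongrightarrow> 0"
  proof (rule Lim_null_comparison)
    show "\<forall>\<^sub>F n in sequentially. norm (real_of_int (\<lfloor>real n * u\<rfloor> + s) / real n - u) \<le> (1 + \<bar>real_of_int s\<bar>) / real n"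
    proof (rule eventually_sequentiallyI[of 1])
      fix n :: nat assume n: "1 \<le> n"
      have "\<bar>real_of_int (\<lfloor>real n * u\<rfloor> + s) - real n * u\<bar> \<le> 1 + \<bar>real_of_int s\<bar>"
        by linarith
      then have "\<bar>real_of_int (\<lfloor>real n * u\<rfloor> + s) - real n * u\<bar> / real n \<le> (1 + \<bar>real_of_int s\<bar>) / real n"
        by (rule divide_right_mono) simp
      moreover have "real_of_int (\<lfloor>real n * u\<rfloor> + s) / real n - u
          = (real_of_int (\<lfloor>real n * u\<rfloor> + s) - real n * u) / real n"
        using n by (simp add: field_simps)
      ultimately show "norm (real_of_int (\<lfloor>real n * u\<rfloor> + s) / real n - u) \<le> (1 + \<bar>real_of_int s\<bar>) / real n"
        by (simp add: abs_divide)
    qed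
    show "(\<lambda>n. (1 + \<bar>real_of_int s\<bar>) / real n) \<longlonglongrightarrow> 0" by (rule lim_const_over_n)
  qed
  then show ?thesis by (simp add: LIM_zero_iff)
qed

text \<open>An interior \<open>u\<close> keeps every fixed shift of the index away from both ends,
  in the range where \<open>beta_laguerre\<close> gives the general diagonal law and an off-diagonal
  law.\<close>

lemma floor_index_eventually:
  assumes u: "0 < u" "u < 1"
  shows "\<forall>\<^sub>F n in sequentially. \<lfloor>real n * u\<rfloor> + s \<in> {1..int n - 1}"
proof -
  have "\<forall>\<^sub>F n in sequentially. 0 < real_of_int (\<lfloor>real n * u\<rfloor> + s) / real n"
    by (rule order_tendstoD(1)[OF floor_ratio_limit u(1)])
  moreover have "\<forall>\<^sub>F n in sequentially. real_of_int (\<lfloor>real n * u\<rfloor> + s) / real n < 1"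
    by (rule order_tendstoD(2)[OF floor_ratio_limit u(2)])
  moreover have "\<forall>\<^sub>F n in sequentially. n \<ge> (1::nat)" by (rule eventually_ge_at_top)
  ultimately show ?thesis
  proof eventually_elim
    case (elim n)
    have "0 < real_of_int (\<lfloor>real n * u\<rfloor> + s)" "real_of_int (\<lfloor>real n * u\<rfloor> + s) < real_of_int (int n)"
      using elim by (auto simp: field_simps)
    then have "0 < \<lfloor>real n * u\<rfloor> + s" "\<lfloor>real n * u\<rfloor> + s < int n"
      by linarith+
    then show ?case by simp
  qed
qed

context
  fixes \<beta> \<gamma> :: real and M :: "nat \<Rightarrow> 'a measure" and T :: "nat \<Rightarrow> 'a \<Rightarrow> int \<Rightarrow> int \<Rightarrow> real"
  assumes \<beta>: "\<beta> > 0" and \<gamma>: "\<gamma> \<ge> 1"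
    and T: "\<And>n. n \<ge> 1 \<Longrightarrow> beta_laguerre (M n) \<beta> \<gamma> n (T n)"
begin

text \<open>With \<open>\<kappa> n\<close> the degrees of freedom divided by \<open>n\<close>, the
  entry has mean \<open>\<kappa> n\<close> and second moment
  \<open>\<kappa> n * (\<kappa> n + 2 / n)\<close>. Since \<open>\<kappa>\<close> tends to
  \<open>c\<close>, the second moment about \<open>c\<close> vanishes.\<close>

lemma diagonal_in_probability:
  assumes u: "0 < u" "u < 1" and d: "d > 0"
  shows "(\<lambda>n. measure (M n) {\<omega> \<in> space (M n).
      d \<le> \<bar>T n \<omega> (\<lfloor>real n * u\<rfloor> + s) (\<lfloor>real n * u\<rfloor> + s) - \<beta> * (\<gamma> + 1 - 2 * u)\<bar>}) \<longlonglongrightarrow> 0"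
    (is "?P \<longlonglongrightarrow> 0")
proof -
  define i where "i n = \<lfloor>real n * u\<rfloor> + s" for n
  define k where "k n = \<beta> * \<gamma> * (real n - 1) + \<beta> * (real n - 2 * real_of_int (i n))" for n
  define c where "c = \<beta> * (\<gamma> + 1 - 2 * u)"
  define B where "B n = (k n * (k n + 2) / (real n)\<^sup>2 - 2 * c * k n / real n + c\<^sup>2) / d\<^sup>2" for n
  define \<kappa> where "\<kappa> n = \<beta> * \<gamma> * (1 - 1 / real n) + \<beta> * (1 - 2 * (real_of_int (i n) / real n))" for n
  have i: "(\<lambda>n. real_of_int (i n) / real n) \<longlonglongrightarrow> u" unfolding i_def by (rule floor_ratio_limit)
  have "\<kappa> \<longlonglongrightarrow> \<beta> * \<gamma> * (1 - 0) + \<beta> * (1 - 2 * u)"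
    unfolding \<kappa>_def by (intro tendsto_intros i lim_const_over_n)
  then have \<kappa>: "\<kappa> \<longlonglongrightarrow> c" by (simp add: c_def algebra_simps)
  have "(\<lambda>n. (\<kappa> n * (\<kappa> n + 2 / real n) - 2 * c * \<kappa> n + c\<^sup>2) / d\<^sup>2) \<longlonglongrightarrow> (c * (c + 0) - 2 * c * c + c\<^sup>2) / d\<^sup>2"
    by (intro tendsto_intros \<kappa> lim_const_over_n) (use d in simp)
  then have lim: "(\<lambda>n. (\<kappa> n * (\<kappa> n + 2 / real n) - 2 * c * \<kappa> n + c\<^sup>2) / d\<^sup>2) \<longlonglongrightarrow> 0"
    by (simp add: power2_eq_square)
  show ?thesis
  proof (rule tendsto_sandwich[OF _ _ tendsto_const lim])
    show "\<forall>\<^sub>F n in sequentially. ?P n \<le> (\<kappa> n * (\<kappa> n + 2 / real n) - 2 * c * \<kappa> n + c\<^sup>2) / d\<^sup>2"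
      using floor_index_eventually[OF u, of s] eventually_ge_at_top[of 1]
    proof eventually_elim
      case (elim n)
      then have j: "i n \<in> {1..int n - 1}" and n: "real n > 0" by (auto simp: i_def)
      have "real_of_int (i n) \<le> real n - 1" using j by auto
      \<comment> \<open>Positivity of the degrees of freedom: by \<open>\<gamma> \<ge> 1\<close>
        they are at least this quantity.\<close>
      then have "\<beta> * (2 * real n - 1 - 2 * real_of_int (i n)) > 0" using \<beta> by simp
      moreover have "\<beta> * (real n - 1) \<le> \<beta> * \<gamma> * (real n - 1)"
        using \<beta> \<gamma> elim(2) by (intro mult_right_mono) auto
      ultimately have k: "k n > 0" unfolding k_def by (simp add: algebra_simps)
      have "?P n \<le> B n"
        unfolding B_def c_def[symmetric] i_def[symmetric]
        by (rule chi_square_tail[OF _ k d]) (use beta_laguerreD(4)[OF T[OF elim(2)] j] in \<open>simp add: k_def\<close>)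
      also have "B n = (\<kappa> n * (\<kappa> n + 2 / real n) - 2 * c * \<kappa> n + c\<^sup>2) / d\<^sup>2"
      proof -
        have "\<kappa> n = k n / real n" using n by (simp add: \<kappa>_def k_def field_simps)
        then show ?thesis unfolding B_def using n by (simp only:) (simp add: power2_eq_square field_simps)
      qed
      finally show ?case .
    qed
  qed simp
qed

text \<open>The degrees of freedom of the two factors, divided by \<open>n\<close>, are
  \<open>x n\<close> and \<open>y n\<close>, with limits \<open>p\<close> and \<open>q\<close>. As
  \<open>c\<^sup>2 = p * q\<close>, the second moment of the squared entry about
  \<open>c\<^sup>2\<close> tends to
  \<open>(p * q)\<^sup>2 - 2 * (p * q)\<^sup>2 + (p * q)\<^sup>2\<close>, which is 0.\<close>

lemma offdiagonal_in_probability: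
  assumes u: "0 < u" "u < 1" and d: "d > 0"
  shows "(\<lambda>n. measure (M n) {\<omega> \<in> space (M n).
      d \<le> \<bar>T n \<omega> (\<lfloor>real n * u\<rfloor> + s - 1) (\<lfloor>real n * u\<rfloor> + s) - \<beta> * sqrt (\<gamma> - u) * sqrt (1 - u)\<bar>}) \<longlonglongrightarrow> 0"
    (is "?P \<longlonglongrightarrow> 0")
proof -
  define i where "i n = \<lfloor>real n * u\<rfloor> + s" for n
  define a where "a n = \<beta> * \<gamma> * (real n - 1) - \<beta> * (real_of_int (i n) - 1)" for n
  define b where "b n = \<beta> * (real n - real_of_int (i n))" for n
  define c where "c = \<beta> * sqrt (\<gamma> - u) * sqrt (1 - u)"
  define p q where "p = \<beta> * (\<gamma> - u)" and "q = \<beta> * (1 - u)"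
  define x where "x n = \<beta> * \<gamma> * (1 - 1 / real n) - \<beta> * (real_of_int (i n) / real n - 1 / real n)" for n
  define y where "y n = \<beta> * (1 - real_of_int (i n) / real n)" for n
  define B where "B n = (x n * (x n + 2 / real n) * (y n * (y n + 2 / real n)) - 2 * c\<^sup>2 * (x n * y n) + (c\<^sup>2)\<^sup>2) / (d\<^sup>2)\<^sup>2" for n
  have c: "c \<ge> 0" "c\<^sup>2 = p * q"
  proof -
    show "c \<ge> 0" using \<beta> \<gamma> u by (simp add: c_def)
    have "c\<^sup>2 = \<beta>\<^sup>2 * (\<gamma> - u) * (1 - u)" using \<gamma> u by (simp add: c_def power_mult_distrib)
    then show "c\<^sup>2 = p * q" by (simp add: p_def q_def power2_eq_square)
  qed
  have i: "(\<lambda>n. real_of_int (i n) / real n) \<longlonglongrightarrow> u" unfolding i_def by (rule floor_ratio_limit)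
  have "x \<longlonglongrightarrow> \<beta> * \<gamma> * (1 - 0) - \<beta> * (u - 0)"
    unfolding x_def by (intro tendsto_intros i lim_const_over_n)
  then have x: "x \<longlonglongrightarrow> p" by (simp add: p_def algebra_simps)
  have y: "y \<longlonglongrightarrow> q" unfolding y_def q_def by (intro tendsto_intros i)
  have "B \<longlonglongrightarrow> (p * (p + 0) * (q * (q + 0)) - 2 * c\<^sup>2 * (p * q) + (c\<^sup>2)\<^sup>2) / (d\<^sup>2)\<^sup>2"
    unfolding B_def by (intro tendsto_intros x y lim_const_over_n) (use d in simp)
  then have lim: "B \<longlonglongrightarrow> 0" unfolding c(2) by (simp add: power2_eq_square algebra_simps)
  show ?thesis
  proof (rule tendsto_sandwich[OF _ _ tendsto_const lim])
    show "\<forall>\<^sub>F n in sequentially. ?P n \<le> B n"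
      using floor_index_eventually[OF u, of s] eventually_ge_at_top[of 1]
    proof eventually_elim
      case (elim n)
      then have j: "i n \<in> {1..int n - 1}" and n: "real n > 0" by (auto simp: i_def)
      have i_le: "real_of_int (i n) \<le> real n - 1" using j by auto
      have "\<beta> * (real n - 1) \<le> \<beta> * \<gamma> * (real n - 1)"
        using \<beta> \<gamma> elim(2) by (intro mult_right_mono) auto
      moreover have "\<beta> * (real_of_int (i n) - 1) < \<beta> * (real n - 1)" using \<beta> i_le by simp
      ultimately have a: "a n > 0" unfolding a_def by linarith
      have b: "b n > 0" using \<beta> i_le unfolding b_def by simp
      have "?P n \<le> (a n * (a n + 2) * (b n * (b n + 2)) / ((real n)\<^sup>2)\<^sup>2 - 2 * c\<^sup>2 * (a n * b n) / (real n)\<^sup>2 + (c\<^sup>2)\<^sup>2) / (d\<^sup>2)\<^sup>2"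
        unfolding c_def[symmetric] i_def[symmetric]
        by (rule chi_prod_tail[OF _ a b d c(1)]) (use beta_laguerreD(5)[OF T[OF elim(2)] j] in \<open>simp add: a_def b_def\<close>)
      also have "\<dots> = B n"
      proof -
        have "x n = a n / real n" "y n = b n / real n"
          using n by (auto simp: x_def y_def a_def b_def field_simps)
        then show ?thesis unfolding B_def using n by (simp only:) (simp add: power2_eq_square field_simps)
      qed
      finally show ?case .
    qed
  qed simp
qed

text \<open>Outside a bad event of vanishing probability the ball of radius \<open>r\<close> has
  weights within \<open>\<delta>\<close> of the limit; on the bad event the error is at most
  \<open>2 * C\<close>.\<close>

lemma expectation_limit:
  assumes F: "bounded_locally_continuous F" and u: "0 < u" "u < 1"
  shows "(\<lambda>n. \<integral>\<omega>. F (tridiagonal_graph n (T n \<omega>)) \<lfloor>real n * u\<rfloor> \<partial>M n) \<longlonglongrightarrow> F (laguerre_limit_graph \<beta> \<gamma> u) 0"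
proof (rule tendstoI)
  fix e :: real assume e: "e > 0"
  let ?L = "F (laguerre_limit_graph \<beta> \<gamma> u) 0"
  define A where "A = \<beta> * (\<gamma> + 1 - 2 * u)"
  define b where "b = \<beta> * sqrt (\<gamma> - u) * sqrt (1 - u)"
  define j where "j n = \<lfloor>real n * u\<rfloor>" for n
  obtain C where C: "\<And>G x. rooted_graph G x \<Longrightarrow> \<bar>F G x\<bar> \<le> C"
    using F by (auto simp: bounded_locally_continuous_def)
  have "C \<ge> 0" using C[OF rooted_graph_laguerre] by (meson abs_ge_zero order.trans)
  obtain r \<delta> where \<delta>: "\<delta> > 0" and close: "\<And>H y. rooted_graph H y \<Longrightarrow>
      locally_close r \<delta> (laguerre_limit_graph \<beta> \<gamma> u) 0 H y \<Longrightarrow> \<bar>F H y - ?L\<bar> < e / 2"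
    using F rooted_graph_laguerre[of \<beta> \<gamma> u 0] e unfolding bounded_locally_continuous_def
    by (meson half_gt_zero)
  define D where "D n s = {\<omega> \<in> space (M n). \<delta> \<le> \<bar>T n \<omega> (j n + s) (j n + s) - A\<bar>}" for n s
  define O' where "O' n s = {\<omega> \<in> space (M n). \<delta> \<le> \<bar>T n \<omega> (j n + s - 1) (j n + s) - b\<bar>}" for n s
  define S where "S = {- int r..int r}"
  define B where "B n = (\<Union>s\<in>S. D n s \<union> O' n s)" for n
  have "(\<lambda>n. \<Sum>s\<in>S. measure (M n) (D n s) + measure (M n) (O' n s)) \<longlonglongrightarrow> (\<Sum>s\<in>S. 0 + 0)"
    unfolding D_def O'_def A_def b_def j_def
    by (intro tendsto_sum tendsto_add diagonal_in_probability offdiagonal_in_probability u \<delta>)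
  then have "(\<lambda>n. 2 * C * (\<Sum>s\<in>S. measure (M n) (D n s) + measure (M n) (O' n s))) \<longlonglongrightarrow> 2 * C * 0"
    by (intro tendsto_intros) simp
  then have small: "\<forall>\<^sub>F n in sequentially. 2 * C * (\<Sum>s\<in>S. measure (M n) (D n s) + measure (M n) (O' n s)) < e / 2"
    using e by (intro order_tendstoD(2)[where a="e/2"]) auto
  show "\<forall>\<^sub>F n in sequentially. dist (\<integral>\<omega>. F (tridiagonal_graph n (T n \<omega>)) \<lfloor>real n * u\<rfloor> \<partial>M n) ?L < e"
    using small floor_index_eventually[OF u, of "- int r"] floor_index_eventually[OF u, of "int r"] eventually_ge_at_top[of 1]
  proof eventually_elim
    case (elim n)
    note Tn = T[OF elim(4)]
    interpret prob_space "M n" by (rule beta_laguerreD[OF Tn])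
    \<comment> \<open>The extra 1 keeps the row \<open>j n - int r - 1\<close> nonnegative, which
      \<open>O' n s\<close> reads at \<open>s = - int r\<close>.\<close>
    have j: "1 + int r \<le> j n" "j n + int r < int n" using elim(2,3) by (auto simp: j_def)
    then have jI: "j n \<in> {0..<int n}" by auto
    have [measurable]: "(\<lambda>\<omega>. F (tridiagonal_graph n (T n \<omega>)) (j n)) \<in> borel_measurable (M n)"
      by (rule measurable_tridiagonal[OF Tn F jI])
    have rooted: "rooted_graph (tridiagonal_graph n (T n \<omega>)) (j n)" if "\<omega> \<in> space (M n)" for \<omega>
      by (rule rooted_graph_tridiagonal[OF Tn that jI])
    have [measurable]: "(\<lambda>\<omega>. T n \<omega> (j n + s) (j n + s)) \<in> borel_measurable (M n)"
      "(\<lambda>\<omega>. T n \<omega> (j n + s - 1) (j n + s)) \<in> borel_measurable (M n)" if "s \<in> S" for s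
      using j that by (auto intro!: measurable_entry[OF Tn] simp: S_def)
    have D_m: "D n s \<in> sets (M n)" "O' n s \<in> sets (M n)" if s: "s \<in> S" for s
      unfolding D_def O'_def using s by measurable
    have B_m: "B n \<in> sets (M n)" unfolding B_def using D_m by (intro sets.finite_UN) (auto simp: S_def)
    have "measure (M n) (B n) \<le> (\<Sum>s\<in>S. measure (M n) (D n s \<union> O' n s))"
      unfolding B_def using D_m by (intro finite_measure_subadditive_finite) (auto simp: S_def)
    also have "\<dots> \<le> (\<Sum>s\<in>S. measure (M n) (D n s) + measure (M n) (O' n s))"
      using D_m by (intro sum_mono measure_Un_le) auto
    finally have "2 * C * measure (M n) (B n) \<le> 2 * C * (\<Sum>s\<in>S. measure (M n) (D n s) + measure (M n) (O' n s))"
      using \<open>C \<ge> 0\<close> by (intro mult_left_mono) auto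
    then have PB: "2 * C * measure (M n) (B n) < e / 2" using elim(1) by linarith
    have good: "\<bar>F (tridiagonal_graph n (T n \<omega>)) (j n) - ?L\<bar> < e / 2" if \<omega>: "\<omega> \<in> space (M n)" "\<omega> \<notin> B n" for \<omega>
    proof (rule close[OF rooted[OF \<omega>(1)]])
      have d: "\<bar>T n \<omega> (j n + s) (j n + s) - A\<bar> < \<delta>" "\<bar>T n \<omega> (j n + s - 1) (j n + s) - b\<bar> < \<delta>" if "s \<in> S" for s
        using \<omega> that unfolding B_def D_def O'_def by (auto simp: not_le)
      have "locally_close r \<delta> (laguerre_limit_graph \<beta> \<gamma> u) 0 (tridiagonal_graph n (T n \<omega>)) (0 + j n)"
        unfolding laguerre_band tridiagonal_band
      proof (rule locally_close_band)
        fix v w :: int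
        assume vw: "\<bar>v - 0\<bar> \<le> int r" "\<bar>w - 0\<bar> \<le> int r" "\<bar>v - w\<bar> \<le> 1"
        then have S: "v \<in> S" "w \<in> S" by (auto simp: S_def)
        consider "v = w" | "w = v + 1" | "v = w + 1" using vw(3) by linarith
        then show "\<bar>T n \<omega> (v + j n) (w + j n) - (if v = w then \<beta> * (\<gamma> + 1 - 2 * u) else \<beta> * sqrt (\<gamma> - u) * sqrt (1 - u))\<bar> < \<delta>"
        proof cases
          case 1
          then show ?thesis using d(1)[OF S(1)] by (simp add: A_def add.commute)
        next
          case 2
          then show ?thesis using d(2)[OF S(2)] by (simp add: b_def add.commute)
        next
          case 3
          have "T n \<omega> (v + j n) (w + j n) = T n \<omega> (w + j n) (v + j n)"
            by (rule beta_laguerreD(2)[OF Tn \<omega>(1)]) (use vw j in auto)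
          then show ?thesis using 3 d(2)[OF S(1)] by (simp add: b_def add.commute)
        qed
      qed (use j in auto)
      then show "locally_close r \<delta> (laguerre_limit_graph \<beta> \<gamma> u) 0 (tridiagonal_graph n (T n \<omega>)) (j n)" by simp
    qed
    have int: "integrable (M n) (\<lambda>\<omega>. F (tridiagonal_graph n (T n \<omega>)) (j n))"
      by (rule integrable_const_bound[where B=C]) (auto intro!: AE_I2 C rooted)
    have "\<bar>(\<integral>\<omega>. F (tridiagonal_graph n (T n \<omega>)) (j n) \<partial>M n) - ?L\<bar>
        = \<bar>\<integral>\<omega>. F (tridiagonal_graph n (T n \<omega>)) (j n) - ?L \<partial>M n\<bar>"
      using int prob_space by simp
    also have "\<dots> \<le> (\<integral>\<omega>. \<bar>F (tridiagonal_graph n (T n \<omega>)) (j n) - ?L\<bar> \<partial>M n)"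
      by (rule integral_abs_bound)
    also have "\<dots> \<le> (\<integral>\<omega>. e / 2 + 2 * C * indicator (B n) \<omega> \<partial>M n)"
    proof (rule integral_mono)
      show "integrable (M n) (\<lambda>\<omega>. \<bar>F (tridiagonal_graph n (T n \<omega>)) (j n) - ?L\<bar>)" using int by auto
      show "integrable (M n) (\<lambda>\<omega>. e / 2 + 2 * C * indicator (B n) \<omega>)"
        using B_m by (auto simp: integrable_indicator_iff emeasure_eq_measure)
      fix \<omega> assume \<omega>: "\<omega> \<in> space (M n)"
      show "\<bar>F (tridiagonal_graph n (T n \<omega>)) (j n) - ?L\<bar> \<le> e / 2 + 2 * C * indicator (B n) \<omega>"
      proof (cases "\<omega> \<in> B n")
        case True
        have "\<bar>F (tridiagonal_graph n (T n \<omega>)) (j n)\<bar> \<le> C" "\<bar>?L\<bar> \<le> C"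
          by (auto intro!: C rooted \<omega> rooted_graph_laguerre)
        then show ?thesis using True e by (simp add: abs_le_iff)
      qed (use good[OF \<omega>] in simp)
    qed
    also have "\<dots> = e / 2 + 2 * C * measure (M n) (B n)"
      using B_m prob_space by (subst Bochner_Integration.integral_add) (auto simp: integrable_indicator_iff emeasure_eq_measure)
    also have "\<dots> < e" using PB by simp
    finally show ?case by (simp add: dist_real_def j_def)
  qed
qed

end

text \<open>The values of \<open>u\<close> whose index is \<open>j\<close> form an interval of
  length \<open>1 / n\<close>. The indicator removes \<open>u = 1\<close>, where the floor is
  \<open>n\<close> and lies outside the index set.\<close>

lemma average_eq_integral:
  fixes c :: "int \<Rightarrow> real"
  assumes n: "n \<ge> 1"
  shows "(\<Sum>j\<in>{0..<int n}. c j) / real n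
    = (LINT u|uniform_measure lborel {0..1}. indicator {0<..<1} u * c \<lfloor>real n * u\<rfloor>)"
proof -
  interpret N: prob_space "uniform_measure lborel {0..1::real}"
    by (rule prob_space_uniform_measure) auto
  let ?N = "uniform_measure lborel {0..1::real}"
  define J where "J j = {real_of_int j / real n..<(real_of_int j + 1) / real n}" for j
  have [measurable]: "J j \<in> sets borel" for j by (simp add: J_def)
  have J: "u \<in> J j \<longleftrightarrow> \<lfloor>real n * u\<rfloor> = j" for u j
    using n by (auto simp: J_def floor_eq_iff field_simps)
  have "(LINT u|?N. indicator {0<..<1} u * c \<lfloor>real n * u\<rfloor>) = (LINT u|?N. (\<Sum>j\<in>{0..<int n}. c j * indicator (J j) u))"
  proof (rule integral_cong_AE)
    show "AE u in ?N. indicator {0<..<1} u * c \<lfloor>real n * u\<rfloor> = (\<Sum>j\<in>{0..<int n}. c j * indicator (J j) u)"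
    proof (rule AE_uniform_measureI)
      show "AE u in lborel. u \<in> {0..1} \<longrightarrow> indicator {0<..<1} u * c \<lfloor>real n * u\<rfloor> = (\<Sum>j\<in>{0..<int n}. c j * indicator (J j) u)"
        using AE_lborel_singleton[of 0] AE_lborel_singleton[of 1]
      proof eventually_elim
        case (elim u)
        show ?case
        proof
          assume "u \<in> {0..1}"
          then have u: "0 < u" "u < 1" using elim by auto
          have "\<lfloor>real n * u\<rfloor> \<in> {0..<int n}" using u n by (auto simp: floor_less_iff)
          moreover have "(\<Sum>j\<in>{0..<int n}. c j * indicator (J j) u) = (\<Sum>j\<in>{0..<int n}. if j = \<lfloor>real n * u\<rfloor> then c j else 0)"
            by (intro sum.cong) (auto simp: J indicator_def)
          ultimately show "indicator {0<..<1} u * c \<lfloor>real n * u\<rfloor> = (\<Sum>j\<in>{0..<int n}. c j * indicator (J j) u)"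
            using u by simp
        qed
      qed
    qed simp
  qed measurable
  also have "\<dots> = (\<Sum>j\<in>{0..<int n}. c j * measure ?N (J j))"
    by (subst Bochner_Integration.integral_sum) (auto simp: J_def integrable_indicator_iff N.emeasure_eq_measure)
  also have "\<dots> = (\<Sum>j\<in>{0..<int n}. c j * (1 / real n))"
  proof (intro sum.cong refl arg_cong2[where f=times])
    fix j assume j: "j \<in> {0..<int n}"
    have "0 \<le> real_of_int j / real n" using j by simp
    moreover have "(real_of_int j + 1) / real n \<le> 1"
    proof -
      have "real_of_int (j + 1) \<le> real_of_int (int n)" using j by (intro of_int_le_iff[THEN iffD2]) simp
      then show ?thesis using n by simp
    qed
    ultimately have "{0..1} \<inter> J j = J j" by (auto simp: J_def)
    then show "measure ?N (J j) = 1 / real n"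
      by (subst measure_uniform_measure) (auto simp: J_def divide_right_mono diff_divide_distrib[symmetric])
  qed
  also have "\<dots> = (\<Sum>j\<in>{0..<int n}. c j) / real n" by (simp add: sum_divide_distrib)
  finally show ?thesis by simp
qed

text \<open>Fubini integrates over the matrix first; the average over the root becomes an integral
  over \<open>u\<close>, with pointwise limit from \<open>expectation_limit\<close> and majorant
  \<open>C\<close>.\<close>

lemma weighted_limit:
  assumes \<beta>: "\<beta> > 0" and \<gamma>: "\<gamma> \<ge> 1"
    and T: "\<And>n. n \<ge> 1 \<Longrightarrow> beta_laguerre (M n) \<beta> \<gamma> n (T n)"
    and F: "bounded_locally_continuous F"
  shows "(\<lambda>n. \<integral>z. F (tridiagonal_graph n (T n (fst z))) (snd z) \<partial>(M n \<Otimes>\<^sub>M uniform_count_measure {0..<int n}))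
    \<longlonglongrightarrow> (\<integral>u. F (laguerre_limit_graph \<beta> \<gamma> u) 0 \<partial>uniform_measure lborel {0..1::real})"
proof -
  let ?N = "uniform_measure lborel {0..1::real}"
  interpret N: prob_space ?N by (rule prob_space_uniform_measure) auto
  obtain C where C: "\<And>G x. rooted_graph G x \<Longrightarrow> \<bar>F G x\<bar> \<le> C"
    using F by (auto simp: bounded_locally_continuous_def)
  define E where "E n j = (\<integral>\<omega>. F (tridiagonal_graph n (T n \<omega>)) j \<partial>M n)" for n and j :: int
  have E_bd: "\<bar>E n j\<bar> \<le> C" if n: "n \<ge> 1" and j: "j \<in> {0..<int n}" for n j
  proof -
    interpret prob_space "M n" by (rule beta_laguerreD[OF T[OF n]])
    have bd: "\<bar>F (tridiagonal_graph n (T n \<omega>)) j\<bar> \<le> C" if "\<omega> \<in> space (M n)" for \<omega>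
      by (rule C[OF rooted_graph_tridiagonal[OF T[OF n] that j]])
    have "integrable (M n) (\<lambda>\<omega>. F (tridiagonal_graph n (T n \<omega>)) j)"
      by (rule integrable_const_bound[where B=C])
         (use bd measurable_tridiagonal[OF T[OF n] F j] in \<open>auto intro!: AE_I2\<close>)
    then have "\<bar>E n j\<bar> \<le> (\<integral>\<omega>. C \<partial>M n)"
      unfolding E_def by (intro order.trans[OF integral_abs_bound] integral_mono) (use bd in auto)
    then show ?thesis using prob_space by simp
  qed
  have avg: "(\<integral>z. F (tridiagonal_graph n (T n (fst z))) (snd z) \<partial>(M n \<Otimes>\<^sub>M uniform_count_measure {0..<int n}))
      = (LINT u|?N. indicator {0<..<1} u * E n \<lfloor>real n * u\<rfloor>)" if n: "n \<ge> 1" for n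
  proof -
    let ?U = "uniform_count_measure {0..<int n}"
    interpret M: prob_space "M n" by (rule beta_laguerreD[OF T[OF n]])
    interpret U: prob_space ?U
      using n by (intro prob_space_uniform_count_measure) auto
    interpret P: pair_prob_space "M n" ?U ..
    have i: "integrable (M n \<Otimes>\<^sub>M ?U) (\<lambda>(\<omega>, j). F (tridiagonal_graph n (T n \<omega>)) j)"
    proof (rule P.integrable_const_bound[where B=C])
      show "AE z in M n \<Otimes>\<^sub>M ?U. norm (case z of (\<omega>, j) \<Rightarrow> F (tridiagonal_graph n (T n \<omega>)) j) \<le> C"
        using C[OF rooted_graph_tridiagonal[OF T[OF n]]]
        by (intro AE_I2) (auto simp: space_pair_measure space_uniform_count_measure)
    qed (rule measurable_tridiagonal_pair[OF T[OF n] F])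
    have "(\<integral>z. F (tridiagonal_graph n (T n (fst z))) (snd z) \<partial>(M n \<Otimes>\<^sub>M ?U)) = (\<integral>j. E n j \<partial>?U)"
      unfolding E_def using P.integral_snd[OF i] by (simp add: split_beta')
    also have "\<dots> = (\<Sum>j\<in>{0..<int n}. E n j) / real n"
      by (subst integral_uniform_count_measure) auto
    also have "\<dots> = (LINT u|?N. indicator {0<..<1} u * E n \<lfloor>real n * u\<rfloor>)"
      by (rule average_eq_integral[OF n])
    finally show ?thesis .
  qed
  have Fm: "(\<lambda>u. F (laguerre_limit_graph \<beta> \<gamma> u) 0) \<in> borel_measurable borel"
    using random_rooted_graph_laguerre[of \<beta> \<gamma>] F by (auto simp: random_rooted_graph_def)
  \<comment> \<open>The index is shifted because the bound \<open>C\<close> on the expectations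
    needs \<open>n \<ge> 1\<close>, whereas dominated convergence asks for a bound at every
    index.\<close>
  have "(\<lambda>n. LINT u|?N. indicator {0<..<1} u * E (Suc n) \<lfloor>real (Suc n) * u\<rfloor>)
      \<longlonglongrightarrow> (LINT u|?N. F (laguerre_limit_graph \<beta> \<gamma> u) 0)"
  proof (rule integral_dominated_convergence[where w="\<lambda>_. C"])
    show "(\<lambda>u. indicator {0<..<1} u * E (Suc n) \<lfloor>real (Suc n) * u\<rfloor>) \<in> borel_measurable ?N" for n
      by measurable
    show "AE u in ?N. (\<lambda>n. indicator {0<..<1} u * E (Suc n) \<lfloor>real (Suc n) * u\<rfloor>) \<longlonglongrightarrow> F (laguerre_limit_graph \<beta> \<gamma> u) 0"
    proof (rule AE_uniform_measureI)
      show "AE u in lborel. u \<in> {0..1} \<longrightarrow> (\<lambda>n. indicator {0<..<1} u * E (Suc n) \<lfloor>real (Suc n) * u\<rfloor>) \<longlonglongrightarrow> F (laguerre_limit_graph \<beta> \<gamma> u) 0"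
        using AE_lborel_singleton[of 0] AE_lborel_singleton[of 1]
      proof eventually_elim
        case (elim u)
        show ?case
        proof
          assume "u \<in> {0..1}"
          then have u: "0 < u" "u < 1" using elim by auto
          have "(\<lambda>n. E n \<lfloor>real n * u\<rfloor>) \<longlonglongrightarrow> F (laguerre_limit_graph \<beta> \<gamma> u) 0"
            unfolding E_def by (rule expectation_limit[OF \<beta> \<gamma> T F u])
          from LIMSEQ_Suc[OF this]
          show "(\<lambda>n. indicator {0<..<1} u * E (Suc n) \<lfloor>real (Suc n) * u\<rfloor>) \<longlonglongrightarrow> F (laguerre_limit_graph \<beta> \<gamma> u) 0"
            using u by simp
        qed
      qed
    qed simp
    show "AE u in ?N. norm (indicator {0<..<1} u * E (Suc n) \<lfloor>real (Suc n) * u\<rfloor>) \<le> C" for n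
    proof (rule AE_I2)
      fix u :: real
      have "C \<ge> 0" using C[OF rooted_graph_laguerre] by (meson abs_ge_zero order.trans)
      moreover have "\<bar>E (Suc n) \<lfloor>real (Suc n) * u\<rfloor>\<bar> \<le> C" if u: "0 < u" "u < 1"
      proof (rule E_bd)
        have "real (Suc n) * u < real (Suc n) * 1" using u by (intro mult_strict_left_mono) auto
        then show "\<lfloor>real (Suc n) * u\<rfloor> \<in> {0..<int (Suc n)}"
          using u by (auto simp: floor_less_iff simp del: of_nat_Suc)
      qed simp
      ultimately show "norm (indicator {0<..<1} u * E (Suc n) \<lfloor>real (Suc n) * u\<rfloor>) \<le> C"
        by (simp add: indicator_def)
    qed
  qed (use Fm in auto)
  moreover have "(LINT u|?N. indicator {0<..<1} u * E (Suc n) \<lfloor>real (Suc n) * u\<rfloor>)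
      = (\<integral>z. F (tridiagonal_graph (Suc n) (T (Suc n) (fst z))) (snd z) \<partial>(M (Suc n) \<Otimes>\<^sub>M uniform_count_measure {0..<int (Suc n)}))" for n
    by (rule avg[symmetric]) simp
  ultimately have "(\<lambda>n. \<integral>z. F (tridiagonal_graph (Suc n) (T (Suc n) (fst z))) (snd z) \<partial>(M (Suc n) \<Otimes>\<^sub>M uniform_count_measure {0..<int (Suc n)}))
      \<longlonglongrightarrow> (LINT u|?N. F (laguerre_limit_graph \<beta> \<gamma> u) 0)"
    by (simp only:)
  then show ?thesis by (rule LIMSEQ_imp_Suc)
qed

section \<open>Square-summable functions\<close>

text \<open>To be read with \<open>a\<close> and \<open>b\<close> the squared norms of
  \<open>f\<close> and \<open>g\<close> and \<open>c\<close> their inner product; the hypothesis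
  says that the squared norm of \<open>f + z g\<close> is nonnegative.\<close>

lemma sesquilinear_Cauchy_Schwarz:
  fixes a b :: real and c :: complex
  assumes "\<And>z. a + 2 * Re (z * c) + (cmod z)\<^sup>2 * b \<ge> 0" "b \<ge> 0"
  shows "(cmod c)\<^sup>2 \<le> a * b"
proof (cases "b = 0")
  case True
  have "c = 0"
  proof (rule ccontr)
    assume "c \<noteq> 0"
    \<comment> \<open>With this \<open>t\<close> the form takes the value
      \<open>a - (a + 1)\<close>, which is negative.\<close>
    define t where "t = (a + 1) / (cmod c)\<^sup>2"
    have "Re (- (of_real (t / 2) * cnj c) * c) = - t / 2 * (cmod c)\<^sup>2"
      unfolding cmod_power2 by (simp add: power2_eq_square algebra_simps)
    with assms(1)[of "- (of_real (t / 2) * cnj c)"] have "a - t * (cmod c)\<^sup>2 \<ge> 0"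
      using True by simp
    then show False using \<open>c \<noteq> 0\<close> by (simp add: t_def)
  qed
  then show ?thesis using True by simp
next
  case False
  \<comment> \<open>The minimiser of the quadratic form in \<open>z\<close>.\<close>
  define z where "z = - (of_real (1 / b) * cnj c)"
  have "Re (z * c) = - (cmod c)\<^sup>2 / b"
    unfolding cmod_power2 using False by (simp add: z_def power2_eq_square field_simps)
  moreover have "(cmod z)\<^sup>2 * b = (cmod c)\<^sup>2 / b"
    using False assms(2) by (simp add: z_def norm_mult power_divide norm_divide power2_eq_square)
  ultimately have "a - (cmod c)\<^sup>2 / b \<ge> 0"
    using assms(1)[of z] by simp
  then show ?thesis using False assms(2) by (simp add: field_simps)
qed

lemma norm_cnj_mult_le: "cmod (cnj x * y) \<le> (cmod x)\<^sup>2 + (cmod y)\<^sup>2"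
proof -
  have "2 * cmod x * cmod y \<le> (cmod x)\<^sup>2 + (cmod y)\<^sup>2" by (rule sum_squares_bound)
  moreover have "0 \<le> cmod x * cmod y" by simp
  ultimately show ?thesis by (simp add: norm_mult del: mult_nonneg_nonneg)
qed

lemma norm_lincomb_sq_le:
  "(cmod (c * x + d * y))\<^sup>2 \<le> 2 * (cmod c)\<^sup>2 * (cmod x)\<^sup>2 + 2 * (cmod d)\<^sup>2 * (cmod y)\<^sup>2"
proof -
  have "(cmod (c * x + d * y))\<^sup>2 \<le> (cmod (c * x) + cmod (d * y))\<^sup>2"
    by (intro power_mono norm_triangle_ineq) auto
  also have "\<dots> \<le> 2 * (cmod (c * x))\<^sup>2 + 2 * (cmod (d * y))\<^sup>2"
    using sum_squares_bound[of "cmod (c * x)" "cmod (d * y)"] by (simp add: power2_sum)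
  finally show ?thesis by (simp add: norm_mult power_mult_distrib)
qed

lemma l2_product_summable:
  assumes "f \<in> l2 V" "g \<in> l2 V"
  shows "(\<lambda>v. cnj (f v) * g v) summable_on V"
proof (rule abs_summable_summable, rule summable_on_comparison_test)
  show "(\<lambda>v. (cmod (f v))\<^sup>2 + (cmod (g v))\<^sup>2) summable_on V"
    using assms by (intro summable_on_add) (auto simp: l2_def)
qed (use norm_cnj_mult_le in auto)

lemma l2_lincomb:
  assumes "f \<in> l2 V" "g \<in> l2 V"
  shows "(\<lambda>v. c * f v + d * g v) \<in> l2 V"
proof -
  have "(\<lambda>v. (cmod (c * f v + d * g v))\<^sup>2) summable_on V"
  proof (rule summable_on_comparison_test)
    show "(\<lambda>v. 2 * (cmod c)\<^sup>2 * (cmod (f v))\<^sup>2 + 2 * (cmod d)\<^sup>2 * (cmod (g v))\<^sup>2) summable_on V"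
      using assms by (intro summable_on_add summable_on_cmult_right) (auto simp: l2_def)
  qed (use norm_lincomb_sq_le in auto)
  then show ?thesis using assms by (auto simp: l2_def)
qed

lemma l2_inner_lincomb_right:
  assumes "f \<in> l2 V" "g \<in> l2 V" "h \<in> l2 V"
  shows "l2_inner V h (\<lambda>v. c * f v + d * g v) = c * l2_inner V h f + d * l2_inner V h g"
proof -
  note s = l2_product_summable[OF assms(3,1)] l2_product_summable[OF assms(3,2)]
  have "l2_inner V h (\<lambda>v. c * f v + d * g v)
      = (\<Sum>\<^sub>\<infinity>v\<in>V. c * (cnj (h v) * f v) + d * (cnj (h v) * g v))"
    unfolding l2_inner_def by (intro infsum_cong) (simp add: algebra_simps)
  also have "\<dots> = c * l2_inner V h f + d * l2_inner V h g"
    unfolding l2_inner_def using s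
    by (simp add: infsum_add summable_on_cmult_right infsum_cmult_right)
  finally show ?thesis .
qed

lemma l2_inner_cnj: "cnj (l2_inner V f g) = l2_inner V g f"
  unfolding l2_inner_def infsum_cnj[symmetric] by (simp add: mult.commute)

lemma l2_inner_lincomb_left:
  assumes "f \<in> l2 V" "g \<in> l2 V" "h \<in> l2 V"
  shows "l2_inner V (\<lambda>v. c * f v + d * g v) h = cnj c * l2_inner V f h + cnj d * l2_inner V g h"
  by (subst (1 2 3) l2_inner_cnj[symmetric]) (simp add: l2_inner_lincomb_right assms)

text \<open>Without summability both sides are the default value 0, so \<open>l2_inner_same\<close>
  can do without membership in \<open>l2\<close>.\<close>

lemma infsum_complex_of_real: "(\<Sum>\<^sub>\<infinity>v\<in>V. complex_of_real (f v)) = of_real (\<Sum>\<^sub>\<infinity>v\<in>V. f v)"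
proof (cases "f summable_on V")
  case True
  then show ?thesis
    by (intro infsumI) (simp add: has_sum_of_real_iff)
next
  case False
  then have "\<not> (\<lambda>v. complex_of_real (f v)) summable_on V"
    using summable_on_Re[of "\<lambda>v. complex_of_real (f v)" V] by auto
  with False show ?thesis by (simp add: infsum_not_exists)
qed

lemma l2_inner_same: "l2_inner V f f = of_real (\<Sum>\<^sub>\<infinity>v\<in>V. (cmod (f v))\<^sup>2)"
proof -
  have "l2_inner V f f = (\<Sum>\<^sub>\<infinity>v\<in>V. of_real ((cmod (f v))\<^sup>2))"
    unfolding l2_inner_def
    by (intro infsum_cong) (simp add: complex_norm_square mult.commute del: of_real_power)
  then show ?thesis by (simp only: infsum_complex_of_real)
qed

abbreviation l2_sq :: "'v set \<Rightarrow> ('v \<Rightarrow> complex) \<Rightarrow> real" where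
  "l2_sq V f \<equiv> Re (l2_inner V f f)"

lemma l2_inner_nonneg: "l2_sq V f \<ge> 0"
  by (simp add: l2_inner_same infsum_nonneg)

text \<open>Cauchy-Schwarz, the parallelogram estimate in \<open>spectral_moments\<close> and the
  polarization in \<open>Plancherel\<close> are all read off from this expansion.\<close>

lemma l2_inner_expand:
  assumes "f \<in> l2 V" "g \<in> l2 V"
  shows "l2_sq V (\<lambda>v. f v + z * g v)
    = l2_sq V f + 2 * Re (z * l2_inner V f g) + (cmod z)\<^sup>2 * l2_sq V g"
proof -
  have "l2_inner V (\<lambda>v. 1 * f v + z * g v) (\<lambda>v. 1 * f v + z * g v)
    = l2_inner V f f + z * l2_inner V f g + cnj z * (cnj (l2_inner V f g)) + cnj z * z * l2_inner V g g"
    using assms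
    by (simp add: l2_inner_lincomb_left[where c=1 and d=z, simplified] l2_lincomb[where c=1 and d=z, simplified]
       l2_inner_lincomb_right[where c=1 and d=z, simplified] l2_inner_cnj algebra_simps)
  moreover have "Im (l2_inner V g g) = 0" by (simp add: l2_inner_same)
  ultimately show ?thesis
    unfolding cmod_power2 by (simp add: power2_eq_square algebra_simps)
qed

lemma l2_Cauchy_Schwarz:
  assumes "f \<in> l2 V" "g \<in> l2 V"
  shows "(cmod (l2_inner V f g))\<^sup>2 \<le> l2_sq V f * l2_sq V g"
proof (rule sesquilinear_Cauchy_Schwarz)
  fix z
  show "0 \<le> l2_sq V f + 2 * Re (z * l2_inner V f g) + (cmod z)\<^sup>2 * l2_sq V g"
    unfolding l2_inner_expand[OF assms, symmetric] by (rule l2_inner_nonneg)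
qed (rule l2_inner_nonneg)

section \<open>Fourier series\<close>

abbreviation angle_measure :: "real measure" where
  "angle_measure \<equiv> uniform_measure lborel {-pi..pi}"

lemma emeasure_pi_interval: "emeasure lborel {-pi..pi} = ennreal (2 * pi)"
  by simp

lemma prob_space_angle: "prob_space angle_measure"
  by (rule prob_space_uniform_measure) auto

interpretation angle: prob_space angle_measure
  by (rule prob_space_angle)

text \<open>\<open>cis\<close> identifies the points \<open>-pi\<close> and \<open>pi\<close>;
  discarding both makes it injective on what remains.\<close>

lemma AE_angle_open: "AE t in angle_measure. -pi < t \<and> t < pi"
proof (rule AE_uniform_measureI)
  have "AE x in lborel. x \<noteq> pi" "AE x in lborel. x \<noteq> -pi"
    by (auto intro: AE_lborel_singleton)
  then show "AE x in lborel. x \<in> {-pi..pi} \<longrightarrow> -pi < x \<and> x < pi"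
    by eventually_elim auto
qed auto

lemma integral_angle:
  fixes f :: "real \<Rightarrow> 'b::{banach, second_countable_topology}"
  assumes [measurable]: "f \<in> borel_measurable borel"
  shows "(LINT t|angle_measure. f t) = (LINT t:{-pi..pi}|lborel. f t) /\<^sub>R (2 * pi)"
proof -
  have "1 / ennreal (2*pi) = ennreal (1 / (2*pi))"
    by (metis divide_ennreal ennreal_1 mult_pos_pos pi_gt_zero zero_le_one zero_less_numeral)
  then have "angle_measure = density lborel (\<lambda>x. ennreal (indicator {-pi..pi} x / (2*pi)))"
    unfolding uniform_measure_def emeasure_pi_interval
    by (intro density_cong) (auto split: split_indicator)
  then have "(LINT t|angle_measure. f t)
      = (LINT t|lborel. (indicator {-pi..pi} t / (2*pi)) *\<^sub>R f t)"
    by (simp add: integral_density)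
  also have "\<dots> = (LINT t|lborel. (1 / (2*pi)) *\<^sub>R (indicator {-pi..pi} t *\<^sub>R f t))"
    by (intro Bochner_Integration.integral_cong) auto
  also have "\<dots> = (1 / (2*pi)) *\<^sub>R (LINT t|lborel. indicator {-pi..pi} t *\<^sub>R f t)"
    by (rule integral_scaleR_right)
  finally show ?thesis
    by (simp only: set_lebesgue_integral_def inverse_eq_divide)
qed

section \<open>Characters and uniqueness of Fourier coefficients\<close>

definition fourier_char :: "int \<Rightarrow> real \<Rightarrow> complex" where
  "fourier_char k t = cis (real_of_int k * t)"

lemma fourier_char_0 [simp]: "fourier_char 0 t = 1"
  by (simp add: fourier_char_def)

lemma fourier_char_add: "fourier_char (j + k) t = fourier_char j t * fourier_char k t"
  by (simp add: fourier_char_def cis_mult algebra_simps)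

lemma cnj_fourier_char: "cnj (fourier_char k t) = fourier_char (- k) t"
  by (simp add: fourier_char_def cis_cnj)

lemma norm_fourier_char [simp]: "cmod (fourier_char k t) = 1"
  by (simp add: fourier_char_def)

lemma continuous_fourier_char [continuous_intros]: "continuous_on S (fourier_char k)"
  unfolding fourier_char_def by (intro continuous_intros)

lemma measurable_fourier_char [measurable]: "fourier_char k \<in> borel_measurable borel"
  by (intro borel_measurable_continuous_onI continuous_intros)

text \<open>A nonconstant character has a periodic antiderivative. By multiplicativity of characters
  this is their orthonormality.\<close>

lemma integral_fourier_char: "(LINT t|angle_measure. fourier_char k t) = (if k = 0 then 1 else 0)"
proof (cases "k = 0")
  case True
  then show ?thesis by (simp add: angle.prob_space[simplified])
next
  case False
  define F where "F t = fourier_char k t / (\<i> * of_int k)" for t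
  have "(LINT t:{-pi..pi}|lborel. fourier_char k t) = F pi - F (-pi)"
    unfolding set_lebesgue_integral_def
  proof (rule integral_FTC_Icc)
    fix x :: real
    show "(F has_vector_derivative fourier_char k x) (at x within {-pi..pi})"
      unfolding F_def fourier_char_def using False
      by (auto intro!: derivative_eq_intros simp: has_vector_derivative_def scaleR_conv_of_real field_simps)
  qed (auto intro!: continuous_intros)
  also have "\<dots> = 0"
  proof -
    have "cis (of_int k * pi) = cis (of_int k * (- pi))"
      using sin_npi_int[of k] by (simp add: complex_eq_iff mult.commute)
    then show ?thesis unfolding F_def fourier_char_def by simp
  qed
  finally show ?thesis using False by (simp add: integral_angle)
qed

definition fourier_coef :: "(real \<Rightarrow> complex) \<Rightarrow> int \<Rightarrow> complex" where
  "fourier_coef h k = (LINT t|angle_measure. fourier_char (- k) t * h t)"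

lemma integrable_bounded_mult:
  fixes h g :: "'a \<Rightarrow> complex"
  assumes "integrable M h" "g \<in> borel_measurable M" "\<And>x. cmod (g x) \<le> C"
  shows "integrable M (\<lambda>x. g x * h x)"
proof (rule Bochner_Integration.integrable_bound)
  show "integrable M (\<lambda>x. C * cmod (h x))" using assms(1) by auto
  show "AE x in M. norm (g x * h x) \<le> norm (C * cmod (h x))"
  proof (rule AE_I2)
    fix x
    have "cmod (g x) * cmod (h x) \<le> C * cmod (h x)"
      using assms(3) by (intro mult_right_mono) auto
    then show "norm (g x * h x) \<le> norm (C * cmod (h x))"
      by (smt (verit) norm_mult real_norm_def)
  qed
qed (use assms in measurable)

lemma integrable_fourier_char_mult:
  "integrable angle_measure h \<Longrightarrow> integrable angle_measure (\<lambda>t. fourier_char k t * h t)"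
  by (rule integrable_bounded_mult[where C=1]) auto

text \<open>The kernel of the Fourier transform on integrable functions. The class of functions
  whose product with such an \<open>h\<close> integrates to 0 is enlarged from polynomials in
  \<open>cis t\<close> to continuous functions of it and to indicators of closed and then Borel
  sets, which forces \<open>h = 0\<close> almost everywhere.\<close>

definition coef_null :: "(real \<Rightarrow> complex) \<Rightarrow> bool" where
  "coef_null h \<longleftrightarrow> integrable angle_measure h \<and> (\<forall>k. fourier_coef h k = 0)"

lemma coef_null_add: "coef_null h \<Longrightarrow> coef_null g \<Longrightarrow> coef_null (\<lambda>t. h t + g t)"
  unfolding coef_null_def fourier_coef_def
  by (auto simp: distrib_left integrable_fourier_char_mult)

lemma coef_null_cmult: "coef_null h \<Longrightarrow> coef_null (\<lambda>t. c * h t)"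
  unfolding coef_null_def fourier_coef_def
  by (auto simp: mult.left_commute[of _ c])

lemma coef_null_char:
  assumes "coef_null h"
  shows "coef_null (\<lambda>t. fourier_char j t * h t)"
proof -
  have "fourier_coef (\<lambda>t. fourier_char j t * h t) k = fourier_coef h (k - j)" for k
    unfolding fourier_coef_def mult.assoc[symmetric] fourier_char_add[symmetric] by simp
  then show ?thesis
    using assms by (auto simp: coef_null_def integrable_fourier_char_mult)
qed

text \<open>A polynomial in the coordinates of \<open>cis t\<close> is a trigonometric polynomial,
  and a character only shifts coefficients. \<open>h\<close> stays arbitrary in the induction
  because a product is applied one factor at a time.\<close>

lemma coef_null_polynomial:
  fixes p :: "complex \<Rightarrow> real"
  assumes "real_polynomial_function p" and "coef_null h"
  shows "coef_null (\<lambda>t. of_real (p (cis t)) * h t)"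
  using assms
proof (induction arbitrary: h rule: real_polynomial_function.induct)
  case (linear f)
  interpret bounded_linear f by fact
  \<comment> \<open>Euler's formulas for \<open>cos t\<close> and \<open>sin t\<close>;
    \<open>f\<close> is only real-linear, hence the two separate values \<open>f 1\<close> and
    \<open>f \<i>\<close>.\<close>
  have "complex_of_real (f (cis t)) = ((of_real (f 1) - \<i> * of_real (f \<i>)) / 2) * fourier_char 1 t
      + ((of_real (f 1) + \<i> * of_real (f \<i>)) / 2) * fourier_char (-1) t" for t
  proof -
    have "cis t = cos t *\<^sub>R 1 + sin t *\<^sub>R \<i>" by (simp add: complex_eq_iff)
    then have "f (cis t) = cos t * f 1 + sin t * f \<i>"
      by (simp only: add scaleR) simp
    then show ?thesis
      by (simp add: fourier_char_def complex_eq_iff field_simps)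
  qed
  then have "(\<lambda>t. of_real (f (cis t)) * h t)
    = (\<lambda>t. ((of_real (f 1) - \<i> * of_real (f \<i>)) / 2) * (fourier_char 1 t * h t)
      + ((of_real (f 1) + \<i> * of_real (f \<i>)) / 2) * (fourier_char (-1) t * h t))"
    by (auto simp: algebra_simps)
  then show ?case
    by (simp only:) (intro coef_null_add coef_null_cmult coef_null_char linear.prems)
next
  case (const c)
  then show ?case by (rule coef_null_cmult)
next
  case (add f g)
  then show ?case
    using coef_null_add[OF add.IH(1)[OF add.prems] add.IH(2)[OF add.prems]]
    by (simp add: distrib_right)
next
  case (mult f g)
  show ?case
    using mult.IH(1)[OF mult.IH(2)[OF mult.prems]] by (simp add: mult.assoc)
qed

text \<open>Stone-Weierstrass on the unit circle: a uniform error \<open>e\<close> costs at most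
  \<open>e\<close> times the L1 norm \<open>B\<close> of \<open>h\<close>.\<close>

lemma coef_null_continuous:
  fixes g :: "complex \<Rightarrow> real"
  assumes h: "coef_null h" and g: "continuous_on UNIV g"
  shows "(LINT t|angle_measure. of_real (g (cis t)) * h t) = 0"
proof -
  have hi: "integrable angle_measure h" using h by (simp add: coef_null_def)
  define B where "B = (LINT t|angle_measure. cmod (h t))"
  have B: "B \<ge> 0" unfolding B_def by simp
  have [measurable]: "(\<lambda>t. g (cis t)) \<in> borel_measurable borel"
    by (intro borel_measurable_continuous_onI continuous_on_compose2[OF g] continuous_intros) auto
  have "cmod (LINT t|angle_measure. of_real (g (cis t)) * h t) \<le> e * B" if "e > 0" for e
  proof -
    obtain p where p: "real_polynomial_function p" "\<And>x. x \<in> sphere 0 1 \<Longrightarrow> \<bar>g x - p x\<bar> < e"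
      using Stone_Weierstrass_real_polynomial_function[OF compact_sphere[of "0::complex" 1]
          continuous_on_subset[OF g subset_UNIV] \<open>e > 0\<close>] by blast
    have pc: "continuous_on UNIV p"
      using p(1) by (intro continuous_on_polymonial_function) (simp add: real_polynomial_function_eq)
    have [measurable]: "(\<lambda>t. p (cis t)) \<in> borel_measurable borel"
      by (intro borel_measurable_continuous_onI continuous_on_compose2[OF pc] continuous_intros) auto
    have cn: "coef_null (\<lambda>t. of_real (p (cis t)) * h t)"
      by (rule coef_null_polynomial[OF p(1) h])
    have p0: "(LINT t|angle_measure. of_real (p (cis t)) * h t) = 0"
      using cn[unfolded coef_null_def fourier_coef_def, THEN conjunct2, rule_format, of 0] by simp
    have d: "cmod (of_real (g (cis t) - p (cis t))) \<le> e" for t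
      using p(2)[of "cis t"] by (simp del: of_real_diff)
    have i: "integrable angle_measure (\<lambda>t. of_real (g (cis t) - p (cis t)) * h t)"
      by (rule integrable_bounded_mult[OF hi _ d]) simp
    have "(LINT t|angle_measure. of_real (g (cis t)) * h t)
       = (LINT t|angle_measure. of_real (g (cis t) - p (cis t)) * h t + of_real (p (cis t)) * h t)"
      by (intro Bochner_Integration.integral_cong) (auto simp: algebra_simps)
    also have "\<dots> = (LINT t|angle_measure. of_real (g (cis t) - p (cis t)) * h t)"
      using i cn p0 by (subst Bochner_Integration.integral_add) (auto simp: coef_null_def)
    also have "cmod \<dots> \<le> (LINT t|angle_measure. cmod (of_real (g (cis t) - p (cis t)) * h t))"
      by (rule integral_norm_bound)
    also have "\<dots> \<le> (LINT t|angle_measure. e * cmod (h t))"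
    proof (rule integral_mono)
      show "integrable angle_measure (\<lambda>t. cmod (of_real (g (cis t) - p (cis t)) * h t))"
        using i by (rule integrable_norm)
      show "cmod (of_real (g (cis t) - p (cis t)) * h t) \<le> e * cmod (h t)" for t
        using mult_right_mono[OF d[of t] norm_ge_zero[of "h t"]] by (simp only: norm_mult)
    qed (use hi in auto)
    finally show ?thesis by (simp add: B_def)
  qed
  note bound = this
  have "cmod (LINT t|angle_measure. of_real (g (cis t)) * h t) \<le> 0"
  proof (rule field_le_epsilon)
    fix e :: real assume "e > 0"
    \<comment> \<open>The denominator \<open>B + 1\<close> is positive even if \<open>h\<close>
      vanishes.\<close>
    then have "e / (B + 1) * B \<le> e" using B by (simp add: field_simps)
    then show "cmod (LINT t|angle_measure. of_real (g (cis t)) * h t) \<le> 0 + e"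
      using bound[of "e / (B + 1)"] \<open>e > 0\<close> B by simp
  qed
  then show ?thesis by simp
qed

lemma coef_null_closed:
  assumes h: "coef_null h" and A: "closed A"
  shows "(LINT t:A|angle_measure. h t) = 0"
proof -
  have hi: "integrable angle_measure h" using h by (simp add: coef_null_def)
  \<comment> \<open>The approximating functions must be functions of \<open>cis t\<close>;
    compactness of the interval keeps the image on the circle closed.\<close>
  define S where "S = cis ` (A \<inter> {-pi..pi})"
  have S: "closed S"
    unfolding S_def using A
    by (intro compact_imp_closed compact_continuous_image continuous_intros) auto
  show ?thesis
  \<comment> \<open>\<open>infdist z {}\<close> is 0 by convention, so the distance functions below
    would not approximate the indicator of an empty set.\<close>
  proof (cases "S = {}")
    case True
    have "(LINT t:A|angle_measure. h t) = (LINT t|angle_measure. 0)"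
      unfolding set_lebesgue_integral_def
    proof (rule integral_cong_AE)
      show "AE t in angle_measure. indicator A t *\<^sub>R h t = 0"
        using AE_angle_open by eventually_elim (use True in \<open>auto simp: S_def indicator_def\<close>)
      show "(\<lambda>t. indicator A t *\<^sub>R h t) \<in> borel_measurable angle_measure"
        using hi A by (intro borel_measurable_scaleR borel_measurable_indicator) auto
    qed simp
    then show ?thesis by simp
  next
    case False
    \<comment> \<open>Continuous functions decreasing to the indicator of \<open>S\<close>, because
      a nonempty closed set is the zero set of its distance function.\<close>
    define g where "g n z = max 0 (1 - real n * infdist z S)" for n z
    have g_cont: "continuous_on UNIV (g n)" for n
      unfolding g_def by (intro continuous_intros)
    have g_bd: "0 \<le> g n z" "g n z \<le> 1" for n z
      using infdist_nonneg[of z S] by (auto simp: g_def)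
    have g_lim: "(\<lambda>n. g n z) \<longlonglongrightarrow> indicator S z" for z
    proof (cases "z \<in> S")
      case True
      then show ?thesis by (simp add: g_def)
    next
      case F: False
      then have pos: "infdist z S > 0"
        using S False in_closed_iff_infdist_zero[of S z] infdist_nonneg[of z S] by fastforce
      obtain N where N: "real N * infdist z S \<ge> 1"
        using pos by (metis ex_less_of_nat_mult less_eq_real_def)
      have "g n z = 0" if "n \<ge> N" for n
      proof -
        have "real N * infdist z S \<le> real n * infdist z S"
          using that pos by (intro mult_right_mono) auto
        then show ?thesis using N by (simp add: g_def)
      qed
      then have "\<forall>\<^sub>F n in sequentially. g n z = indicator S z"
        using F eventually_sequentially by (auto intro!: exI[of _ N])
      then show ?thesis by (rule tendsto_eventually)
    qed
    have [measurable]: "(\<lambda>t. g n (cis t)) \<in> borel_measurable borel" for n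
      by (intro borel_measurable_continuous_onI continuous_on_compose2[OF g_cont] continuous_intros) auto
    have [measurable]: "cis \<in> borel_measurable borel"
      by (intro borel_measurable_continuous_onI continuous_intros)
    have [measurable]: "S \<in> sets borel" using S by simp
    have "(\<lambda>n. LINT t|angle_measure. of_real (g n (cis t)) * h t)
        \<longlonglongrightarrow> (LINT t|angle_measure. of_real (indicator S (cis t)) * h t)"
    proof (rule integral_dominated_convergence[where w="\<lambda>t. cmod (h t)"])
      show "AE t in angle_measure. (\<lambda>n. of_real (g n (cis t)) * h t)
          \<longlonglongrightarrow> of_real (indicator S (cis t)) * h t"
        by (intro AE_I2 tendsto_intros g_lim)
      show "AE t in angle_measure. norm (of_real (g n (cis t)) * h t) \<le> cmod (h t)" for n
        using g_bd by (intro AE_I2) (auto simp: norm_mult intro!: mult_left_le_one_le)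
    qed (use hi in auto)
    then have "(LINT t|angle_measure. of_real (indicator S (cis t)) * h t) = 0"
      using coef_null_continuous[OF h g_cont] by (simp add: LIMSEQ_const_iff)
    moreover have "(LINT t:A|angle_measure. h t)
        = (LINT t|angle_measure. of_real (indicator S (cis t)) * h t)"
      unfolding set_lebesgue_integral_def
    proof (rule integral_cong_AE)
      show "AE t in angle_measure. indicator A t *\<^sub>R h t = of_real (indicator S (cis t)) * h t"
        using AE_angle_open
      proof eventually_elim
        case (elim t)
        have "t \<in> A" if "cis t = cis s" "s \<in> A" "-pi \<le> s" "s \<le> pi" for s
        proof -
          have "s \<noteq> -pi"
          proof
            assume "s = -pi"
            then have "cis t = cis pi" using that by (simp add: complex_eq_iff)
            moreover have "Arg (cis t) = t" "Arg (cis pi) = pi"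
              using elim by (auto intro!: Arg_cis simp del: cis_pi)
            ultimately show False using elim by simp
          qed
          have "Arg (cis t) = t" by (rule Arg_cis) (use elim in auto)
          moreover have "Arg (cis s) = s" by (rule Arg_cis) (use that \<open>s \<noteq> -pi\<close> in auto)
          ultimately have "t = s" using that(1) by metis
          then show ?thesis using that(2) by simp
        qed
        then have "cis t \<in> S \<longleftrightarrow> t \<in> A" using elim by (force simp: S_def)
        then show ?case by (auto simp: indicator_def)
      qed
    qed (use hi A in \<open>auto intro!: borel_measurable_scaleR borel_measurable_indicator\<close>)
    ultimately show ?thesis by simp
  qed
qed

text \<open>Closed sets are an intersection-stable generator, so a Dynkin argument extends the
  vanishing of the integrals to all Borel sets, and these determine \<open>h\<close> up to a null
  set.\<close>

lemma coef_null_AE: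
  assumes h: "coef_null h"
  shows "AE t in angle_measure. h t = 0"
proof (rule angle.density_unique_banach)
  have hi: "integrable angle_measure h" using h by (simp add: coef_null_def)
  then show "integrable angle_measure h" .
  fix A assume "A \<in> sets angle_measure"
  then have A: "A \<in> sigma_sets UNIV (Collect closed)" by (simp add: borel_eq_closed)
  have m: "B \<in> sets borel" if "B \<in> sigma_sets UNIV (Collect closed)" for B :: "real set"
    using that by (simp add: borel_eq_closed)
  have si: "set_integrable angle_measure B h" if "B \<in> sets borel" for B
    using hi that unfolding set_integrable_def by (intro integrable_mult_indicator) auto
  have U: "(LINT t:UNIV|angle_measure. h t) = 0"
    by (rule coef_null_closed[OF h]) simp
  have "(LINT t:A|angle_measure. h t) = 0"
  proof (rule sigma_sets_induct_disjoint[OF _ _ A])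
    show "Int_stable (Collect closed)" by (auto simp: Int_stable_def)
    show "(LINT t:B|angle_measure. h t) = 0" if "B \<in> Collect closed" for B
      using coef_null_closed[OF h] that by simp
    show "(LINT t:UNIV - B|angle_measure. h t) = 0"
      if "B \<in> sigma_sets UNIV (Collect closed)" "(LINT t:B|angle_measure. h t) = 0" for B
    proof -
      have "(LINT t:B \<union> (UNIV - B)|angle_measure. h t)
         = (LINT t:B|angle_measure. h t) + (LINT t:(UNIV - B)|angle_measure. h t)"
        using m[OF that(1)] by (intro set_integral_Un si) auto
      then show ?thesis using U that(2) by simp
    qed
    show "(LINT t:(\<Union>i. B i)|angle_measure. h t) = 0"
      if "disjoint_family B" "range B \<subseteq> sigma_sets UNIV (Collect closed)"
        "\<And>i::nat. (LINT t:B i|angle_measure. h t) = 0" for B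
    proof -
      have "B i \<in> sets borel" for i using that(2) m by blast
      then have "(LINT t:(\<Union>i. B i)|angle_measure. h t) = (\<Sum>i. LINT t:B i|angle_measure. h t)"
        using that(1)
        by (intro lebesgue_integral_countable_add si) (auto simp: disjoint_family_on_def)
      then show ?thesis using that(3) by simp
    qed
  qed (auto simp: set_lebesgue_integral_def)
  then show "(LINT t:A|angle_measure. h t) = (LINT t:A|angle_measure. 0)"
    by simp
qed simp

section \<open>Square-integrable functions on the circle\<close>

lemma measurable_cnj [measurable]: "cnj \<in> borel_measurable borel"
  by (intro borel_measurable_continuous_onI continuous_intros)

text \<open>Functions rather than classes modulo null sets; independence of the representative is
  supplied by \<open>coef_inj\<close> and \<open>coef_cong_AE\<close>.\<close>

definition sq_int :: "(real \<Rightarrow> complex) \<Rightarrow> bool" where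
  "sq_int h \<longleftrightarrow> h \<in> borel_measurable borel \<and> integrable angle_measure (\<lambda>t. (cmod (h t))\<^sup>2)"

definition L2_inner :: "(real \<Rightarrow> complex) \<Rightarrow> (real \<Rightarrow> complex) \<Rightarrow> complex" where
  "L2_inner g h = (LINT t|angle_measure. cnj (g t) * h t)"

lemma sq_int_product_integrable:
  assumes "sq_int g" "sq_int h"
  shows "integrable angle_measure (\<lambda>t. cnj (g t) * h t)"
proof (rule Bochner_Integration.integrable_bound)
  show "integrable angle_measure (\<lambda>t. (cmod (g t))\<^sup>2 + (cmod (h t))\<^sup>2)"
    using assms by (auto simp: sq_int_def)
  have [measurable]: "g \<in> borel_measurable borel" "h \<in> borel_measurable borel"
    using assms by (auto simp: sq_int_def)
  show "(\<lambda>t. cnj (g t) * h t) \<in> borel_measurable angle_measure"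
    by simp
  show "AE t in angle_measure. norm (cnj (g t) * h t) \<le> norm ((cmod (g t))\<^sup>2 + (cmod (h t))\<^sup>2)"
    using norm_cnj_mult_le by (auto intro!: AE_I2)
qed

lemma sq_int_bounded:
  assumes [measurable]: "h \<in> borel_measurable borel" and "\<And>t. cmod (h t) \<le> C"
  shows "sq_int h"
  unfolding sq_int_def
proof (intro conjI assms(1))
  show "integrable angle_measure (\<lambda>t. (cmod (h t))\<^sup>2)"
    by (rule angle.integrable_const_bound[where B="C\<^sup>2"])
       (use assms(2) in \<open>auto intro!: AE_I2 power_mono\<close>)
qed

lemma sq_int_bounded_mult:
  assumes h: "sq_int h" and [measurable]: "g \<in> borel_measurable borel" and g: "\<And>t. cmod (g t) \<le> C"
  shows "sq_int (\<lambda>t. g t * h t)"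
  unfolding sq_int_def
proof
  have [measurable]: "h \<in> borel_measurable borel" using h by (simp add: sq_int_def)
  show "(\<lambda>t. g t * h t) \<in> borel_measurable borel" by simp
  show "integrable angle_measure (\<lambda>t. (cmod (g t * h t))\<^sup>2)"
  proof (rule Bochner_Integration.integrable_bound)
    show "integrable angle_measure (\<lambda>t. C\<^sup>2 * (cmod (h t))\<^sup>2)"
      using h by (simp add: sq_int_def)
    have "(cmod (g t))\<^sup>2 * (cmod (h t))\<^sup>2 \<le> C\<^sup>2 * (cmod (h t))\<^sup>2" for t
      using g by (intro mult_right_mono power_mono) auto
    then show "AE t in angle_measure. norm ((cmod (g t * h t))\<^sup>2) \<le> norm (C\<^sup>2 * (cmod (h t))\<^sup>2)"
      by (intro AE_I2) (simp add: norm_mult power_mult_distrib)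
  qed simp
qed

lemma sq_int_lincomb:
  assumes "sq_int g" "sq_int h"
  shows "sq_int (\<lambda>t. c * g t + d * h t)"
  unfolding sq_int_def
proof
  have [measurable]: "g \<in> borel_measurable borel" "h \<in> borel_measurable borel"
    using assms by (auto simp: sq_int_def)
  show "(\<lambda>t. c * g t + d * h t) \<in> borel_measurable borel" by simp
  show "integrable angle_measure (\<lambda>t. (cmod (c * g t + d * h t))\<^sup>2)"
  proof (rule Bochner_Integration.integrable_bound)
    show "integrable angle_measure (\<lambda>t. 2 * (cmod c)\<^sup>2 * (cmod (g t))\<^sup>2 + 2 * (cmod d)\<^sup>2 * (cmod (h t))\<^sup>2)"
      using assms by (intro Bochner_Integration.integrable_add integrable_mult_right) (auto simp: sq_int_def)
    show "AE t in angle_measure. norm ((cmod (c * g t + d * h t))\<^sup>2)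
        \<le> norm (2 * (cmod c)\<^sup>2 * (cmod (g t))\<^sup>2 + 2 * (cmod d)\<^sup>2 * (cmod (h t))\<^sup>2)"
      using norm_lincomb_sq_le by (auto intro!: AE_I2)
  qed simp
qed

lemma sq_int_diff: "sq_int g \<Longrightarrow> sq_int h \<Longrightarrow> sq_int (\<lambda>t. g t - h t)"
  using sq_int_lincomb[of g h 1 "-1"] by simp

lemma sq_int_char: "sq_int (fourier_char k)"
  by (rule sq_int_bounded[where C=1]) auto

lemma sq_int_integrable:
  assumes "sq_int h" shows "integrable angle_measure h"
  using sq_int_product_integrable[OF sq_int_char[of 0] assms] by simp

lemma fourier_coef_eq: "fourier_coef h k = L2_inner (fourier_char k) h"
  by (simp add: fourier_coef_def L2_inner_def cnj_fourier_char)

lemma L2_inner_lincomb_right: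
  assumes "sq_int f" "sq_int g" "sq_int h"
  shows "L2_inner h (\<lambda>v. c * f v + d * g v) = c * L2_inner h f + d * L2_inner h g"
proof -
  note s = sq_int_product_integrable[OF assms(3,1)] sq_int_product_integrable[OF assms(3,2)]
  have "L2_inner h (\<lambda>v. c * f v + d * g v)
      = (LINT v|angle_measure. c * (cnj (h v) * f v) + d * (cnj (h v) * g v))"
    unfolding L2_inner_def by (intro Bochner_Integration.integral_cong) (simp_all add: algebra_simps)
  also have "\<dots> = c * L2_inner h f + d * L2_inner h g"
    unfolding L2_inner_def using s by simp
  finally show ?thesis .
qed

lemma L2_inner_cnj: "cnj (L2_inner f g) = L2_inner g f"
proof -
  have "cnj (L2_inner f g) = (LINT t|angle_measure. cnj (cnj (f t) * g t))"
    unfolding L2_inner_def by (rule Bochner_Integration.integral_cnj[symmetric])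
  then show ?thesis by (simp add: L2_inner_def mult.commute del: Bochner_Integration.integral_cnj)
qed

lemma L2_inner_lincomb_left:
  assumes "sq_int f" "sq_int g" "sq_int h"
  shows "L2_inner (\<lambda>v. c * f v + d * g v) h = cnj c * L2_inner f h + cnj d * L2_inner g h"
  by (subst (1 2 3) L2_inner_cnj[symmetric]) (simp add: L2_inner_lincomb_right assms)

lemma L2_inner_same: "L2_inner f f = of_real (LINT t|angle_measure. (cmod (f t))\<^sup>2)"
  unfolding L2_inner_def integral_complex_of_real[symmetric]
  by (intro Bochner_Integration.integral_cong)
     (simp_all add: complex_norm_square mult.commute del: of_real_power)

abbreviation L2_sq :: "(real \<Rightarrow> complex) \<Rightarrow> real" where
  "L2_sq f \<equiv> Re (L2_inner f f)"

lemma L2_inner_nonneg: "L2_sq f \<ge> 0"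
  by (simp add: L2_inner_same)

lemma L2_inner_expand:
  assumes "sq_int f" "sq_int g"
  shows "L2_sq (\<lambda>v. f v + z * g v)
    = L2_sq f + 2 * Re (z * L2_inner f g) + (cmod z)\<^sup>2 * L2_sq g"
proof -
  have "L2_inner (\<lambda>v. 1 * f v + z * g v) (\<lambda>v. 1 * f v + z * g v)
    = L2_inner f f + z * L2_inner f g + cnj z * (cnj (L2_inner f g)) + cnj z * z * L2_inner g g"
    using assms
    by (simp add: L2_inner_lincomb_left[where c=1 and d=z, simplified] sq_int_lincomb[where c=1 and d=z, simplified]
       L2_inner_lincomb_right[where c=1 and d=z, simplified] L2_inner_cnj algebra_simps)
  moreover have "Im (L2_inner g g) = 0" by (simp add: L2_inner_same)
  ultimately show ?thesis
    unfolding cmod_power2 by (simp add: power2_eq_square algebra_simps)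
qed

lemma coef_lincomb:
  assumes "sq_int g" "sq_int h"
  shows "fourier_coef (\<lambda>t. c * g t + d * h t) k = c * fourier_coef g k + d * fourier_coef h k"
  using assms by (simp add: fourier_coef_eq L2_inner_lincomb_right sq_int_char)

lemma coef_inj:
  assumes "sq_int g" "sq_int h" "fourier_coef g = fourier_coef h"
  shows "AE t in angle_measure. g t = h t"
proof -
  have "fourier_coef (\<lambda>t. 1 * g t + (-1) * h t) k = 0" for k
    using coef_lincomb[OF assms(1,2), of 1 "-1" k] assms(3) by simp
  then have "coef_null (\<lambda>t. g t - h t)"
    using sq_int_integrable[OF assms(1)] sq_int_integrable[OF assms(2)] by (auto simp: coef_null_def)
  from coef_null_AE[OF this] show ?thesis by eventually_elim simp
qed

lemma coef_cong_AE:
  assumes "sq_int g" "sq_int h" "AE t in angle_measure. g t = h t"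
  shows "fourier_coef g = fourier_coef h"
proof
  fix k
  have [measurable]: "g \<in> borel_measurable borel" "h \<in> borel_measurable borel"
    using assms by (auto simp: sq_int_def)
  show "fourier_coef g k = fourier_coef h k"
    unfolding fourier_coef_def using assms(3)
    by (intro integral_cong_AE) (auto elim: eventually_mono)
qed

section \<open>Trigonometric polynomials, Bessel's inequality and completeness\<close>

definition trig_poly :: "(int \<Rightarrow> complex) \<Rightarrow> int set \<Rightarrow> real \<Rightarrow> complex" where
  "trig_poly c K t = (\<Sum>k\<in>K. c k * fourier_char k t)"

lemma measurable_trig_poly [measurable]: "trig_poly c K \<in> borel_measurable borel"
  unfolding trig_poly_def by simp

lemma sq_int_trig_poly: "sq_int (trig_poly c K)"
proof (rule sq_int_bounded[where C="\<Sum>k\<in>K. cmod (c k)"])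
  show "cmod (trig_poly c K t) \<le> (\<Sum>k\<in>K. cmod (c k))" for t
    unfolding trig_poly_def by (rule order.trans[OF norm_sum]) (simp add: norm_mult)
qed simp

lemma L2_inner_trig_poly:
  assumes "sq_int h"
  shows "L2_inner (trig_poly c K) h = (\<Sum>k\<in>K. cnj (c k) * fourier_coef h k)"
proof -
  have "L2_inner (trig_poly c K) h = (LINT t|angle_measure. (\<Sum>k\<in>K. cnj (c k) * (fourier_char (- k) t * h t)))"
    unfolding L2_inner_def trig_poly_def
    by (intro Bochner_Integration.integral_cong) (simp_all add: cnj_fourier_char sum_distrib_right mult.assoc)
  also have "\<dots> = (\<Sum>k\<in>K. cnj (c k) * fourier_coef h k)"
    using integrable_fourier_char_mult[OF sq_int_integrable[OF assms]]
    by (subst Bochner_Integration.integral_sum) (auto simp: fourier_coef_def)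
  finally show ?thesis .
qed

lemma fourier_coef_trig_poly:
  assumes "finite K"
  shows "fourier_coef (trig_poly c K) k = (if k \<in> K then c k else 0)"
proof -
  have "fourier_coef (trig_poly c K) k
      = (LINT t|angle_measure. (\<Sum>j\<in>K. c j * fourier_char (j - k) t))"
    unfolding fourier_coef_def trig_poly_def
    by (intro Bochner_Integration.integral_cong)
       (simp_all add: sum_distrib_left mult.left_commute fourier_char_add[symmetric])
  also have "\<dots> = (\<Sum>j\<in>K. c j * (if j - k = 0 then 1 else 0))"
    using sq_int_integrable[OF sq_int_char]
    by (subst Bochner_Integration.integral_sum) (auto simp: integral_fourier_char intro!: sum.cong)
  also have "\<dots> = (if k \<in> K then c k else 0)"
    using assms by (simp add: if_distrib sum.delta cong: if_cong)
  finally show ?thesis .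
qed

lemma trig_poly_norm:
  assumes "finite K"
  shows "L2_sq (trig_poly c K) = (\<Sum>k\<in>K. (cmod (c k))\<^sup>2)"
  using assms unfolding cmod_power2
  by (simp add: L2_inner_trig_poly sq_int_trig_poly fourier_coef_trig_poly power2_eq_square)

text \<open>Pythagoras for orthonormal characters; \<open>Bessel\<close> is the nonnegativity of the
  left-hand side.\<close>

lemma dist_trig_poly:
  assumes h: "sq_int h" and K: "finite K" and c: "\<And>k. k \<in> K \<Longrightarrow> fourier_coef h k = c k"
  shows "L2_sq (\<lambda>t. h t - trig_poly c K t)
     = L2_sq h - (\<Sum>k\<in>K. (cmod (c k))\<^sup>2)"
proof -
  let ?S = "trig_poly c K"
  have e: "L2_inner ?S h = of_real (\<Sum>k\<in>K. (cmod (c k))\<^sup>2)"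
    using h c by (simp add: L2_inner_trig_poly complex_norm_square mult.commute del: of_real_power)
  have s: "L2_sq ?S = (\<Sum>k\<in>K. (cmod (c k))\<^sup>2)" by (rule trig_poly_norm[OF K])
  have "L2_inner (\<lambda>t. 1 * h t + (-1) * ?S t) (\<lambda>t. 1 * h t + (-1) * ?S t)
    = L2_inner h h - cnj (L2_inner ?S h) - L2_inner ?S h + L2_inner ?S ?S"
    using h sq_int_trig_poly[of c K] sq_int_lincomb[of h ?S 1 "-1"]
    by (subst L2_inner_lincomb_left) (simp_all add: L2_inner_lincomb_right[where c=1 and d="-1", simplified] L2_inner_cnj)
  then show ?thesis using e s by simp
qed

lemma Bessel:
  assumes h: "sq_int h" and K: "finite K"
  shows "(\<Sum>k\<in>K. (cmod (fourier_coef h k))\<^sup>2) \<le> L2_sq h"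
proof -
  have "0 \<le> L2_sq h - (\<Sum>k\<in>K. (cmod (fourier_coef h k))\<^sup>2)"
    unfolding dist_trig_poly[OF h K refl, symmetric] by (rule L2_inner_nonneg)
  then show ?thesis by simp
qed

lemma fourier_coef_l2:
  assumes "sq_int h" shows "fourier_coef h \<in> l2 UNIV"
proof -
  have "(\<lambda>k. (cmod (fourier_coef h k))\<^sup>2) summable_on UNIV"
  proof (rule nonneg_bdd_above_summable_on)
    show "bdd_above (sum (\<lambda>k. (cmod (fourier_coef h k))\<^sup>2) ` {F. F \<subseteq> UNIV \<and> finite F})"
      using Bessel[OF assms] by (intro bdd_aboveI2) simp
  qed simp
  then show ?thesis by (simp add: l2_def)
qed

text \<open>Unordered sums converge along the net of finite sets, in which the symmetric intervals
  are cofinal.\<close>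

lemma has_sum_symmetric_limit:
  fixes f :: "int \<Rightarrow> 'b::{comm_monoid_add, topological_space}"
  assumes "(f has_sum s) UNIV"
  shows "(\<lambda>N. \<Sum>k\<in>{-int N..int N}. f k) \<longlonglongrightarrow> s"
proof -
  have "filterlim (\<lambda>N. {-int N..int N}) (finite_subsets_at_top UNIV) sequentially"
    unfolding filterlim_finite_subsets_at_top
  proof safe
    fix X :: "int set" assume "finite X"
    then obtain b where b: "\<And>x. x \<in> X \<Longrightarrow> \<bar>x\<bar> \<le> b"
      using bdd_above_finite[of "abs ` X"] by (fastforce simp: bdd_above_def)
    have "finite {-int N..int N} \<and> X \<subseteq> {-int N..int N} \<and> {-int N..int N} \<subseteq> UNIV" if "N \<ge> nat b" for N
      using b that by fastforce
    then show "\<forall>\<^sub>F N in sequentially. finite {-int N..int N} \<and> X \<subseteq> {-int N..int N} \<and> {-int N..int N} \<subseteq> UNIV"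
      by (rule eventually_sequentiallyI)
  qed
  with assms show ?thesis
    unfolding has_sum_def by (rule filterlim_compose)
qed

abbreviation partial_trig :: "(int \<Rightarrow> complex) \<Rightarrow> nat \<Rightarrow> real \<Rightarrow> complex" where
  "partial_trig f N \<equiv> trig_poly f {-int N..int N}"

lemma trig_poly_diff:
  assumes "finite K" "J \<subseteq> K"
  shows "trig_poly f K t - trig_poly f J t = trig_poly f (K - J) t"
  using assms by (simp add: trig_poly_def sum_diff)

text \<open>Integrating \<open>2 * cmod (h t) * c \<le> (cmod (h t))\<^sup>2 + c\<^sup>2\<close>
  gives what Cauchy-Schwarz would give on a probability space.\<close>

lemma angle_L1_le:
  assumes h: "sq_int h" and c: "c > 0" and e: "L2_sq h \<le> c\<^sup>2"
  shows "(LINT t|angle_measure. cmod (h t)) \<le> c"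
proof -
  have i: "integrable angle_measure (\<lambda>t. (cmod (h t))\<^sup>2)" using h by (simp add: sq_int_def)
  have "cmod (h t) \<le> (cmod (h t))\<^sup>2 / (2 * c) + c / 2" for t
    using c sum_squares_bound[of "cmod (h t)" c] by (simp add: field_simps power2_eq_square)
  then have "(LINT t|angle_measure. cmod (h t)) \<le> (LINT t|angle_measure. (cmod (h t))\<^sup>2 / (2 * c) + c / 2)"
    using sq_int_integrable[OF h] i by (intro integral_mono) auto
  also have "\<dots> = L2_sq h / (2 * c) + c / 2"
    using i angle.prob_space by (simp add: L2_inner_same)
  also have "\<dots> \<le> c\<^sup>2 / (2 * c) + c / 2"
    using e c by (intro add_mono divide_right_mono) auto
  finally show ?thesis using c by (simp add: power2_eq_square)
qed

text \<open>A subsequence of the partial sums converges almost everywhere, and Fatou's lemma identifies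
  its limit with the limit in mean square.\<close>

theorem Riesz_Fischer:
  assumes f: "f \<in> l2 UNIV"
  obtains h where "sq_int h" "fourier_coef h = f"
    "L2_sq h \<le> (\<Sum>\<^sub>\<infinity>k. (cmod (f k))\<^sup>2)"
proof -
  define q where "q k = (cmod (f k))\<^sup>2" for k
  define s where "s N = (\<Sum>k\<in>{-int N..int N}. q k)" for N :: nat
  define S where "S N = partial_trig f N" for N
  have q: "q summable_on UNIV" using f by (simp add: l2_def q_def[abs_def])
  define A where "A = infsum q UNIV"
  have lim: "s \<longlonglongrightarrow> A"
    unfolding s_def A_def using q by (intro has_sum_symmetric_limit) simp
  have s_le: "s N \<le> A" for N
    unfolding s_def A_def using q
    by (intro finite_sum_le_infsum) (auto simp: q_def)
  have S_sq: "sq_int (S N)" for N unfolding S_def by (rule sq_int_trig_poly)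
  have S_m [measurable]: "S N \<in> borel_measurable borel" for N unfolding S_def by simp
  have S_diff: "(LINT t|angle_measure. (cmod (S N t - S M t))\<^sup>2) = s N - s M" if "M \<le> N" for M N
  proof -
    have sub: "{-int M..int M} \<subseteq> {-int N..int N}" using that by auto
    have "(LINT t|angle_measure. (cmod (S N t - S M t))\<^sup>2)
        = L2_sq (trig_poly f ({-int N..int N} - {-int M..int M}))"
      unfolding S_def by (simp add: trig_poly_diff[OF _ sub] L2_inner_same)
    also have "\<dots> = s N - s M"
      using sub by (simp add: trig_poly_norm s_def q_def sum_diff)
    finally show ?thesis .
  qed
  \<comment> \<open>A rate of \<open>(1/2)^j\<close> in norm makes the increments of the subsequence
    summable.\<close>
  have "\<exists>n. \<forall>m\<ge>n. A - s m < ((1/2)^j)\<^sup>2" for j :: nat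
  proof -
    have "\<forall>\<^sub>F m in sequentially. A - ((1/2)^j)\<^sup>2 < s m"
      by (rule order_tendstoD[OF lim]) simp
    then show ?thesis by (auto simp: eventually_sequentially algebra_simps)
  qed
  then obtain n0 where n0: "\<And>j m. m \<ge> n0 j \<Longrightarrow> A - s m < ((1/2)^j)\<^sup>2"
    by metis
  \<comment> \<open>The running sum makes the subsequence monotone and keeps it above both
    \<open>n0 j\<close> and \<open>j\<close>.\<close>
  define n where "n j = (\<Sum>i\<le>j. n0 i) + j" for j
  have n_ge: "n0 j \<le> n j" "j \<le> n j" for j
    unfolding n_def by (auto intro: trans_le_add1 member_le_sum)
  have n_mono: "n j \<le> n (Suc j)" for j by (simp add: n_def)
  have n_s: "A - s (n j) < ((1/2)^j)\<^sup>2" for j using n0 n_ge by blast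
  have D: "(LINT t|angle_measure. cmod (S (n (Suc j)) t - S (n j) t)) \<le> (1/2)^j" for j
  proof (rule angle_L1_le)
    show "sq_int (\<lambda>t. S (n (Suc j)) t - S (n j) t)" by (intro sq_int_diff S_sq)
    show "L2_sq (\<lambda>t. S (n (Suc j)) t - S (n j) t) \<le> ((1/2)^j)\<^sup>2"
      using S_diff[OF n_mono[of j]] n_s[of j] s_le[of "n (Suc j)"] by (simp add: L2_inner_same)
  qed simp
  have "(\<integral>\<^sup>+t. (\<Sum>j. ennreal (cmod (S (n (Suc j)) t - S (n j) t))) \<partial>angle_measure)
      = (\<Sum>j. \<integral>\<^sup>+t. ennreal (cmod (S (n (Suc j)) t - S (n j) t)) \<partial>angle_measure)"
    by (intro nn_integral_suminf) simp
  also have "\<dots> \<le> (\<Sum>j. ennreal ((1/2)^j))"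
  proof (intro suminf_le)
    fix j
    have "(\<integral>\<^sup>+t. ennreal (cmod (S (n (Suc j)) t - S (n j) t)) \<partial>angle_measure)
        = ennreal (LINT t|angle_measure. cmod (S (n (Suc j)) t - S (n j) t))"
      by (intro nn_integral_eq_integral integrable_norm sq_int_integrable sq_int_diff S_sq) simp
    also have "\<dots> \<le> ennreal ((1/2)^j)" using D by (intro ennreal_leI)
    finally show "(\<integral>\<^sup>+t. ennreal (cmod (S (n (Suc j)) t - S (n j) t)) \<partial>angle_measure) \<le> ennreal ((1/2)^j)" .
  qed auto
  also have "\<dots> < top"
  proof -
    have "(\<Sum>j. ennreal ((1/2)^j)) = ennreal (\<Sum>j. (1/2)^j)"
      by (intro suminf_ennreal2) (auto intro: summable_geometric)
    then show ?thesis by simp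
  qed
  finally have "AE t in angle_measure. (\<Sum>j. ennreal (cmod (S (n (Suc j)) t - S (n j) t))) \<noteq> \<infinity>"
    by (intro nn_integral_PInf_AE) auto
  then have conv: "AE t in angle_measure. convergent (\<lambda>j. S (n j) t)"
  proof eventually_elim
    case (elim t)
    then have "summable (\<lambda>j. cmod (S (n (Suc j)) t - S (n j) t))"
      by (intro summable_suminf_not_top) auto
    then have "summable (\<lambda>j. S (n (Suc j)) t - S (n j) t)"
      by (rule summable_norm_cancel)
    then have "convergent (\<lambda>m. \<Sum>j<m. S (n (Suc j)) t - S (n j) t)"
      by (simp add: summable_iff_convergent)
    then have "convergent (\<lambda>m. (S (n m) t - S (n 0) t) + S (n 0) t)"
      by (intro convergent_add convergent_const) (simp add: sum_lessThan_telescope[of "\<lambda>j. S (n j) t"])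
    then show ?case by simp
  qed
  \<comment> \<open>\<open>h\<close> is Borel on the whole line, whatever value \<open>lim\<close>
    takes where the subsequence diverges.\<close>
  define h where "h t = lim (\<lambda>j. S (n j) t)" for t
  have [measurable]: "h \<in> borel_measurable borel"
    unfolding h_def by (intro borel_measurable_lim_metric) simp
  have h_lim: "AE t in angle_measure. (\<lambda>j. S (n j) t) \<longlonglongrightarrow> h t"
    using conv by eventually_elim (simp add: h_def convergent_LIMSEQ_iff)
  have bound: "(\<integral>\<^sup>+t. ennreal ((cmod (h t - S M t))\<^sup>2) \<partial>angle_measure) \<le> ennreal (A - s M)" for M
  proof -
    have "(\<integral>\<^sup>+t. ennreal ((cmod (h t - S M t))\<^sup>2) \<partial>angle_measure)
       = (\<integral>\<^sup>+t. liminf (\<lambda>j. ennreal ((cmod (S (n j) t - S M t))\<^sup>2)) \<partial>angle_measure)"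
    proof (rule nn_integral_cong_AE)
      show "AE t in angle_measure. ennreal ((cmod (h t - S M t))\<^sup>2)
          = liminf (\<lambda>j. ennreal ((cmod (S (n j) t - S M t))\<^sup>2))"
        using h_lim
      proof eventually_elim
        case (elim t)
        then have "(\<lambda>j. ennreal ((cmod (S (n j) t - S M t))\<^sup>2)) \<longlonglongrightarrow> ennreal ((cmod (h t - S M t))\<^sup>2)"
          by (intro tendsto_ennrealI tendsto_intros)
        then show ?case by (metis lim_imp_Liminf sequentially_bot)
      qed
    qed
    also have "\<dots> \<le> liminf (\<lambda>j. \<integral>\<^sup>+t. ennreal ((cmod (S (n j) t - S M t))\<^sup>2) \<partial>angle_measure)"
      by (rule nn_integral_liminf) simp
    also have "\<dots> \<le> liminf (\<lambda>j. ennreal (A - s M))"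
    proof (rule Liminf_mono, rule eventually_sequentiallyI[of M])
      fix j assume "M \<le> j"
      then have le: "M \<le> n j" using n_ge(2)[of j] by simp
      have "(\<integral>\<^sup>+t. ennreal ((cmod (S (n j) t - S M t))\<^sup>2) \<partial>angle_measure)
         = ennreal (LINT t|angle_measure. (cmod (S (n j) t - S M t))\<^sup>2)"
        using sq_int_diff[OF S_sq[of "n j"] S_sq[of M]]
        by (intro nn_integral_eq_integral) (auto simp: sq_int_def)
      also have "\<dots> \<le> ennreal (A - s M)"
        using S_diff[OF le] s_le[of "n j"] by (intro ennreal_leI) simp
      finally show "(\<integral>\<^sup>+t. ennreal ((cmod (S (n j) t - S M t))\<^sup>2) \<partial>angle_measure) \<le> ennreal (A - s M)" .
    qed
    also have "\<dots> = ennreal (A - s M)" by (simp add: Liminf_const)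
    finally show ?thesis .
  qed
  have diff_sq: "sq_int (\<lambda>t. h t - S M t)" for M
    unfolding sq_int_def
  proof
    show "integrable angle_measure (\<lambda>t. (cmod (h t - S M t))\<^sup>2)"
      using bound[of M] by (intro integrableI_bounded) (auto intro: le_less_trans)
  qed simp
  have h_sq: "sq_int h"
    using sq_int_lincomb[OF diff_sq[of 0] S_sq[of 0], of 1 1] by simp
  have dist: "L2_sq (\<lambda>t. h t - S M t) \<le> A - s M" for M
  proof -
    have "ennreal (LINT t|angle_measure. (cmod (h t - S M t))\<^sup>2) \<le> ennreal (A - s M)"
      using diff_sq[of M] bound[of M]
      by (subst nn_integral_eq_integral[symmetric]) (auto simp: sq_int_def)
    then show ?thesis using s_le[of M] by (simp add: L2_inner_same ennreal_le_iff)
  qed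
  have coef: "fourier_coef h k = f k" for k
  proof -
    \<comment> \<open>Bessel's inequality for \<open>h - S M\<close>, used at the single frequency
      \<open>k\<close>.\<close>
    have "(cmod (fourier_coef h k - f k))\<^sup>2 \<le> A - s M" if "M \<ge> nat \<bar>k\<bar>" for M
    proof -
      have "k \<in> {-int M..int M}" using that by auto
      then have "fourier_coef (\<lambda>t. h t - S M t) k = fourier_coef h k - f k"
        using coef_lincomb[OF h_sq S_sq[of M], of 1 "-1" k] by (simp add: S_def fourier_coef_trig_poly)
      then show ?thesis using Bessel[OF diff_sq[of M], of "{k}"] dist[of M] by simp
    qed
    moreover have "(\<lambda>M. A - s M) \<longlonglongrightarrow> A - A" by (intro tendsto_intros lim)
    ultimately have "(cmod (fourier_coef h k - f k))\<^sup>2 \<le> A - A"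
      by (intro LIMSEQ_le_const) blast+
    then show ?thesis by simp
  qed
  \<comment> \<open>At \<open>M = 0\<close> the squared norm of \<open>h\<close> splits into its
    squared distance from \<open>S 0\<close> and \<open>s 0 = (cmod (f 0))\<^sup>2\<close>.\<close>
  have "L2_sq h \<le> A"
    using dist[of 0] dist_trig_poly[OF h_sq, of "{0}" f] coef by (simp add: S_def s_def q_def)
  then have "L2_sq h \<le> (\<Sum>\<^sub>\<infinity>k. (cmod (f k))\<^sup>2)"
    unfolding A_def q_def .
  moreover have "fourier_coef h = f" using coef by blast
  ultimately show thesis using h_sq that by blast
qed

section \<open>Multiplication operators\<close>

text \<open>For norms, Bessel gives one inequality; the other holds because the Riesz-Fischer
  function with the same coefficients equals the given one almost everywhere. Inner products follow
  by polarization.\<close>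

theorem Plancherel:
  assumes g: "sq_int g" and h: "sq_int h"
  shows "l2_inner UNIV (fourier_coef g) (fourier_coef h) = L2_inner g h"
proof -
  have norm: "l2_sq UNIV (fourier_coef u) = L2_sq u" if u: "sq_int u" for u
  proof -
    have c: "fourier_coef u \<in> l2 UNIV" by (rule fourier_coef_l2[OF u])
    obtain w where w: "sq_int w" "fourier_coef w = fourier_coef u"
      "L2_sq w \<le> (\<Sum>\<^sub>\<infinity>k. (cmod (fourier_coef u k))\<^sup>2)"
      using Riesz_Fischer[OF c] by blast
    have ae: "AE t in angle_measure. u t = w t" by (rule coef_inj[OF u w(1)]) (simp add: w)
    have [measurable]: "u \<in> borel_measurable borel" "w \<in> borel_measurable borel"
      using u w by (auto simp: sq_int_def)
    have "L2_inner u u = L2_inner w w"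
      unfolding L2_inner_def using ae by (intro integral_cong_AE) (auto elim: eventually_mono)
    moreover have "(\<Sum>\<^sub>\<infinity>k. (cmod (fourier_coef u k))\<^sup>2) \<le> L2_sq u"
      using c Bessel[OF u] by (intro infsum_le_finite_sums) (auto simp: l2_def)
    ultimately show ?thesis using w(3) by (simp add: l2_inner_same)
  qed
  have *: "Re (z * l2_inner UNIV (fourier_coef g) (fourier_coef h)) = Re (z * L2_inner g h)" for z
  proof -
    have s: "sq_int (\<lambda>t. g t + z * h t)" using sq_int_lincomb[OF g h, of 1 z] by simp
    have "fourier_coef (\<lambda>t. g t + z * h t) = (\<lambda>k. fourier_coef g k + z * fourier_coef h k)"
      using coef_lincomb[OF g h, of 1 z] by auto
    then show ?thesis
      using norm[OF s] l2_inner_expand[OF fourier_coef_l2[OF g] fourier_coef_l2[OF h], of z]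
        L2_inner_expand[OF g h, of z] norm[OF g] norm[OF h] by simp
  qed
  \<comment> \<open>The factors 1 and \<open>- \<i>\<close> read off the real and the imaginary
    part.\<close>
  show ?thesis using *[of 1] *[of "- \<i>"] by (simp add: complex_eq_iff)
qed

text \<open>A chosen representative, determined by the coefficients only up to null sets.\<close>

definition inverse_fourier :: "(int \<Rightarrow> complex) \<Rightarrow> real \<Rightarrow> complex" where
  "inverse_fourier f = (SOME h. sq_int h \<and> fourier_coef h = f)"

lemma inverse_fourier:
  assumes "f \<in> l2 UNIV"
  shows "sq_int (inverse_fourier f)" "fourier_coef (inverse_fourier f) = f"
proof -
  have "\<exists>h. sq_int h \<and> fourier_coef h = f" using Riesz_Fischer[OF assms] by blast
  then have "sq_int (inverse_fourier f) \<and> fourier_coef (inverse_fourier f) = f"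
    unfolding inverse_fourier_def by (rule someI_ex)
  then show "sq_int (inverse_fourier f)" "fourier_coef (inverse_fourier f) = f" by auto
qed

definition fourier_multiplier :: "(real \<Rightarrow> complex) \<Rightarrow> (int \<Rightarrow> complex) \<Rightarrow> int \<Rightarrow> complex" where
  "fourier_multiplier m f = fourier_coef (\<lambda>t. m t * inverse_fourier f t)"

definition symbol :: "(real \<Rightarrow> complex) \<Rightarrow> bool" where
  "symbol m \<longleftrightarrow> m \<in> borel_measurable borel \<and> (\<exists>C. \<forall>t. cmod (m t) \<le> C)"

lemma sq_int_symbol_mult: "symbol m \<Longrightarrow> sq_int h \<Longrightarrow> sq_int (\<lambda>t. m t * h t)"
  unfolding symbol_def using sq_int_bounded_mult by blast

text \<open>The choice in \<open>inverse_fourier\<close> is immaterial, as any \<open>h\<close> with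
  these coefficients agrees with it almost everywhere. This is what makes multipliers compose by
  multiplying symbols.\<close>

lemma fourier_multiplier_coef:
  assumes m: "symbol m" and h: "sq_int h"
  shows "fourier_multiplier m (fourier_coef h) = fourier_coef (\<lambda>t. m t * h t)"
proof -
  note i = inverse_fourier[OF fourier_coef_l2[OF h]]
  have "AE t in angle_measure. inverse_fourier (fourier_coef h) t = h t"
    by (rule coef_inj[OF i(1) h i(2)])
  then show ?thesis
    unfolding fourier_multiplier_def using i(1) h m
    by (intro coef_cong_AE sq_int_symbol_mult) (auto elim: eventually_mono)
qed

lemma fourier_multiplier_l2: "symbol m \<Longrightarrow> f \<in> l2 UNIV \<Longrightarrow> fourier_multiplier m f \<in> l2 UNIV"
  unfolding fourier_multiplier_def by (intro fourier_coef_l2 sq_int_symbol_mult inverse_fourier)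

lemma fourier_multiplier_mult:
  assumes "symbol m" "symbol m'" "f \<in> l2 UNIV"
  shows "fourier_multiplier m (fourier_multiplier m' f) = fourier_multiplier (\<lambda>t. m t * m' t) f"
  unfolding fourier_multiplier_def[of m' f] using assms
  by (subst fourier_multiplier_coef)
     (auto intro!: sq_int_symbol_mult inverse_fourier simp: fourier_multiplier_def mult.assoc)

lemma fourier_multiplier_lincomb:
  assumes "symbol m" "f \<in> l2 UNIV" "g \<in> l2 UNIV"
  shows "fourier_multiplier m (\<lambda>v. c * f v + d * g v)
     = (\<lambda>v. c * fourier_multiplier m f v + d * fourier_multiplier m g v)"
proof -
  let ?f = "inverse_fourier f" and ?g = "inverse_fourier g"
  note i = inverse_fourier[OF assms(2)] inverse_fourier[OF assms(3)]
  have "(\<lambda>v. c * f v + d * g v) = fourier_coef (\<lambda>t. c * ?f t + d * ?g t)"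
    using coef_lincomb[OF i(1,3), of c d] i(2,4) by auto
  then have "fourier_multiplier m (\<lambda>v. c * f v + d * g v)
      = fourier_coef (\<lambda>t. m t * (c * ?f t + d * ?g t))"
    using i assms(1) by (simp add: fourier_multiplier_coef sq_int_lincomb)
  also have "\<dots> = fourier_coef (\<lambda>t. c * (m t * ?f t) + d * (m t * ?g t))"
    by (simp add: algebra_simps)
  also have "\<dots> = (\<lambda>v. c * fourier_multiplier m f v + d * fourier_multiplier m g v)"
    unfolding fourier_multiplier_def
    using coef_lincomb[OF sq_int_symbol_mult[OF assms(1) i(1)] sq_int_symbol_mult[OF assms(1) i(3)], of c d]
    by auto
  finally show ?thesis .
qed

lemma fourier_multiplier_inner:
  assumes "symbol m" "f \<in> l2 UNIV" "g \<in> l2 UNIV"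
  shows "l2_inner UNIV (fourier_multiplier m f) g
     = (LINT t|angle_measure. cnj (m t) * (cnj (inverse_fourier f t) * inverse_fourier g t))"
proof -
  note i = inverse_fourier[OF assms(2)] inverse_fourier[OF assms(3)]
  have "l2_inner UNIV (fourier_multiplier m f) (fourier_coef (inverse_fourier g))
     = L2_inner (\<lambda>t. m t * inverse_fourier f t) (inverse_fourier g)"
    unfolding fourier_multiplier_def by (intro Plancherel sq_int_symbol_mult assms i)
  then show ?thesis by (simp add: i L2_inner_def mult.assoc)
qed

lemma fourier_multiplier_adjoint:
  assumes "symbol m" "f \<in> l2 UNIV" "g \<in> l2 UNIV" "\<And>t. cnj (m t) = m t"
  shows "l2_inner UNIV (fourier_multiplier m f) g = l2_inner UNIV f (fourier_multiplier m g)"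
  unfolding l2_inner_cnj[of UNIV "fourier_multiplier m g" f, symmetric]
  using assms by (simp add: fourier_multiplier_inner Bochner_Integration.integral_cnj[symmetric] mult_ac
      del: Bochner_Integration.integral_cnj)

section \<open>The projection-valued measure of a multiplication operator\<close>

definition multiplier_pvm :: "(real \<Rightarrow> real) \<Rightarrow> real set \<Rightarrow> (int \<Rightarrow> complex) \<Rightarrow> int \<Rightarrow> complex" where
  "multiplier_pvm \<sigma> X = fourier_multiplier (\<lambda>t. of_real (indicator X (\<sigma> t)))"

lemma symbol_indicator:
  assumes "\<sigma> \<in> borel_measurable borel" "X \<in> sets borel"
  shows "symbol (\<lambda>t. of_real (indicator X (\<sigma> t)))"
  unfolding symbol_def using assms
  by (intro conjI exI[of _ 1]) (auto simp: indicator_def)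

lemma integrable_inverse_fourier_product:
  "f \<in> l2 UNIV \<Longrightarrow> g \<in> l2 UNIV \<Longrightarrow>
    integrable angle_measure (\<lambda>t. cnj (inverse_fourier f t) * inverse_fourier g t)"
  by (intro sq_int_product_integrable inverse_fourier)

text \<open>The projections multiply by indicators of preimages under \<open>\<sigma>\<close>, so
  idempotence and compatibility with intersections are identities between indicators; countable
  additivity is dominated convergence.\<close>

lemma multiplier_pvm:
  assumes \<sigma> [measurable]: "\<sigma> \<in> borel_measurable borel"
  shows "projection_valued_measure UNIV (multiplier_pvm \<sigma>)"
  unfolding projection_valued_measure_def
proof (intro conjI ballI allI impI)
  fix X :: "real set" assume X: "X \<in> sets borel"
  note s = symbol_indicator[OF \<sigma> X]
  show "orthogonal_projection UNIV (multiplier_pvm \<sigma> X)"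
    unfolding orthogonal_projection_def multiplier_pvm_def
    using s
    by (auto simp: fourier_multiplier_l2 fourier_multiplier_mult fourier_multiplier_lincomb
        indicator_inter_arith[symmetric] of_real_mult[symmetric]
        intro!: fourier_multiplier_adjoint simp del: of_real_mult)
next
  fix f :: "int \<Rightarrow> complex" assume f: "f \<in> l2 UNIV"
  show "multiplier_pvm \<sigma> {} f = (\<lambda>v. 0)"
    by (auto simp: multiplier_pvm_def fourier_multiplier_def fourier_coef_def)
  show "multiplier_pvm \<sigma> UNIV f = f"
    using inverse_fourier[OF f] by (simp add: multiplier_pvm_def fourier_multiplier_def)
next
  fix X Y :: "real set" and f :: "int \<Rightarrow> complex"
  assume X: "X \<in> sets borel" and Y: "Y \<in> sets borel" and f: "f \<in> l2 UNIV"
  show "multiplier_pvm \<sigma> (X \<inter> Y) f = multiplier_pvm \<sigma> X (multiplier_pvm \<sigma> Y f)"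
    unfolding multiplier_pvm_def
    by (simp add: fourier_multiplier_mult symbol_indicator X Y f indicator_inter_arith)
next
  fix X :: "nat \<Rightarrow> real set" and f g :: "int \<Rightarrow> complex"
  assume X: "range X \<subseteq> sets borel" and d: "disjoint_family X" and f: "f \<in> l2 UNIV" and g: "g \<in> l2 UNIV"
  let ?w = "\<lambda>t. cnj (inverse_fourier f t) * inverse_fourier g t"
  have w: "integrable angle_measure ?w" by (rule integrable_inverse_fourier_product[OF f g])
  have [measurable]: "inverse_fourier f \<in> borel_measurable borel" "inverse_fourier g \<in> borel_measurable borel"
    using inverse_fourier(1)[OF f] inverse_fourier(1)[OF g] by (auto simp: sq_int_def)
  have Xi [measurable]: "X i \<in> sets borel" for i using X by auto
  have U [measurable]: "(\<Union>i. X i) \<in> sets borel" using X by auto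
  have inner: "l2_inner UNIV (multiplier_pvm \<sigma> Y f) g
      = (LINT t|angle_measure. indicator Y (\<sigma> t) *\<^sub>R ?w t)" if "Y \<in> sets borel" for Y
    unfolding multiplier_pvm_def
    by (simp add: fourier_multiplier_inner symbol_indicator that f g scaleR_conv_of_real)
  have wi: "integrable angle_measure (\<lambda>t. indicator Y (\<sigma> t) *\<^sub>R ?w t)" if [measurable]: "Y \<in> sets borel" for Y
    using integrable_bounded_mult[OF w, of "\<lambda>t. of_real (indicator Y (\<sigma> t))" 1]
    by (simp add: scaleR_conv_of_real)
  have ind: "(\<lambda>i. indicator (X i) x :: real) sums indicator (\<Union>i. X i) x" for x
    using d by (intro indicator_sums) (auto simp: disjoint_family_on_def)
  \<comment> \<open>Disjointness bounds the partial sums of indicators by 1, which yields the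
    integrable majorant.\<close>
  have le1: "(\<Sum>i<n. indicator (X i) x) \<le> (1::real)" for x n
  proof -
    have "(\<Sum>i<n. indicator (X i) x) \<le> (\<Sum>i. indicator (X i) x :: real)"
      using ind[of x] by (intro sum_le_suminf) (auto simp: sums_iff)
    also have "\<dots> \<le> 1" using ind[of x] by (simp add: sums_iff indicator_def)
    finally show ?thesis .
  qed
  show "(\<lambda>i. l2_inner UNIV (multiplier_pvm \<sigma> (X i) f) g) sums l2_inner UNIV (multiplier_pvm \<sigma> (\<Union>i. X i) f) g"
    unfolding sums_def
  proof (rule Lim_transform_eventually)
    show "(\<lambda>n. LINT t|angle_measure. (\<Sum>i<n. indicator (X i) (\<sigma> t)) *\<^sub>R ?w t)
        \<longlonglongrightarrow> l2_inner UNIV (multiplier_pvm \<sigma> (\<Union>i. X i) f) g"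
    proof (subst inner)
      show "(\<lambda>n. LINT t|angle_measure. (\<Sum>i<n. indicator (X i) (\<sigma> t)) *\<^sub>R ?w t)
        \<longlonglongrightarrow> (LINT t|angle_measure. indicator (\<Union>i. X i) (\<sigma> t) *\<^sub>R ?w t)"
      proof (rule integral_dominated_convergence[where w="\<lambda>t. cmod (?w t)"])
        show "AE t in angle_measure. (\<lambda>n. (\<Sum>i<n. indicator (X i) (\<sigma> t)) *\<^sub>R ?w t)
            \<longlonglongrightarrow> indicator (\<Union>i. X i) (\<sigma> t) *\<^sub>R ?w t"
          using ind by (intro AE_I2 tendsto_intros) (simp add: sums_def)
        show "AE t in angle_measure. norm ((\<Sum>i<n. indicator (X i) (\<sigma> t)) *\<^sub>R ?w t) \<le> cmod (?w t)" for n
        proof (rule AE_I2)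
          fix t
          have "\<bar>\<Sum>i<n. indicator (X i) (\<sigma> t) :: real\<bar> \<le> 1"
            using le1[of "\<sigma> t" n] by (simp add: sum_nonneg abs_of_nonneg)
          then show "norm ((\<Sum>i<n. indicator (X i) (\<sigma> t)) *\<^sub>R ?w t) \<le> cmod (?w t)"
            unfolding norm_scaleR by (intro mult_left_le_one_le) auto
        qed
      qed (use w wi[OF U] in \<open>auto dest: borel_measurable_integrable\<close>)
    qed (rule U)
    show "\<forall>\<^sub>F n in sequentially. (LINT t|angle_measure. (\<Sum>i<n. indicator (X i) (\<sigma> t)) *\<^sub>R ?w t)
        = (\<Sum>i<n. l2_inner UNIV (multiplier_pvm \<sigma> (X i) f) g)"
      unfolding scaleR_sum_left
      by (intro always_eventually allI, subst Bochner_Integration.integral_sum)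
         (intro wi Xi, intro sum.cong refl inner[symmetric] Xi)
  qed
qed

lemma multiplier_pvm_diagonal:
  assumes \<sigma> [measurable]: "\<sigma> \<in> borel_measurable borel" and f: "f \<in> l2 UNIV"
  shows "pvm_diagonal UNIV (multiplier_pvm \<sigma>) f
    = distr (density angle_measure (\<lambda>t. ennreal ((cmod (inverse_fourier f t))\<^sup>2))) borel \<sigma>" (is "_ = ?D")
proof -
  have [measurable]: "inverse_fourier f \<in> borel_measurable borel"
    using inverse_fourier[OF f] by (simp add: sq_int_def)
  have i: "integrable angle_measure (\<lambda>t. (cmod (inverse_fourier f t))\<^sup>2)"
    using inverse_fourier[OF f] by (simp add: sq_int_def)
  have eq: "ennreal (Re (l2_inner UNIV (multiplier_pvm \<sigma> X f) f)) = emeasure ?D X" if X [measurable]: "X \<in> sets borel" for X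
  proof -
    have "l2_inner UNIV (multiplier_pvm \<sigma> X f) f
      = (LINT t|angle_measure. of_real (indicator X (\<sigma> t) * (cmod (inverse_fourier f t))\<^sup>2))"
      unfolding multiplier_pvm_def
      by (subst fourier_multiplier_inner[OF symbol_indicator[OF \<sigma> X] f f])
         (simp add: complex_norm_square mult.commute del: of_real_power)
    then have "Re (l2_inner UNIV (multiplier_pvm \<sigma> X f) f)
      = (LINT t|angle_measure. indicator X (\<sigma> t) * (cmod (inverse_fourier f t))\<^sup>2)"
      by (simp only: integral_complex_of_real Re_complex_of_real)
    also have "ennreal \<dots> = (\<integral>\<^sup>+t. ennreal (indicator X (\<sigma> t) * (cmod (inverse_fourier f t))\<^sup>2) \<partial>angle_measure)"
    proof (rule nn_integral_eq_integral[symmetric])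
      show "integrable angle_measure (\<lambda>t. indicator X (\<sigma> t) * (cmod (inverse_fourier f t))\<^sup>2)"
        by (rule Bochner_Integration.integrable_bound[OF i]) (auto simp: indicator_def)
    qed auto
    also have "\<dots> = emeasure ?D X"
      using measurable_sets[OF \<sigma> X]
      by (auto simp: emeasure_distr emeasure_density intro!: nn_integral_cong split: split_indicator)
    finally show ?thesis .
  qed
  have "pvm_diagonal UNIV (multiplier_pvm \<sigma>) f = measure_of UNIV (sets borel) (emeasure ?D)"
    unfolding pvm_diagonal_def
    by (rule measure_of_eq) (use eq sets.sigma_sets_eq[of "borel :: real measure"] in auto)
  also have "\<dots> = ?D"
    using measure_of_of_measure[of ?D] by simp
  finally show ?thesis .
qed

text \<open>Knowing \<open>A\<close> on the coefficients of square-integrable functions is enough: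
  by Riesz-Fischer these exhaust \<open>l2 UNIV\<close>.\<close>

theorem multiplier_is_spectral_pvm:
  assumes \<sigma> [measurable]: "\<sigma> \<in> borel_measurable borel" and bd: "\<And>t. \<bar>\<sigma> t\<bar> \<le> R"
    and A: "\<And>h. sq_int h \<Longrightarrow> A (fourier_coef h) = fourier_coef (\<lambda>t. of_real (\<sigma> t) * h t)"
  shows "is_spectral_pvm UNIV A (multiplier_pvm \<sigma>)"
  unfolding is_spectral_pvm_def
proof (intro conjI exI ballI)
  show "projection_valued_measure UNIV (multiplier_pvm \<sigma>)" by (rule multiplier_pvm[OF \<sigma>])
next
  fix f :: "int \<Rightarrow> complex" assume f: "f \<in> l2 UNIV"
  have "indicator {-R..R} (\<sigma> t) = (1::real)" for t
    using bd[of t] by (simp add: indicator_def abs_le_iff)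
  then show "multiplier_pvm \<sigma> {-R..R} f = f"
    using inverse_fourier[OF f] by (simp add: multiplier_pvm_def fourier_multiplier_def)
  have s: "symbol (\<lambda>t. of_real (\<sigma> t))" unfolding symbol_def using bd by auto
  have [measurable]: "inverse_fourier f \<in> borel_measurable borel"
    using inverse_fourier[OF f] by (simp add: sq_int_def)
  have "A f = fourier_multiplier (\<lambda>t. of_real (\<sigma> t)) f"
    using A[OF inverse_fourier(1)[OF f]] inverse_fourier(2)[OF f] by (simp add: fourier_multiplier_def)
  then have "l2_inner UNIV (A f) f
      = (LINT t|angle_measure. of_real ((cmod (inverse_fourier f t))\<^sup>2 * \<sigma> t))"
    by (simp add: fourier_multiplier_inner s f complex_norm_square mult_ac del: of_real_power)
  also have "\<dots> = of_real (LINT x|pvm_diagonal UNIV (multiplier_pvm \<sigma>) f. x)"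
    unfolding multiplier_pvm_diagonal[OF \<sigma> f] integral_complex_of_real
    by (subst integral_distr) (auto simp: integral_density)
  finally show "l2_inner UNIV (A f) f = of_real (LINT x|pvm_diagonal UNIV (multiplier_pvm \<sigma>) f. x)" .
qed

section \<open>Uniqueness of the spectral measure\<close>

lemma l2_zero [simp]: "(\<lambda>v. 0) \<in> l2 V"
  by (simp add: l2_def)

lemma l2_add: "f \<in> l2 V \<Longrightarrow> g \<in> l2 V \<Longrightarrow> (\<lambda>v. f v + g v) \<in> l2 V"
  using l2_lincomb[of f V g 1 1] by simp

lemma l2_diff: "f \<in> l2 V \<Longrightarrow> g \<in> l2 V \<Longrightarrow> (\<lambda>v. f v - g v) \<in> l2 V"
  using l2_lincomb[of f V g 1 "-1"] by simp

lemma l2_cmult: "f \<in> l2 V \<Longrightarrow> (\<lambda>v. c * f v) \<in> l2 V"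
  using l2_lincomb[of f V f c 0] by simp

lemma l2_sum:
  assumes "finite K" "\<And>k. k \<in> K \<Longrightarrow> g k \<in> l2 V"
  shows "(\<lambda>v. \<Sum>k\<in>K. c k * g k v) \<in> l2 V"
  using assms by (induction K rule: finite_induct) (auto intro!: l2_add l2_cmult)

lemma l2_inner_zero_left [simp]: "l2_inner V (\<lambda>v. 0) h = 0"
  by (simp add: l2_inner_def)

lemma l2_inner_sum_left:
  assumes "finite K" "\<And>k. k \<in> K \<Longrightarrow> g k \<in> l2 V" "h \<in> l2 V"
  shows "l2_inner V (\<lambda>v. \<Sum>k\<in>K. c k * g k v) h = (\<Sum>k\<in>K. cnj (c k) * l2_inner V (g k) h)"
  using assms(1,2)
proof (induction K rule: finite_induct)
  case (insert k K)
  then show ?case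
    using l2_inner_lincomb_left[of "g k" V "\<lambda>v. \<Sum>k\<in>K. c k * g k v" h "c k" 1] assms(3)
    by (simp add: l2_sum)
qed simp

text \<open>Common frame for the adjacency operator, the spectral projections, their step
  combinations and differences of these.\<close>

definition l2_operator :: "'v set \<Rightarrow> (('v \<Rightarrow> complex) \<Rightarrow> 'v \<Rightarrow> complex) \<Rightarrow> bool" where
  "l2_operator V B \<longleftrightarrow>
     (\<forall>f\<in>l2 V. B f \<in> l2 V) \<and>
     (\<forall>f\<in>l2 V. \<forall>g\<in>l2 V. \<forall>c d. B (\<lambda>v. c * f v + d * g v) = (\<lambda>v. c * B f v + d * B g v)) \<and>
     (\<forall>f\<in>l2 V. \<forall>g\<in>l2 V. l2_inner V (B f) g = l2_inner V f (B g))"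

lemma l2_operatorD:
  assumes "l2_operator V B"
  shows "f \<in> l2 V \<Longrightarrow> B f \<in> l2 V"
    and "f \<in> l2 V \<Longrightarrow> g \<in> l2 V \<Longrightarrow> B (\<lambda>v. c * f v + d * g v) = (\<lambda>v. c * B f v + d * B g v)"
    and "f \<in> l2 V \<Longrightarrow> g \<in> l2 V \<Longrightarrow> l2_inner V (B f) g = l2_inner V f (B g)"
  using assms by (auto simp: l2_operator_def)

lemma l2_operator_diff:
  assumes A: "l2_operator V A" and B: "l2_operator V B"
  shows "l2_operator V (\<lambda>f v. A f v - B f v)"
  unfolding l2_operator_def
proof (intro conjI ballI allI)
  note DA = l2_operatorD[OF A] and DB = l2_operatorD[OF B]
  fix f g assume f: "f \<in> l2 V" and g: "g \<in> l2 V"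
  show "(\<lambda>v. A f v - B f v) \<in> l2 V" by (intro l2_diff DA(1) DB(1) f)
  show "(\<lambda>v. A (\<lambda>v. c * f v + d * g v) v - B (\<lambda>v. c * f v + d * g v) v)
      = (\<lambda>v. c * (A f v - B f v) + d * (A g v - B g v))" for c d
    by (simp add: DA(2)[OF f g] DB(2)[OF f g] algebra_simps)
  show "l2_inner V (\<lambda>v. A f v - B f v) g = l2_inner V f (\<lambda>v. A g v - B g v)"
    using l2_inner_lincomb_left[OF DA(1)[OF f] DB(1)[OF f] g, of 1 "-1"]
      l2_inner_lincomb_right[OF DA(1)[OF g] DB(1)[OF g] f, of 1 "-1"]
      DA(3)[OF f g] DB(3)[OF f g] by simp
qed

text \<open>For symmetric operators the numerical radius bounds the norm. Subtracting the values of
  the form at \<open>f + t B f\<close> and \<open>f - t B f\<close> leaves \<open>4 * t\<close>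
  times the squared norm of \<open>B f\<close>, and the parallelogram law adds up the two
  bounds.\<close>

lemma numerical_radius_bound:
  assumes B: "l2_operator V B" and e: "e > 0"
    and bd: "\<And>f. f \<in> l2 V \<Longrightarrow> \<bar>Re (l2_inner V (B f) f)\<bar> \<le> e * l2_sq V f"
    and f: "f \<in> l2 V"
  shows "l2_sq V (B f) \<le> e\<^sup>2 * l2_sq V f"
proof -
  note D = l2_operatorD[OF B]
  \<comment> \<open>This \<open>t\<close> balances the two terms of the final bound.\<close>
  define t where "t = 1 / e"
  define q where "q = l2_sq V (B f)"
  have Bf: "B f \<in> l2 V" and BBf: "B (B f) \<in> l2 V" using f D by auto
  have g: "(\<lambda>v. 1 * f v + of_real s * B f v) \<in> l2 V" for s :: real by (intro l2_lincomb f Bf)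
  have inner: "Re (l2_inner V (B (\<lambda>v. 1 * f v + of_real s * B f v)) (\<lambda>v. 1 * f v + of_real s * B f v))
     = Re (l2_inner V (B f) f) + 2 * s * q + s\<^sup>2 * Re (l2_inner V (B (B f)) (B f))" for s :: real
    unfolding D(2)[OF f Bf] using D(3)[OF Bf f] f Bf BBf
    by (subst l2_inner_lincomb_left) (simp_all add: g[simplified]
      l2_inner_lincomb_right[where c=1, simplified] q_def power2_eq_square algebra_simps)
  have norm: "l2_sq V (\<lambda>v. 1 * f v + of_real s * B f v)
     = l2_sq V f + 2 * s * Re (l2_inner V f (B f)) + s\<^sup>2 * q" for s :: real
    using l2_inner_expand[OF f Bf, of "of_real s"] by (simp add: q_def)
  have "Re (l2_inner V (B f) f) + 2 * t * q + t\<^sup>2 * Re (l2_inner V (B (B f)) (B f))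
     \<le> e * (l2_sq V f + 2 * t * Re (l2_inner V f (B f)) + t\<^sup>2 * q)"
    using bd[OF g[of t]] unfolding inner norm by linarith
  moreover have "- (Re (l2_inner V (B f) f) - 2 * t * q + t\<^sup>2 * Re (l2_inner V (B (B f)) (B f)))
     \<le> e * (l2_sq V f - 2 * t * Re (l2_inner V f (B f)) + t\<^sup>2 * q)"
    using bd[OF g[of "-t"]] unfolding inner norm by simp
  ultimately have "4 * t * q \<le> e * (2 * l2_sq V f + 2 * t\<^sup>2 * q)"
    by (simp add: algebra_simps)
  then show ?thesis
    using e unfolding q_def[symmetric] t_def by (simp add: field_simps power2_eq_square)
qed

section \<open>Projection-valued measures and their scalar measures\<close>

lemma pvm_projection:
  assumes "projection_valued_measure V P" "X \<in> sets borel"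
  shows "l2_operator V (P X)"
  using assms by (auto simp: projection_valued_measure_def orthogonal_projection_def l2_operator_def)

lemma pvm_zero:
  assumes "projection_valued_measure V P" "X \<in> sets borel"
  shows "P X (\<lambda>v. 0) = (\<lambda>v. 0)"
  using l2_operatorD(2)[OF pvm_projection[OF assms], of "\<lambda>v. 0" "\<lambda>v. 0" 0 0] by simp

lemma pvm_Int:
  assumes "projection_valued_measure V P" "X \<in> sets borel" "Y \<in> sets borel" "f \<in> l2 V"
  shows "P X (P Y f) = P (X \<inter> Y) f"
  using assms by (auto simp: projection_valued_measure_def)

lemma pvm_sum:
  assumes P: "projection_valued_measure V P" "X \<in> sets borel"
    and "finite K" "\<And>k. k \<in> K \<Longrightarrow> g k \<in> l2 V"
  shows "P X (\<lambda>v. \<Sum>k\<in>K. c k * g k v) = (\<lambda>v. \<Sum>k\<in>K. c k * P X (g k) v)"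
  using assms(3,4)
proof (induction K rule: finite_induct)
  case empty
  then show ?case using pvm_zero[OF P] by simp
next
  case (insert k K)
  then show ?case
    using l2_operatorD(2)[OF pvm_projection[OF P], of "g k" "\<lambda>v. \<Sum>k\<in>K. c k * g k v" "c k" 1]
    by (simp add: l2_sum)
qed

lemma pvm_diagonal_nonneg:
  assumes P: "projection_valued_measure V P" "X \<in> sets borel" and f: "f \<in> l2 V"
  shows "Re (l2_inner V (P X f) f) \<ge> 0"
proof -
  have "l2_inner V (P X f) f = l2_inner V (P X (P X f)) f"
    using pvm_Int[OF P(1,2,2) f] by simp
  also have "\<dots> = l2_inner V (P X f) (P X f)"
    using l2_operatorD[OF pvm_projection[OF P]] f by simp
  finally show ?thesis using l2_inner_nonneg by metis
qed

lemma sets_pvm_diagonal [measurable_cong, simp]: "sets (pvm_diagonal V P f) = sets borel"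
  by (simp add: pvm_diagonal_def sets.sigma_sets_eq[of "borel :: real measure", simplified])

lemma space_pvm_diagonal [simp]: "space (pvm_diagonal V P f) = UNIV"
  by (simp add: pvm_diagonal_def space_measure_of_conv)

text \<open>\<open>measure_of\<close> returns the zero measure for a set function that is not a
  measure, so positivity and countable additivity have to be verified.\<close>

lemma emeasure_pvm_diagonal:
  assumes P: "projection_valued_measure V P" and f: "f \<in> l2 V" and X: "X \<in> sets borel"
  shows "emeasure (pvm_diagonal V P f) X = ennreal (Re (l2_inner V (P X f) f))"
proof (rule emeasure_measure_of[OF pvm_diagonal_def])
  let ?\<mu> = "\<lambda>X. ennreal (Re (l2_inner V (P X f) f))"
  show "positive (sets (pvm_diagonal V P f)) ?\<mu>"
    using P f by (simp add: positive_def projection_valued_measure_def)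
  show "countably_additive (sets (pvm_diagonal V P f)) ?\<mu>"
  proof (rule countably_additiveI)
    fix A :: "nat \<Rightarrow> real set"
    assume A: "range A \<subseteq> sets (pvm_diagonal V P f)" "disjoint_family A"
    then have "(\<lambda>i. l2_inner V (P (A i) f) f) sums l2_inner V (P (\<Union>i. A i) f) f"
      using P f by (simp add: projection_valued_measure_def)
    from sums_Re[OF this]
    have s: "(\<lambda>i. Re (l2_inner V (P (A i) f) f)) sums Re (l2_inner V (P (\<Union>i. A i) f) f)" .
    have "A i \<in> sets borel" for i using A by auto
    then have "\<And>i. 0 \<le> Re (l2_inner V (P (A i) f) f)"
      using pvm_diagonal_nonneg[OF P _ f] by blast
    then show "(\<Sum>i. ?\<mu> (A i)) = ?\<mu> (\<Union>i. A i)"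
      using s by (subst suminf_ennreal2) (auto simp: sums_iff)
  qed
qed (use X in auto)

lemma measure_pvm_diagonal:
  assumes "projection_valued_measure V P" "f \<in> l2 V" "X \<in> sets borel"
  shows "measure (pvm_diagonal V P f) X = Re (l2_inner V (P X f) f)"
  using emeasure_pvm_diagonal[OF assms] pvm_diagonal_nonneg[OF assms(1,3,2)] by (simp add: measure_def)

lemma finite_measure_pvm_diagonal:
  assumes "projection_valued_measure V P" "f \<in> l2 V"
  shows "finite_measure (pvm_diagonal V P f)"
  by (rule finite_measureI) (simp add: emeasure_pvm_diagonal[OF assms])

section \<open>Functional calculus for step functions\<close>

definition pvm_step :: "(real set \<Rightarrow> ('v \<Rightarrow> complex) \<Rightarrow> 'v \<Rightarrow> complex) \<Rightarrow> (int \<Rightarrow> real set) \<Rightarrow> int set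
    \<Rightarrow> (int \<Rightarrow> real) \<Rightarrow> ('v \<Rightarrow> complex) \<Rightarrow> 'v \<Rightarrow> complex" where
  "pvm_step P I K c f v = (\<Sum>k\<in>K. of_real (c k) * P (I k) f v)"

context
  fixes V :: "'v set" and P :: "real set \<Rightarrow> ('v \<Rightarrow> complex) \<Rightarrow> 'v \<Rightarrow> complex"
    and I :: "int \<Rightarrow> real set" and K :: "int set"
  assumes P: "projection_valued_measure V P" and I: "\<And>k. I k \<in> sets borel" "disjoint_family I"
    and K: "finite K"
begin

lemma pvm_step_l2: "f \<in> l2 V \<Longrightarrow> pvm_step P I K c f \<in> l2 V"
  unfolding pvm_step_def[abs_def] using l2_operatorD(1)[OF pvm_projection[OF P I(1)]] K
  by (intro l2_sum) auto

lemma pvm_step_inner: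
  "f \<in> l2 V \<Longrightarrow> g \<in> l2 V \<Longrightarrow> l2_inner V (pvm_step P I K c f) g = (\<Sum>k\<in>K. of_real (c k) * l2_inner V (P (I k) f) g)"
  unfolding pvm_step_def[abs_def] using l2_operatorD(1)[OF pvm_projection[OF P I(1)]] K
  by (subst l2_inner_sum_left) auto

lemma pvm_step_operator: "l2_operator V (pvm_step P I K c)"
  unfolding l2_operator_def
proof (intro conjI ballI allI)
  note D = l2_operatorD[OF pvm_projection[OF P I(1)]]
  fix f g assume f: "f \<in> l2 V" and g: "g \<in> l2 V"
  show "pvm_step P I K c f \<in> l2 V" by (rule pvm_step_l2[OF f])
  show "pvm_step P I K c (\<lambda>v. a * f v + b * g v) = (\<lambda>v. a * pvm_step P I K c f v + b * pvm_step P I K c g v)" for a b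
    using f g by (auto simp: pvm_step_def D(2) algebra_simps sum.distrib sum_distrib_left)
  show "l2_inner V (pvm_step P I K c f) g = l2_inner V f (pvm_step P I K c g)"
    unfolding l2_inner_cnj[of V "pvm_step P I K c g" f, symmetric]
    using f g by (simp add: pvm_step_inner D(3) l2_inner_cnj D(1))
qed

text \<open>Projections of disjoint cells have product zero, so only the diagonal terms of the
  double sum survive.\<close>

lemma pvm_step_mult:
  assumes f: "f \<in> l2 V"
  shows "pvm_step P I K c (pvm_step P I K d f) = pvm_step P I K (\<lambda>k. c k * d k) f"
proof
  fix v
  note D = l2_operatorD[OF pvm_projection[OF P I(1)]]
  have *: "P (I k) (pvm_step P I K d f) v = of_real (d k) * P (I k) f v" if k: "k \<in> K" for k
  proof -
    have "P (I k) (pvm_step P I K d f) v = (\<Sum>l\<in>K. of_real (d l) * P (I k) (P (I l) f) v)"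
      unfolding pvm_step_def[abs_def] using D(1) f by (subst pvm_sum[OF P I(1) K]) auto
    also have "\<dots> = (\<Sum>l\<in>K. if l = k then of_real (d k) * P (I k) f v else 0)"
    proof (intro sum.cong refl)
      fix l assume "l \<in> K"
      show "of_real (d l) * P (I k) (P (I l) f) v = (if l = k then of_real (d k) * P (I k) f v else 0)"
      proof (cases "l = k")
        case False
        then have "I k \<inter> I l = {}" using I(2) by (auto simp: disjoint_family_on_def)
        then show ?thesis using False P f
          by (simp add: pvm_Int[OF P I(1) I(1) f] projection_valued_measure_def)
      qed (simp add: pvm_Int[OF P I(1) I(1) f])
    qed
    also have "\<dots> = of_real (d k) * P (I k) f v" using K k by simp
    finally show ?thesis .
  qed
  show "pvm_step P I K c (pvm_step P I K d f) v = pvm_step P I K (\<lambda>k. c k * d k) f v"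
    unfolding pvm_step_def[of P I K c] using * by (simp add: pvm_step_def mult.assoc)
qed

lemma pvm_step_integral:
  assumes f: "f \<in> l2 V"
  shows "Re (l2_inner V (pvm_step P I K c f) f)
     = (LINT x|pvm_diagonal V P f. (\<Sum>k\<in>K. c k * indicator (I k) x))"
proof -
  interpret finite_measure "pvm_diagonal V P f" by (rule finite_measure_pvm_diagonal[OF P f])
  have "integrable (pvm_diagonal V P f) (indicator (I k) :: real \<Rightarrow> real)" for k
    using I(1) by (simp add: integrable_indicator_iff emeasure_finite less_top[symmetric])
  then have "(LINT x|pvm_diagonal V P f. (\<Sum>k\<in>K. c k * indicator (I k) x))
     = (\<Sum>k\<in>K. c k * measure (pvm_diagonal V P f) (I k))"
    by (subst Bochner_Integration.integral_sum) auto
  then show ?thesis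
    using f by (simp add: pvm_step_inner measure_pvm_diagonal[OF P f I(1)])
qed

lemma pvm_step_norm:
  assumes f: "f \<in> l2 V"
  shows "l2_sq V (pvm_step P I K c f)
     = Re (l2_inner V (pvm_step P I K (\<lambda>k. (c k)\<^sup>2) f) f)"
  using l2_operatorD(3)[OF pvm_step_operator[of c] pvm_step_l2[OF f, of c] f] pvm_step_mult[OF f, of c c]
  by (simp add: power2_eq_square)

text \<open>The cells are disjoint, so their masses add up to at most the total mass
  \<open>l2_sq V f\<close>.\<close>

lemma pvm_step_bound:
  assumes f: "f \<in> l2 V" and c: "\<And>k. k \<in> K \<Longrightarrow> \<bar>c k\<bar> \<le> C"
  shows "l2_sq V (pvm_step P I K c f) \<le> C\<^sup>2 * l2_sq V f"
proof -
  interpret finite_measure "pvm_diagonal V P f" by (rule finite_measure_pvm_diagonal[OF P f])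
  have "l2_sq V (pvm_step P I K c f)
      = (\<Sum>k\<in>K. (c k)\<^sup>2 * measure (pvm_diagonal V P f) (I k))"
    unfolding pvm_step_norm[OF f] using f by (simp add: pvm_step_inner measure_pvm_diagonal[OF P f I(1)])
  also have "\<dots> \<le> (\<Sum>k\<in>K. C\<^sup>2 * measure (pvm_diagonal V P f) (I k))"
  proof (intro sum_mono mult_right_mono)
    show "(c k)\<^sup>2 \<le> C\<^sup>2" if "k \<in> K" for k
      using power_mono[OF c[OF that], of 2] by simp
  qed simp
  also have "\<dots> = C\<^sup>2 * measure (pvm_diagonal V P f) (\<Union>k\<in>K. I k)"
    using I K by (subst finite_measure_finite_Union) (auto simp: sum_distrib_left disjoint_family_on_def)
  also have "\<dots> \<le> C\<^sup>2 * measure (pvm_diagonal V P f) UNIV"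
    using finite_measure_mono[of "\<Union>k\<in>K. I k" UNIV] by (intro mult_left_mono) auto
  also have "\<dots> = C\<^sup>2 * l2_sq V f"
    using P f measure_pvm_diagonal[OF P f, of UNIV] by (simp add: projection_valued_measure_def)
  finally show ?thesis .
qed

end

lemma spectral_support_AE:
  assumes P: "projection_valued_measure V P" and f: "f \<in> l2 V" and R: "P {-R..R} f = f"
  shows "AE x in pvm_diagonal V P f. x \<in> {-R..R}"
proof (rule AE_I[where N="UNIV - {-R..R}"])
  have "P (UNIV - {-R..R}) f = P (UNIV - {-R..R}) (P {-R..R} f)" by (simp add: R)
  also have "\<dots> = P {} f" by (subst pvm_Int[OF P _ _ f]) (auto intro!: arg_cong[where f="\<lambda>X. P X f"])
  finally show "emeasure (pvm_diagonal V P f) (UNIV - {-R..R}) = 0"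
    using P f by (simp add: emeasure_pvm_diagonal[OF P f] projection_valued_measure_def)
qed auto

text \<open>The operator is approximated in norm by step functions of the projection-valued measure,
  whose powers are step functions again.\<close>

theorem spectral_moments:
  assumes A: "l2_operator V A" and spec: "is_spectral_pvm V A P" and f: "f \<in> l2 V"
  shows "(LINT x|pvm_diagonal V P f. x ^ n) = Re (l2_inner V ((A ^^ n) f) f)"
proof -
  have P: "projection_valued_measure V P" using spec by (simp add: is_spectral_pvm_def)
  obtain R where R: "\<And>g. g \<in> l2 V \<Longrightarrow> P {-R..R} g = g" using spec by (auto simp: is_spectral_pvm_def)
  have Aint: "Re (l2_inner V (A g) g) = (LINT x|pvm_diagonal V P g. x)" if "g \<in> l2 V" for g
    using spec that by (simp add: is_spectral_pvm_def)
  \<comment> \<open>Half-open cells of mesh \<open>1 / Suc N\<close>; \<open>c N j\<close> is the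
    \<open>j\<close>-th power of the left endpoint.\<close>
  define J where "J N k = {x::real. \<lfloor>x * real (Suc N)\<rfloor> = k}" for N and k :: int
  \<comment> \<open>Finitely many cells that cover \<open>{-R..R}\<close>.\<close>
  define K where "K N = {\<lfloor>- R * real (Suc N)\<rfloor>..\<lfloor>R * real (Suc N)\<rfloor>}" for N
  define c where "c N j k = (of_int k / real (Suc N)) ^ j" for N j and k :: int
  define S where "S N j = pvm_step P (J N) (K N) (c N j)" for N j
  have J: "J N k \<in> sets borel" "disjoint_family (J N)" for N k
    by (auto simp: J_def disjoint_family_on_def)
  have K: "finite (K N)" for N by (simp add: K_def)
  note step = pvm_step_l2[OF P J K] pvm_step_operator[OF P J K]
    pvm_step_mult[OF P J K] pvm_step_integral[OF P J K] pvm_step_norm[OF P J K]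
    pvm_step_bound[OF P J K]
  have S_l2: "g \<in> l2 V \<Longrightarrow> S N j g \<in> l2 V" for g N j unfolding S_def by (rule step)
  have S_op: "l2_operator V (S N j)" for N j unfolding S_def by (rule step)
  define s where "s N j x = (\<Sum>k\<in>K N. c N j k * indicator (J N k) x)" for N j x
  have s_eq: "s N j x = (of_int \<lfloor>x * real (Suc N)\<rfloor> / real (Suc N)) ^ j" if x: "x \<in> {-R..R}" for N j x
  proof -
    let ?k = "\<lfloor>x * real (Suc N)\<rfloor>"
    have k: "?k \<in> K N"
      using x unfolding K_def atLeastAtMost_iff by (intro conjI floor_mono mult_right_mono) auto
    have "s N j x = (\<Sum>k\<in>K N. if k = ?k then c N j k else 0)"
      unfolding s_def by (intro sum.cong) (auto simp: J_def)
    then show ?thesis using k K[of N] by (simp add: c_def)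
  qed
  have s_close: "\<bar>of_int \<lfloor>x * real (Suc N)\<rfloor> / real (Suc N) - x\<bar> \<le> 1 / real (Suc N)" for x N
  proof -
    have "\<bar>of_int \<lfloor>x * real (Suc N)\<rfloor> - x * real (Suc N)\<bar> \<le> 1" by linarith
    moreover have "of_int \<lfloor>x * real (Suc N)\<rfloor> / real (Suc N) - x
        = (of_int \<lfloor>x * real (Suc N)\<rfloor> - x * real (Suc N)) / real (Suc N)"
      by (simp add: field_simps)
    ultimately show ?thesis by (simp only: abs_divide) (auto intro!: divide_right_mono)
  qed
  have s_m [measurable]: "s N j \<in> borel_measurable borel" for N j
    unfolding s_def using J(1) by simp
  have Sint: "Re (l2_inner V (S N j g) g) = (LINT x|pvm_diagonal V P g. s N j x)" if "g \<in> l2 V" for N j g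
    unfolding S_def s_def by (rule step(4)[OF that])
  have AE_R: "AE x in pvm_diagonal V P g. x \<in> {-R..R}" if "g \<in> l2 V" for g
    by (rule spectral_support_AE[OF P that R[OF that]])
  have bint: "integrable (pvm_diagonal V P g) h"
    if g: "g \<in> l2 V" and [measurable]: "h \<in> borel_measurable borel"
      and b: "\<And>x. x \<in> {-R..R} \<Longrightarrow> \<bar>h x\<bar> \<le> B" for g h and B :: real
  proof -
    interpret finite_measure "pvm_diagonal V P g" by (rule finite_measure_pvm_diagonal[OF P g])
    show ?thesis
    proof (rule integrable_const_bound[where B=B])
      show "AE x in pvm_diagonal V P g. norm (h x) \<le> B"
        using AE_R[OF g] by eventually_elim (simp add: b)
    qed simp
  qed
  \<comment> \<open>Rounding moves a point by at most 1; the absolute value is there because the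
    sign of \<open>R\<close> is unspecified.\<close>
  have sR: "\<bar>s N 1 x\<bar> \<le> \<bar>R\<bar> + 1" if "x \<in> {-R..R}" for N x
  proof -
    have "1 / real (Suc N) \<le> 1" by simp
    moreover have "s N 1 x = of_int \<lfloor>x * real (Suc N)\<rfloor> / real (Suc N)"
      using s_eq[OF that, of N 1] by (simp only: power_one_right)
    moreover have "\<bar>x\<bar> \<le> \<bar>R\<bar>" using that by auto
    ultimately show ?thesis using s_close[of x N] by linarith
  qed
  have mu_UNIV: "measure (pvm_diagonal V P g) UNIV = l2_sq V g" if "g \<in> l2 V" for g
    using measure_pvm_diagonal[OF P that, of UNIV] P that by (simp add: projection_valued_measure_def)
  \<comment> \<open>Only the quadratic form of \<open>A\<close> is given, as a first moment. On the
    support it differs from that of \<open>S N 1\<close> by at most the mesh, and symmetry upgrades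
    this to a norm bound.\<close>
  have diff: "l2_sq V (\<lambda>v. A g v - S N 1 g v)
      \<le> (1 / real (Suc N))\<^sup>2 * l2_sq V g" if g: "g \<in> l2 V" for g N
  proof (rule numerical_radius_bound[where B="\<lambda>f v. A f v - S N 1 f v", OF _ _ _ g])
    show "l2_operator V (\<lambda>f v. A f v - S N 1 f v)"
      unfolding S_def by (intro l2_operator_diff A step)
    fix h assume h: "h \<in> l2 V"
    let ?\<mu> = "pvm_diagonal V P h"
    interpret finite_measure ?\<mu> by (rule finite_measure_pvm_diagonal[OF P h])
    have i: "integrable ?\<mu> (\<lambda>x. x)" by (rule bint[OF h, where B="\<bar>R\<bar>"]) auto
    have i': "integrable ?\<mu> (s N 1)" by (rule bint[OF h _ sR]) auto
    have "Re (l2_inner V (\<lambda>v. A h v - S N 1 h v) h) = Re (l2_inner V (A h) h) - Re (l2_inner V (S N 1 h) h)"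
      using l2_inner_lincomb_left[OF l2_operatorD(1)[OF A h] S_l2[OF h] h, of 1 "-1" N 1] by simp
    also have "\<dots> = (LINT x|?\<mu>. x - s N 1 x)"
      using i i' by (simp add: Aint[OF h] Sint[OF h])
    also have "\<bar>\<dots>\<bar> \<le> (LINT x|?\<mu>. \<bar>x - s N 1 x\<bar>)" by (rule integral_abs_bound)
    also have "\<dots> \<le> (LINT x|?\<mu>. 1 / real (Suc N))"
    proof (rule integral_mono_AE)
      show "AE x in ?\<mu>. \<bar>x - s N 1 x\<bar> \<le> 1 / real (Suc N)"
        using AE_R[OF h]
      proof eventually_elim
        case (elim x)
        then show ?case using s_eq[of x N 1] s_close[of x N] by (simp add: abs_minus_commute)
      qed
    qed (use i i' in auto)
    also have "\<dots> = 1 / real (Suc N) * l2_sq V h"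
      by (simp add: mu_UNIV[OF h])
    finally show "\<bar>Re (l2_inner V (\<lambda>v. A h v - S N 1 h v) h)\<bar> \<le> 1 / real (Suc N) * l2_sq V h" .
  qed simp
  have c_bd: "\<bar>c N 1 k\<bar> \<le> \<bar>R\<bar> + 1" if "k \<in> K N" for N k
  proof -
    have "- R * real (Suc N) - 1 \<le> of_int k" "of_int k \<le> R * real (Suc N)"
      using that unfolding K_def by (auto simp: le_floor_iff floor_le_iff)
    moreover have "R * real (Suc N) \<le> \<bar>R\<bar> * real (Suc N)" "- R * real (Suc N) \<ge> - \<bar>R\<bar> * real (Suc N)"
      by (intro mult_right_mono; simp)+
    ultimately have "\<bar>of_int k\<bar> \<le> \<bar>R\<bar> * real (Suc N) + 1" by linarith
    also have "\<dots> \<le> (\<bar>R\<bar> + 1) * real (Suc N)" by (simp add: algebra_simps)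
    finally show ?thesis by (simp add: c_def field_simps)
  qed
  have An: "(A ^^ j) f \<in> l2 V" for j
    by (induction j) (auto simp: f l2_operatorD(1)[OF A])
  have conv: "(\<lambda>N. l2_sq V (\<lambda>v. (A ^^ j) f v - S N j f v)) \<longlonglongrightarrow> 0" for j
  proof (induction j)
    case 0
    \<comment> \<open>All coefficients of \<open>S N 0\<close> are 1 and the cells cover the
      support, so \<open>S N 0 f\<close> is \<open>f\<close> up to norm zero.\<close>
    have "l2_sq V (\<lambda>v. f v - S N 0 f v) = 0" for N
    proof -
      have "l2_sq V (S N 0 f) = Re (l2_inner V (S N 0 f) f)"
      proof -
        have "(\<lambda>k. (c N 0 k)\<^sup>2) = c N 0" by (auto simp: c_def)
        then show ?thesis unfolding S_def step(5)[OF f] by simp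
      qed
      moreover have "Re (l2_inner V (S N 0 f) f) = (LINT x|pvm_diagonal V P f. 1)"
        unfolding Sint[OF f]
      proof (rule integral_cong_AE)
        show "AE x in pvm_diagonal V P f. s N 0 x = 1"
          using AE_R[OF f] by eventually_elim (subst s_eq, auto)
      qed auto
      moreover have "Re (l2_inner V f (S N 0 f)) = Re (l2_inner V (S N 0 f) f)"
        by (subst l2_inner_cnj[symmetric]) simp
      ultimately show ?thesis
        using l2_inner_expand[OF f S_l2[OF f, of N 0], of "-1"] by (simp add: mu_UNIV[OF f])
    qed
    then show ?case by simp
  next
    case (Suc j)
    let ?D = "\<lambda>N v. (A ^^ j) f v - S N j f v"
    let ?E = "\<lambda>N v. (A ^^ Suc j) f v - S N (Suc j) f v"
    have D: "?D N \<in> l2 V" for N by (intro l2_diff An S_l2 f)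
    have le: "l2_sq V (?E N) \<le> 2 * ((1 / real (Suc N))\<^sup>2 * l2_sq V ((A ^^ j) f))
        + 2 * ((\<bar>R\<bar> + 1)\<^sup>2 * l2_sq V (?D N))" for N
    proof -
      \<comment> \<open>The error at power \<open>Suc j\<close> splits into that of replacing the
        last \<open>A\<close> by \<open>S N 1\<close> and the image under \<open>S N 1\<close> of
        the error at power \<open>j\<close>.\<close>
      let ?x = "\<lambda>v. A ((A ^^ j) f) v - S N 1 ((A ^^ j) f) v" and ?y = "S N 1 (?D N)"
      have x: "?x \<in> l2 V" by (intro l2_diff S_l2 l2_operatorD(1)[OF A] An)
      have y: "?y \<in> l2 V" by (intro S_l2 D)
      have "S N (Suc j) f = S N 1 (S N j f)"
      proof -
        have "(\<lambda>k. c N 1 k * c N j k) = c N (Suc j)" by (auto simp: c_def)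
        then show ?thesis unfolding S_def step(3)[OF f] by simp
      qed
      moreover have "?y = (\<lambda>v. S N 1 ((A ^^ j) f) v - S N 1 (S N j f) v)"
        using l2_operatorD(2)[OF S_op[of N 1] An[of j] S_l2[OF f, of N j], of 1 "-1"] by simp
      ultimately have E: "?E N = (\<lambda>v. ?x v + 1 * ?y v)" by auto
      \<comment> \<open>Nonnegativity for \<open>?x - ?y\<close> gives the parallelogram bound for
        \<open>?x + ?y\<close>.\<close>
      have "0 \<le> l2_sq V (\<lambda>v. ?x v + (-1) * ?y v)"
        by (rule l2_inner_nonneg)
      then have "l2_sq V (?E N) \<le> 2 * l2_sq V ?x + 2 * l2_sq V ?y"
        unfolding E l2_inner_expand[OF x y] by simp
      moreover have "l2_sq V ?y \<le> (\<bar>R\<bar> + 1)\<^sup>2 * l2_sq V (?D N)"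
        unfolding S_def[of N 1] by (rule step(6)[OF D c_bd])
      ultimately show ?thesis using diff[OF An, of j N] by linarith
    qed
    have "(\<lambda>N. 2 * ((1 / real (Suc N))\<^sup>2 * l2_sq V ((A ^^ j) f))
        + 2 * ((\<bar>R\<bar> + 1)\<^sup>2 * l2_sq V (?D N)))
       \<longlonglongrightarrow> 2 * (0\<^sup>2 * l2_sq V ((A ^^ j) f)) + 2 * ((\<bar>R\<bar> + 1)\<^sup>2 * 0)"
      by (intro tendsto_intros Suc LIMSEQ_inverse_real_of_nat[unfolded inverse_eq_divide])
    then have lim: "(\<lambda>N. 2 * ((1 / real (Suc N))\<^sup>2 * l2_sq V ((A ^^ j) f))
        + 2 * ((\<bar>R\<bar> + 1)\<^sup>2 * l2_sq V (?D N))) \<longlonglongrightarrow> 0" by simp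
    show ?case
      by (rule tendsto_sandwich[OF _ _ tendsto_const lim])
         (intro always_eventually allI l2_inner_nonneg, intro always_eventually allI le)
  qed
  \<comment> \<open>Both sides of the claim are limits of this sequence: one by norm convergence,
    the other by dominated convergence.\<close>
  have "(\<lambda>N. Re (l2_inner V (S N n f) f)) \<longlonglongrightarrow> Re (l2_inner V ((A ^^ n) f) f)"
  proof -
    let ?D = "\<lambda>N v. (A ^^ n) f v - S N n f v"
    have D: "?D N \<in> l2 V" for N by (intro l2_diff An S_l2 f)
    have "(\<lambda>N. (cmod (l2_inner V (?D N) f))\<^sup>2) \<longlonglongrightarrow> 0"
    proof (rule tendsto_sandwich[OF _ _ tendsto_const])
      show "(\<lambda>N. l2_sq V (?D N) * l2_sq V f) \<longlonglongrightarrow> 0"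
        using tendsto_mult_right[OF conv[of n], of "l2_sq V f"] by simp
    qed (auto intro!: always_eventually l2_Cauchy_Schwarz D f)
    then have "(\<lambda>N. l2_inner V (?D N) f) \<longlonglongrightarrow> 0"
      using tendsto_real_sqrt[of "\<lambda>N. (cmod (l2_inner V (?D N) f))\<^sup>2" 0] by (simp add: tendsto_norm_zero_iff)
    then have "(\<lambda>N. Re (l2_inner V (?D N) f)) \<longlonglongrightarrow> 0"
      using tendsto_Re by fastforce
    moreover have "Re (l2_inner V (?D N) f) = Re (l2_inner V ((A ^^ n) f) f) - Re (l2_inner V (S N n f) f)" for N
      using l2_inner_lincomb_left[OF An[of n] S_l2[OF f, of N n] f, of 1 "-1"] by simp
    ultimately show ?thesis
      using tendsto_diff[OF tendsto_const[of "Re (l2_inner V ((A ^^ n) f) f)"]] by fastforce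
  qed
  moreover have "(\<lambda>N. Re (l2_inner V (S N n f) f)) \<longlonglongrightarrow> (LINT x|pvm_diagonal V P f. x ^ n)"
    unfolding Sint[OF f]
  proof (rule integral_dominated_convergence[where w="\<lambda>_. (\<bar>R\<bar> + 1) ^ n"])
    interpret finite_measure "pvm_diagonal V P f" by (rule finite_measure_pvm_diagonal[OF P f])
    show "integrable (pvm_diagonal V P f) (\<lambda>_. (\<bar>R\<bar> + 1) ^ n)" by simp
    show "AE x in pvm_diagonal V P f. norm (s N n x) \<le> (\<bar>R\<bar> + 1) ^ n" for N
      using AE_R[OF f]
    proof eventually_elim
      case (elim x)
      then have "s N n x = (s N 1 x) ^ n" using s_eq by simp
      then show ?case using sR[OF elim, of N] by (simp add: power_abs power_mono)
    qed
    show "AE x in pvm_diagonal V P f. (\<lambda>N. s N n x) \<longlonglongrightarrow> x ^ n"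
      using AE_R[OF f]
    proof eventually_elim
      case (elim x)
      have "(\<lambda>N. of_int \<lfloor>x * real (Suc N)\<rfloor> / real (Suc N) - x) \<longlonglongrightarrow> 0"
        by (rule Lim_null_comparison[OF _ LIMSEQ_inverse_real_of_nat])
           (use s_close in \<open>auto simp: inverse_eq_divide\<close>)
      then have "(\<lambda>N. (of_int \<lfloor>x * real (Suc N)\<rfloor> / real (Suc N)) ^ n) \<longlonglongrightarrow> x ^ n"
        by (intro tendsto_power) (simp add: LIM_zero_iff)
      then show ?case using s_eq[OF elim] by simp
    qed
  qed auto
  ultimately show ?thesis by (rule LIMSEQ_unique[symmetric])
qed

section \<open>Moments of measures with bounded support\<close>

lemma char_moment_series:
  assumes "real_distribution M" and R: "AE x in M. \<bar>x\<bar> \<le> R"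
  shows "(\<lambda>n. (\<i> * of_real t) ^ n /\<^sub>R fact n * of_real (LINT x|M. x ^ n)) sums char M t"
proof -
  interpret real_distribution M by fact
  let ?f = "\<lambda>n x. (\<i> * of_real t) ^ n /\<^sub>R fact n * of_real (x ^ n)"
  have bd: "AE x in M. norm (?f n x) \<le> (\<bar>t\<bar> * R) ^ n /\<^sub>R fact n" for n
    using R
  proof eventually_elim
    case (elim x)
    have "\<bar>x\<bar> ^ n \<le> R ^ n" using elim by (intro power_mono) auto
    then have "\<bar>t\<bar> ^ n * \<bar>x\<bar> ^ n / fact n \<le> \<bar>t\<bar> ^ n * R ^ n / fact n"
      by (intro divide_right_mono mult_left_mono) auto
    then show ?case
      by (simp add: norm_mult norm_power power_abs power_mult_distrib divide_inverse mult_ac)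
  qed
  have i: "integrable M (?f n)" for n
    by (rule integrable_const_bound[OF bd]) simp
  \<comment> \<open>Bounded support dominates the series by that of
    \<open>exp (\<bar>t\<bar> * R)\<close>, which permits integration term by term.\<close>
  have "(\<lambda>n. integral\<^sup>L M (?f n)) sums (\<integral>x. (\<Sum>n. ?f n x) \<partial>M)"
  proof (rule sums_integral[OF i])
    have "summable (\<lambda>n. norm (?f n x))" for x
      using summable_norm_exp[of "\<i> * of_real t * of_real x"]
      by (simp add: power_mult_distrib norm_mult norm_power mult_ac)
    then show "AE x in M. summable (\<lambda>n. norm (?f n x))" by simp
    have le: "(LINT x|M. norm (?f n x)) \<le> (\<bar>t\<bar> * R) ^ n /\<^sub>R fact n" for n
    proof -
      have "(LINT x|M. norm (?f n x)) \<le> (LINT x|M. (\<bar>t\<bar> * R) ^ n /\<^sub>R fact n)"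
        using bd by (intro integral_mono_AE integrable_norm i) auto
      also have "\<dots> = (\<bar>t\<bar> * R) ^ n /\<^sub>R fact n"
        using prob_space by simp
      finally show ?thesis .
    qed
    show "summable (\<lambda>n. LINT x|M. norm (?f n x))"
      by (rule summable_comparison_test'[OF summable_exp_generic[of "\<bar>t\<bar> * R"]]) (use le in auto)
  qed
  moreover have "(\<integral>x. (\<Sum>n. ?f n x) \<partial>M) = char M t"
    unfolding char_def
  proof (intro Bochner_Integration.integral_cong refl)
    fix x
    have "?f n x = (\<i> * of_real (t * x)) ^ n /\<^sub>R fact n" for n
      by (simp add: power_mult_distrib)
    then show "(\<Sum>n. ?f n x) = iexp (t * x)" by (simp add: exp_def)
  qed
  moreover have "integral\<^sup>L M (?f n) = (\<i> * of_real t) ^ n /\<^sub>R fact n * of_real (LINT x|M. x ^ n)" for n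
    by (simp only: integral_mult_right_zero integral_complex_of_real)
  ultimately show ?thesis by (simp only:)
qed

text \<open>The moments are the coefficients of the characteristic function's power series, and that
  function determines the measure.\<close>

lemma moments_determine:
  assumes M: "real_distribution M" "AE x in M. \<bar>x\<bar> \<le> R" and N: "real_distribution N" "AE x in N. \<bar>x\<bar> \<le> R'"
    and eq: "\<And>n. (LINT x|M. x ^ n) = (LINT x|N. x ^ n)"
  shows "M = N"
proof (rule Levy_uniqueness[OF M(1) N(1)])
  show "char M = char N"
    using char_moment_series[OF M] char_moment_series[OF N] eq by (auto intro: sums_unique2)
qed

theorem spectral_measure_unique:
  assumes A: "l2_operator V A" and spec: "is_spectral_pvm V A P"
    and f: "f \<in> l2 V" "l2_sq V f = 1"
    and N: "real_distribution N" "AE x in N. \<bar>x\<bar> \<le> R"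
    and eq: "\<And>n. (LINT x|N. x ^ n) = Re (l2_inner V ((A ^^ n) f) f)"
  shows "pvm_diagonal V P f = N"
proof -
  have P: "projection_valued_measure V P" using spec by (simp add: is_spectral_pvm_def)
  obtain R' where "\<And>g. g \<in> l2 V \<Longrightarrow> P {-R'..R'} g = g" using spec by (auto simp: is_spectral_pvm_def)
  then have "AE x in pvm_diagonal V P f. \<bar>x\<bar> \<le> R'"
    by (intro eventually_mono[OF spectral_support_AE[OF P f(1), of R']]) (auto simp: f(1))
  moreover have "real_distribution (pvm_diagonal V P f)"
  proof -
    have "emeasure (pvm_diagonal V P f) UNIV = 1"
      using P f by (simp add: emeasure_pvm_diagonal[OF P f(1)] projection_valued_measure_def)
    then show ?thesis
      by (intro real_distribution.intro real_distribution_axioms.intro prob_spaceI) auto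
  qed
  ultimately show ?thesis
    using N eq spectral_moments[OF A spec f(1)] by (intro moments_determine[of _ R' _ R]) auto
qed

section \<open>The expected spectral measure\<close>

text \<open>Characters shift Fourier coefficients, so the two neighbours contribute \<open>b\<close>
  times the sum of the characters of index 1 and -1, which is \<open>2 * b * cos t\<close>.\<close>

lemma adjacency_fourier_coef:
  assumes h: "sq_int h"
  shows "adjacency (laguerre_limit_graph \<beta> \<gamma> u) (fourier_coef h)
    = fourier_coef (\<lambda>t. of_real (\<beta> * (\<gamma> + 1 - 2 * u) + 2 * (\<beta> * sqrt (\<gamma> - u) * sqrt (1 - u)) * cos t) * h t)"
proof
  fix k
  define a b where "a = \<beta> * (\<gamma> + 1 - 2 * u)" and "b = \<beta> * sqrt (\<gamma> - u) * sqrt (1 - u)"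
  note i = integrable_fourier_char_mult[OF sq_int_integrable[OF h]]
  have "fourier_char (- k) t * (of_real (a + 2 * b * cos t) * h t)
     = of_real b * (fourier_char (- (k - 1)) t * h t + fourier_char (- (k + 1)) t * h t)
       + of_real a * (fourier_char (- k) t * h t)" for t
  proof -
    have c: "of_real (2 * cos t) = fourier_char 1 t + fourier_char (- 1) t"
      by (simp add: fourier_char_def complex_eq_iff)
    have "fourier_char (- (k - 1)) t = fourier_char (- k) t * fourier_char 1 t"
      "fourier_char (- (k + 1)) t = fourier_char (- k) t * fourier_char (- 1) t"
      by (simp_all add: fourier_char_add[symmetric])
    then have "of_real b * (fourier_char (- (k - 1)) t * h t + fourier_char (- (k + 1)) t * h t)
       = fourier_char (- k) t * (of_real b * of_real (2 * cos t) * h t)"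
      unfolding c by (simp only:) (simp add: algebra_simps)
    then show ?thesis by (simp only:) (simp add: algebra_simps)
  qed
  then have "fourier_coef (\<lambda>t. of_real (a + 2 * b * cos t) * h t) k
    = of_real b * (fourier_coef h (k - 1) + fourier_coef h (k + 1)) + of_real a * fourier_coef h k"
    unfolding fourier_coef_def using i by simp
  then show "adjacency (laguerre_limit_graph \<beta> \<gamma> u) (fourier_coef h) k
    = fourier_coef (\<lambda>t. of_real (\<beta> * (\<gamma> + 1 - 2 * u) + 2 * (\<beta> * sqrt (\<gamma> - u) * sqrt (1 - u)) * cos t) * h t) k"
    by (simp only: adjacency_laguerre_limit_graph a_def b_def)
qed

text \<open>The constant function 1 represents the root.\<close>

lemma fourier_coef_1: "fourier_coef (\<lambda>_. 1) = (\<lambda>k. if k = 0 then 1 else 0)"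
  by (auto simp: fourier_coef_def integral_fourier_char)

lemma sq_int_1: "sq_int (\<lambda>_. 1)"
  by (rule sq_int_bounded[where C=1]) auto

lemma spectral_measure_laguerre:
  "spectral_measure (laguerre_limit_graph \<beta> \<gamma> u) 0
    = distr angle_measure borel
        (\<lambda>t. \<beta> * (\<gamma> + 1 - 2 * u) + 2 * (\<beta> * sqrt (\<gamma> - u) * sqrt (1 - u)) * cos t)"
proof -
  let ?G = "laguerre_limit_graph \<beta> \<gamma> u"
  define a b where "a = \<beta> * (\<gamma> + 1 - 2 * u)" and "b = \<beta> * sqrt (\<gamma> - u) * sqrt (1 - u)"
  define \<sigma> where "\<sigma> t = a + 2 * b * cos t" for t
  define R where "R = \<bar>a\<bar> + 2 * \<bar>b\<bar>"
  have \<sigma>_m [measurable]: "\<sigma> \<in> borel_measurable borel" unfolding \<sigma>_def by measurable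
  have R: "\<bar>\<sigma> t\<bar> \<le> R" for t
  proof -
    have "\<bar>2 * b * cos t\<bar> \<le> 2 * \<bar>b\<bar>"
      by (simp add: abs_mult mult_left_le)
    then show ?thesis unfolding \<sigma>_def R_def by linarith
  qed
  have A: "adjacency ?G (fourier_coef h) = fourier_coef (\<lambda>t. of_real (\<sigma> t) * h t)" if "sq_int h" for h
    using adjacency_fourier_coef[OF that, of \<beta> \<gamma> u] by (simp only: \<sigma>_def a_def b_def)
  have s: "symbol (\<lambda>t. of_real (\<sigma> t))"
    unfolding symbol_def using R by auto
  have Am: "adjacency ?G f = fourier_multiplier (\<lambda>t. of_real (\<sigma> t)) f" if "f \<in> l2 UNIV" for f
    using A[OF inverse_fourier(1)[OF that]] inverse_fourier(2)[OF that]
    by (simp add: fourier_multiplier_def)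
  have op: "l2_operator UNIV (adjacency ?G)"
    unfolding l2_operator_def
    by (auto simp: Am l2_lincomb fourier_multiplier_l2 s fourier_multiplier_lincomb
        intro!: fourier_multiplier_adjoint)
  have V: "verts ?G = UNIV" by (simp add: laguerre_limit_graph_def)
  have "is_spectral_pvm UNIV (adjacency ?G) (multiplier_pvm \<sigma>)"
    by (rule multiplier_is_spectral_pvm[OF \<sigma>_m R A])
  then have spec: "is_spectral_pvm UNIV (adjacency ?G) (spectral_pvm ?G)"
    unfolding spectral_pvm_def V
    by (rule someI[where P="is_spectral_pvm UNIV (adjacency ?G)"])
  \<comment> \<open>On the constant function the operator acts by powers of the symbol, so the
    moments at the root are means over the angle.\<close>
  have pow: "(adjacency ?G ^^ n) (fourier_coef (\<lambda>_. 1)) = fourier_coef (\<lambda>t. of_real (\<sigma> t ^ n))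
      \<and> sq_int (\<lambda>t. of_real (\<sigma> t ^ n))" for n
  proof (induction n)
    case (Suc n)
    then have "sq_int (\<lambda>t. of_real (\<sigma> t) * of_real (\<sigma> t ^ n))"
      by (intro sq_int_symbol_mult s) auto
    then show ?case using Suc A[of "\<lambda>t. of_real (\<sigma> t ^ n)"] by simp
  qed (simp add: sq_int_1)
  have "pvm_diagonal UNIV (spectral_pvm ?G) (fourier_coef (\<lambda>_. 1)) = distr angle_measure borel \<sigma>"
  proof (rule spectral_measure_unique[OF op spec, where R=R])
    show "fourier_coef (\<lambda>_. 1) \<in> l2 UNIV" by (rule fourier_coef_l2[OF sq_int_1])
    show "l2_sq UNIV (fourier_coef (\<lambda>_. 1)) = 1"
      using angle.prob_space by (simp add: Plancherel sq_int_1 L2_inner_def)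
    show "real_distribution (distr angle_measure borel \<sigma>)"
      by (rule angle.real_distribution_distr) simp
    show "AE x in distr angle_measure borel \<sigma>. \<bar>x\<bar> \<le> R"
      using R by (subst AE_distr_iff) auto
    show "(LINT x|distr angle_measure borel \<sigma>. x ^ n)
      = Re (l2_inner UNIV ((adjacency ?G ^^ n) (fourier_coef (\<lambda>_. 1))) (fourier_coef (\<lambda>_. 1)))" for n
    proof -
      have "l2_inner UNIV ((adjacency ?G ^^ n) (fourier_coef (\<lambda>_. 1))) (fourier_coef (\<lambda>_. 1))
          = (LINT t|angle_measure. of_real (\<sigma> t ^ n))"
        using pow[of n] by (simp add: Plancherel sq_int_1 L2_inner_def)
      then show ?thesis
        by (simp only: integral_complex_of_real Re_complex_of_real) (simp add: integral_distr)
    qed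
  qed
  then show ?thesis
    unfolding spectral_measure_def V fourier_coef_1 \<sigma>_def a_def b_def .
qed

text \<open>Evenness of the cosine folds the circle onto \<open>{-pi..0}\<close>, where it
  increases, as the substitution in \<open>emeasure_arcsine\<close> demands.\<close>

lemma nn_integral_angle_cos:
  assumes [measurable]: "F \<in> borel_measurable borel"
  shows "(\<integral>\<^sup>+t. F (cos t) \<partial>angle_measure) = ennreal (1 / pi) * (\<integral>\<^sup>+t. F (cos t) * indicator {-pi..0} t \<partial>lborel)"
proof -
  let ?I = "\<integral>\<^sup>+t. F (cos t) * indicator {-pi..0} t \<partial>lborel"
  have "(\<integral>\<^sup>+t. F (cos t) * indicator {-pi..pi} t \<partial>lborel)
      = (\<integral>\<^sup>+t. F (cos t) * indicator {-pi..0} t + F (cos t) * indicator {0..pi} t \<partial>lborel)"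
  proof (rule nn_integral_cong_AE)
    show "AE t in lborel. F (cos t) * indicator {-pi..pi} t
        = F (cos t) * indicator {-pi..0} t + F (cos t) * indicator {0..pi} t"
      using AE_lborel_singleton[of 0] by eventually_elim (auto simp: indicator_def)
  qed
  also have "\<dots> = ?I + (\<integral>\<^sup>+t. F (cos t) * indicator {0..pi} t \<partial>lborel)"
    by (rule nn_integral_add) auto
  also have "(\<integral>\<^sup>+t. F (cos t) * indicator {0..pi} t \<partial>lborel) = ?I"
    by (subst nn_integral_real_affine[where c="-1" and t=0])
       (auto intro!: nn_integral_cong simp: indicator_def)
  finally have "(\<integral>\<^sup>+t. F (cos t) * indicator {-pi..pi} t \<partial>lborel) = 2 * ?I"
    by (simp add: mult_2)
  then have "(\<integral>\<^sup>+t. F (cos t) \<partial>angle_measure) = 2 * ?I / ennreal (2 * pi)"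
    by (subst nn_integral_uniform_measure) auto
  also have "\<dots> = ?I * (2 / ennreal (2 * pi))"
    by (subst ennreal_times_divide) (simp only: mult.commute)
  also have "2 / ennreal (2 * pi) = ennreal (1 / pi)"
    using divide_ennreal[of 2 "2 * pi"] by simp
  finally show ?thesis by (simp add: mult.commute)
qed

text \<open>With \<open>x = a + 2 * b * cos t\<close> the root in the density is
  \<open>- 2 * b * sin t\<close> on \<open>{-pi..0}\<close>; it cancels the derivative and leaves
  \<open>1 / pi\<close>.\<close>

lemma emeasure_arcsine:
  assumes b: "b > 0" and X [measurable]: "X \<in> sets borel"
  shows "emeasure (distr angle_measure borel (\<lambda>t. a + 2 * b * cos t)) X
    = (\<integral>\<^sup>+x. ennreal (indicator X x * (if 0 < 4 * b\<^sup>2 - (x - a)\<^sup>2 then 1 / (pi * sqrt (4 * b\<^sup>2 - (x - a)\<^sup>2)) else 0)) \<partial>lborel)"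
proof -
  define g where "g t = a + 2 * b * cos t" for t
  define f where "f x = indicator X x * (if 0 < 4 * b\<^sup>2 - (x - a)\<^sup>2 then 1 / (pi * sqrt (4 * b\<^sup>2 - (x - a)\<^sup>2)) else 0)" for x :: real
  have [measurable]: "g \<in> borel_measurable borel" "f \<in> borel_measurable borel"
    unfolding g_def f_def by measurable
  have "(\<integral>\<^sup>+x. ennreal (f x) \<partial>lborel) = (\<integral>\<^sup>+x. ennreal (f x * indicator {g (-pi)..g 0} x) \<partial>lborel)"
  proof (rule nn_integral_cong)
    fix x
    have "x \<in> {g (-pi)..g 0}" if "0 < 4 * b\<^sup>2 - (x - a)\<^sup>2"
    proof -
      have "(x - a)\<^sup>2 \<le> (2 * b)\<^sup>2" using that by (simp add: power_mult_distrib)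
      then have "\<bar>x - a\<bar> \<le> \<bar>2 * b\<bar>" by (simp only: abs_le_square_iff)
      then have "\<bar>x - a\<bar> \<le> 2 * b" using b by simp
      then show ?thesis by (auto simp: g_def)
    qed
    then show "ennreal (f x) = ennreal (f x * indicator {g (-pi)..g 0} x)"
      by (auto simp: f_def)
  qed
  also have "\<dots> = (\<integral>\<^sup>+t. ennreal (f (g t) * (- 2 * b * sin t) * indicator {-pi..0} t) \<partial>lborel)"
  proof (rule nn_integral_substitution)
    show "set_borel_measurable borel {g (-pi)..g 0} f"
      unfolding set_borel_measurable_def by measurable
    show "(g has_real_derivative - 2 * b * sin t) (at t)" for t
      unfolding g_def by (auto intro!: derivative_eq_intros)
    show "- 2 * b * sin t \<ge> 0" if "t \<in> {-pi..0}" for t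
    proof -
      have "sin (- t) \<ge> 0" using that by (intro sin_ge_zero) auto
      then show ?thesis using b by (simp add: mult_nonneg_nonpos)
    qed
  qed (auto intro!: continuous_intros)
  also have "\<dots> = (\<integral>\<^sup>+t. ennreal (1 / pi) * (indicator X (a + 2 * b * cos t) * indicator {-pi..0} t) \<partial>lborel)"
  proof (rule nn_integral_cong_AE)
    show "AE t in lborel. ennreal (f (g t) * (- 2 * b * sin t) * indicator {-pi..0} t)
        = ennreal (1 / pi) * (indicator X (a + 2 * b * cos t) * indicator {-pi..0} t)"
      using AE_lborel_singleton[of 0] AE_lborel_singleton[of "-pi"]
    proof eventually_elim
      case (elim t)
      show ?case
      proof (cases "t \<in> {-pi..0}")
        case True
        then have "sin (- t) > 0" using elim by (intro sin_gt_zero) auto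
        then have s: "sin t < 0" by simp
        have "4 * b\<^sup>2 - (g t - a)\<^sup>2 = 4 * b\<^sup>2 * (1 - (cos t)\<^sup>2)"
          by (simp add: g_def power_mult_distrib algebra_simps)
        also have "\<dots> = (2 * b * sin t)\<^sup>2" by (simp add: sin_squared_eq power_mult_distrib)
        finally have e: "4 * b\<^sup>2 - (g t - a)\<^sup>2 = (2 * b * sin t)\<^sup>2" .
        have "sqrt ((2 * b * sin t)\<^sup>2) = - 2 * b * sin t"
          using s b by (simp add: abs_mult)
        moreover have "(2 * b * sin t)\<^sup>2 > 0" using s b by simp
        ultimately have "f (g t) * (- 2 * b * sin t) = indicator X (g t) / pi"
          unfolding f_def e using s b by simp
        then show ?thesis using True by (simp add: g_def indicator_def)
      qed simp
    qed
  qed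
  also have "\<dots> = ennreal (1 / pi) * (\<integral>\<^sup>+t. indicator X (a + 2 * b * cos t) * indicator {-pi..0} t \<partial>lborel)"
    by (rule nn_integral_cmult) measurable
  also have "\<dots> = (\<integral>\<^sup>+t. indicator X (a + 2 * b * cos t) \<partial>angle_measure)"
    by (rule nn_integral_angle_cos[where F="\<lambda>c. indicator X (a + 2 * b * c)", symmetric]) measurable
  also have "\<dots> = (\<integral>\<^sup>+x. indicator X x \<partial>distr angle_measure borel (\<lambda>t. a + 2 * b * cos t))"
    by (rule nn_integral_distr[symmetric]) measurable
  also have "\<dots> = emeasure (distr angle_measure borel (\<lambda>t. a + 2 * b * cos t)) X"
    by (rule nn_integral_indicator) simp
  finally show ?thesis unfolding f_def by simp
qed

section \<open>Averaging arcsine laws to the Marchenko-Pastur law\<close>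

definition mp_density :: "real \<Rightarrow> real \<Rightarrow> real \<Rightarrow> real" where
  "mp_density \<beta> \<gamma> x = indicator {\<beta> * (1 - sqrt \<gamma>)\<^sup>2..\<beta> * (1 + sqrt \<gamma>)\<^sup>2} x *
     (sqrt ((x - \<beta> * (1 - sqrt \<gamma>)\<^sup>2) * (\<beta> * (1 + sqrt \<gamma>)\<^sup>2 - x)) / (2 * pi * \<beta> * x))"

text \<open>The argument of the square root in the arcsine density at \<open>u\<close> is affine in \<open>u\<close>, so that
  the average over \<open>u\<close> is elementary.\<close>

lemma arcsine_argument:
  fixes \<beta> \<gamma> u x :: real
  assumes "\<gamma> \<ge> u" "u \<le> 1" "\<gamma> \<ge> 0"
  shows "4 * (\<beta> * sqrt (\<gamma> - u) * sqrt (1 - u))\<^sup>2 - (x - \<beta> * (\<gamma> + 1 - 2 * u))\<^sup>2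
    = (x - \<beta> * (1 - sqrt \<gamma>)\<^sup>2) * (\<beta> * (1 + sqrt \<gamma>)\<^sup>2 - x) - 4 * \<beta> * x * u"
proof -
  define s where "s = sqrt \<gamma>"
  then have s: "s = sqrt \<gamma>" "\<gamma> = s\<^sup>2" using assms by auto
  have "(\<beta> * sqrt (\<gamma> - u) * sqrt (1 - u))\<^sup>2 = \<beta>\<^sup>2 * (\<gamma> - u) * (1 - u)"
    using assms by (simp add: power_mult_distrib)
  then show ?thesis unfolding s(1)[symmetric] unfolding s(2) by algebra
qed

text \<open>The substitution \<open>u = (D - v\<^sup>2) / c\<close> makes the integrand constant,
  and negative \<open>v\<close> keep it increasing. The condition \<open>D \<le> c\<close> places
  the zero \<open>D / c\<close> of the radicand inside the unit interval.\<close>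

lemma nn_integral_inverse_sqrt:
  assumes c: "c > 0" and D: "D > 0" "D \<le> c"
  shows "(\<integral>\<^sup>+u. ennreal ((if 0 < D - c * u then 1 / (pi * sqrt (D - c * u)) else 0) * indicator {0..1} u) \<partial>lborel)
    = ennreal (2 * sqrt D / (pi * c))"
proof -
  define g where "g v = (D - v\<^sup>2) / c" for v
  define f where "f u = (if 0 < D - c * u then 1 / (pi * sqrt (D - c * u)) else 0)" for u
  have [measurable]: "f \<in> borel_measurable borel" unfolding f_def by measurable
  have g0: "g (- sqrt D) = 0" "g 0 = D / c" using D by (auto simp: g_def)
  have "(\<integral>\<^sup>+u. ennreal (f u * indicator {0..1} u) \<partial>lborel)
      = (\<integral>\<^sup>+u. ennreal (f u * indicator {g (- sqrt D)..g 0} u) \<partial>lborel)"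
  proof (rule nn_integral_cong)
    fix u
    have "u \<le> D / c" if "0 < D - c * u" using that c by (simp add: field_simps)
    moreover have "D / c \<le> 1" using D c by simp
    ultimately show "ennreal (f u * indicator {0..1} u) = ennreal (f u * indicator {g (- sqrt D)..g 0} u)"
      unfolding g0 by (auto simp: f_def indicator_def)
  qed
  also have "\<dots> = (\<integral>\<^sup>+v. ennreal (f (g v) * (- 2 * v / c) * indicator {- sqrt D..0} v) \<partial>lborel)"
  proof (rule nn_integral_substitution)
    show "set_borel_measurable borel {g (- sqrt D)..g 0} f"
      unfolding set_borel_measurable_def by measurable
    show "(g has_real_derivative - 2 * v / c) (at v)" for v
      unfolding g_def using c by (auto intro!: derivative_eq_intros)
  qed (use c D in \<open>auto intro!: continuous_intros simp: divide_nonpos_pos\<close>)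
  also have "\<dots> = (\<integral>\<^sup>+v. ennreal (2 / (pi * c)) * indicator {- sqrt D..0} v \<partial>lborel)"
  proof (rule nn_integral_cong_AE)
    show "AE v in lborel. ennreal (f (g v) * (- 2 * v / c) * indicator {- sqrt D..0} v)
        = ennreal (2 / (pi * c)) * indicator {- sqrt D..0} v"
      using AE_lborel_singleton[of 0]
    proof eventually_elim
      case (elim v)
      have "D - c * g v = v\<^sup>2" using c by (simp add: g_def)
      then have "f (g v) = 1 / (pi * \<bar>v\<bar>)" using elim by (simp add: f_def)
      then have "f (g v) * (- 2 * v / c) = 2 / (pi * c)" if "v \<le> 0"
        using that elim c by (simp add: field_simps)
      then show ?case by (auto simp: indicator_def)
    qed
  qed
  also have "\<dots> = ennreal (2 / (pi * c)) * ennreal (sqrt D)"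
    by (subst nn_integral_cmult_indicator) (use D in auto)
  also have "\<dots> = ennreal (2 * sqrt D / (pi * c))"
    using c D by (subst ennreal_mult[symmetric]) auto
  finally show ?thesis unfolding f_def .
qed

text \<open>Where \<open>\<Delta> x\<close> is positive this is
  \<open>nn_integral_inverse_sqrt\<close> with \<open>D = \<Delta> x\<close> and
  \<open>c = 4 * \<beta> * x\<close>; elsewhere the radicand is never positive.\<close>

lemma nn_integral_arcsine_mixture:
  assumes \<beta>: "\<beta> > 0" and \<gamma>: "\<gamma> \<ge> 1"
  defines "\<Delta> \<equiv> \<lambda>x. (x - \<beta> * (1 - sqrt \<gamma>)\<^sup>2) * (\<beta> * (1 + sqrt \<gamma>)\<^sup>2 - x)"
  shows "(\<integral>\<^sup>+u. ennreal ((if 0 < \<Delta> x - 4 * \<beta> * x * u then 1 / (pi * sqrt (\<Delta> x - 4 * \<beta> * x * u)) else 0)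
            * indicator {0..1} u) \<partial>lborel) = ennreal (mp_density \<beta> \<gamma> x)"
proof -
  define s where "s = sqrt \<gamma>"
  then have s: "s = sqrt \<gamma>" "\<gamma> = s\<^sup>2" "s \<ge> 0" using \<gamma> by auto
  have \<Delta>_le: "\<Delta> x \<le> 4 * \<beta> * x"
  proof -
    \<comment> \<open>At \<open>u = 1\<close> the off-diagonal weight vanishes, so the radicand is
      minus the square of \<open>x - a\<close> with
      \<open>a = \<beta> * (\<gamma> - 1)\<close>.\<close>
    have "\<Delta> x - 4 * \<beta> * x = - (x - \<beta> * (\<gamma> - 1))\<^sup>2"
      unfolding \<Delta>_def s(1)[symmetric] unfolding s(2) by algebra
    then show ?thesis by (smt (verit) zero_le_power2)
  qed
  show ?thesis
  proof (cases "\<Delta> x > 0")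
    case True
    then have x: "x > 0" using \<Delta>_le \<beta> by (smt (verit) mult_nonneg_nonpos)
    have "x \<in> {\<beta> * (1 - sqrt \<gamma>)\<^sup>2..\<beta> * (1 + sqrt \<gamma>)\<^sup>2}"
    proof -
      have "\<beta> * (1 - sqrt \<gamma>)\<^sup>2 \<le> \<beta> * (1 + sqrt \<gamma>)\<^sup>2"
        unfolding s(1)[symmetric] using \<beta> s(3) by (intro mult_left_mono) (auto simp: power2_eq_square algebra_simps)
      then show ?thesis using True unfolding \<Delta>_def zero_less_mult_iff by auto
    qed
    then have "mp_density \<beta> \<gamma> x = 2 * sqrt (\<Delta> x) / (pi * (4 * \<beta> * x))"
      unfolding mp_density_def \<Delta>_def using x \<beta> by (simp add: field_simps)
    then show ?thesis
      using nn_integral_inverse_sqrt[of "4 * \<beta> * x" "\<Delta> x"] True \<Delta>_le x \<beta> by simp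
  next
    case False
    \<comment> \<open>The radicand is affine in \<open>u\<close>: its maximum is at
      \<open>u = 0\<close> for \<open>x \<ge> 0\<close> and at \<open>u = 1\<close> for negative
      \<open>x\<close>, and both values are nonpositive.\<close>
    have "\<Delta> x - 4 * \<beta> * x * u \<le> 0" if "u \<in> {0..1}" for u
    proof (cases "x \<ge> 0")
      case True
      then have "4 * \<beta> * x * u \<ge> 0" using \<beta> that by simp
      then show ?thesis using False by linarith
    next
      case neg: False
      then have "\<beta> * x \<le> 0" using \<beta> by (simp add: mult_nonneg_nonpos)
      then have "4 * \<beta> * (- x) * u \<le> 4 * \<beta> * (- x) * 1"
        using that by (intro mult_left_mono) auto
      then show ?thesis using \<Delta>_le by simp
    qed
    then have "(\<integral>\<^sup>+u. ennreal ((if 0 < \<Delta> x - 4 * \<beta> * x * u then 1 / (pi * sqrt (\<Delta> x - 4 * \<beta> * x * u)) else 0)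
            * indicator {0..1} u) \<partial>lborel) = (\<integral>\<^sup>+u. 0 \<partial>(lborel :: real measure))"
      by (intro nn_integral_cong) (auto simp: indicator_def not_less[symmetric])
    moreover have "mp_density \<beta> \<gamma> x = 0"
    proof (cases "x \<in> {\<beta> * (1 - sqrt \<gamma>)\<^sup>2..\<beta> * (1 + sqrt \<gamma>)\<^sup>2}")
      case True
      then have "\<Delta> x \<ge> 0" unfolding \<Delta>_def by simp
      with False have "\<Delta> x = 0" by simp
      \<comment> \<open>At the endpoints the numerator is 0; for \<open>\<gamma> = 1\<close> the
        left endpoint is 0, where the quotient \<open>0 / 0\<close> is 0 by convention.\<close>
      then show ?thesis unfolding mp_density_def \<Delta>_def by (simp only: real_sqrt_zero div_0 mult_zero_right)
    qed (simp add: mp_density_def)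
    ultimately show ?thesis by simp
  qed
qed

text \<open>Tonelli exchanges the average over \<open>u\<close> with the integral over
  \<open>x\<close>, and the inner integral is the arcsine mixture.\<close>

theorem expected_measure_laguerre:
  assumes \<beta>: "\<beta> > 0" and \<gamma>: "\<gamma> \<ge> 1"
  shows "expected_measure (uniform_measure lborel {0..1::real}) (laguerre_limit_graph \<beta> \<gamma>) (\<lambda>u. 0)
    = density lborel (\<lambda>x. ennreal (mp_density \<beta> \<gamma> x))" (is "_ = ?D")
proof -
  define \<Delta> where "\<Delta> x = (x - \<beta> * (1 - sqrt \<gamma>)\<^sup>2) * (\<beta> * (1 + sqrt \<gamma>)\<^sup>2 - x)" for x
  define k where "k x u = (if 0 < \<Delta> x - 4 * \<beta> * x * u then 1 / (pi * sqrt (\<Delta> x - 4 * \<beta> * x * u)) else 0)" for x u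
  have [measurable]: "mp_density \<beta> \<gamma> \<in> borel_measurable borel"
    unfolding mp_density_def by measurable
  have k_m [measurable]: "(\<lambda>(x, u). k x u) \<in> borel_measurable (borel \<Otimes>\<^sub>M borel)"
    unfolding k_def \<Delta>_def by measurable
  have eq: "(\<integral>\<^sup>+u. emeasure (spectral_measure (laguerre_limit_graph \<beta> \<gamma> u) 0) X \<partial>uniform_measure lborel {0..1})
      = emeasure ?D X" if X [measurable]: "X \<in> sets borel" for X
  proof -
    have "(\<integral>\<^sup>+u. emeasure (spectral_measure (laguerre_limit_graph \<beta> \<gamma> u) 0) X \<partial>uniform_measure lborel {0..1})
       = (\<integral>\<^sup>+u. (\<integral>\<^sup>+x. ennreal (indicator X x * k x u) \<partial>lborel) \<partial>uniform_measure lborel {0..1})"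
    proof (rule nn_integral_cong_AE, rule AE_uniform_measureI)
      \<comment> \<open>At \<open>u = 1\<close> the off-diagonal weight is 0 and the spectral
        measure is a point mass, to which \<open>emeasure_arcsine\<close> does not apply.\<close>
      have "AE u in lborel. u \<noteq> (1::real)" by (rule AE_lborel_singleton)
      then show "AE u in lborel. u \<in> {0..1} \<longrightarrow> emeasure (spectral_measure (laguerre_limit_graph \<beta> \<gamma> u) 0) X
          = (\<integral>\<^sup>+x. ennreal (indicator X x * k x u) \<partial>lborel)"
      proof eventually_elim
        case (elim u)
        show ?case
        proof
          assume u: "u \<in> {0..1}"
          then have b: "\<beta> * sqrt (\<gamma> - u) * sqrt (1 - u) > 0" using elim \<beta> \<gamma> by simp
          show "emeasure (spectral_measure (laguerre_limit_graph \<beta> \<gamma> u) 0) X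
            = (\<integral>\<^sup>+x. ennreal (indicator X x * k x u) \<partial>lborel)"
            unfolding spectral_measure_laguerre emeasure_arcsine[OF b X] k_def \<Delta>_def
            using u \<gamma> by (subst (1 2) arcsine_argument) auto
        qed
      qed
    qed simp
    also have "\<dots> = (\<integral>\<^sup>+u. (\<integral>\<^sup>+x. ennreal (indicator X x * k x u) \<partial>lborel) * indicator {0..1} u \<partial>lborel)"
      by (subst nn_integral_uniform_measure) (simp_all add: divide_ennreal_def)
    also have "\<dots> = (\<integral>\<^sup>+u. (\<integral>\<^sup>+x. indicator X x * ennreal (k x u * indicator {0..1} u) \<partial>lborel) \<partial>lborel)"
      by (subst nn_integral_multc[symmetric], measurable)
         (auto intro!: nn_integral_cong simp: indicator_def)
    also have "\<dots> = (\<integral>\<^sup>+x. (\<integral>\<^sup>+u. indicator X x * ennreal (k x u * indicator {0..1} u) \<partial>lborel) \<partial>lborel)"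
      by (rule lborel_pair.Fubini') measurable
    also have "\<dots> = (\<integral>\<^sup>+x. ennreal (mp_density \<beta> \<gamma> x) * indicator X x \<partial>lborel)"
    proof (rule nn_integral_cong)
      fix x
      have "(\<integral>\<^sup>+u. indicator X x * ennreal (k x u * indicator {0..1} u) \<partial>lborel)
          = indicator X x * (\<integral>\<^sup>+u. ennreal (k x u * indicator {0..1} u) \<partial>lborel)"
        by (rule nn_integral_cmult) measurable
      then show "(\<integral>\<^sup>+u. indicator X x * ennreal (k x u * indicator {0..1} u) \<partial>lborel)
          = ennreal (mp_density \<beta> \<gamma> x) * indicator X x"
        unfolding k_def \<Delta>_def nn_integral_arcsine_mixture[OF \<beta> \<gamma>] by (simp add: mult.commute)
    qed
    also have "\<dots> = emeasure ?D X"
      by (subst emeasure_density) auto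
    finally show ?thesis .
  qed
  have "expected_measure (uniform_measure lborel {0..1::real}) (laguerre_limit_graph \<beta> \<gamma>) (\<lambda>u. 0)
      = measure_of UNIV (sets borel) (emeasure ?D)"
    unfolding expected_measure_def
    by (rule measure_of_eq) (use eq sets.sigma_sets_eq[of "borel :: real measure"] in auto)
  also have "\<dots> = ?D"
    using measure_of_of_measure[of ?D] by simp
  finally show ?thesis .
qed

theorem theorem4p2:
  fixes \<beta> \<gamma> Lm Lp :: real
    and M :: "nat \<Rightarrow> 'a measure"
    and T :: "nat \<Rightarrow> 'a \<Rightarrow> int \<Rightarrow> int \<Rightarrow> real"
  assumes "\<beta> > 0" and "\<gamma> \<ge> 1"
    and "Lm = \<beta> * (1 - sqrt \<gamma>)\<^sup>2" and "Lp = \<beta> * (1 + sqrt \<gamma>)\<^sup>2"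
    and "\<And>n. n \<ge> 1 \<Longrightarrow> beta_laguerre (M n) \<beta> \<gamma> n (T n)"
  shows "bs_limit
           (\<lambda>n. M n \<Otimes>\<^sub>M uniform_count_measure {0..<int n})
           (\<lambda>n (\<omega>, j). tridiagonal_graph n (T n \<omega>))
           (\<lambda>n (\<omega>, j). j)
           (uniform_measure lborel {0..1::real})
           (laguerre_limit_graph \<beta> \<gamma>)
           (\<lambda>u. 0)
       \<and> expected_measure (uniform_measure lborel {0..1::real}) (laguerre_limit_graph \<beta> \<gamma>) (\<lambda>u. 0)
         = density lborel (\<lambda>x. ennreal
             (indicator {Lm..Lp} x * (sqrt ((x - Lm) * (Lp - x)) / (2 * pi * \<beta> * x))))"
proof
  show "bs_limit
           (\<lambda>n. M n \<Otimes>\<^sub>M uniform_count_measure {0..<int n})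
           (\<lambda>n (\<omega>, j). tridiagonal_graph n (T n \<omega>))
           (\<lambda>n (\<omega>, j). j)
           (uniform_measure lborel {0..1::real})
           (laguerre_limit_graph \<beta> \<gamma>)
           (\<lambda>u. 0)"
    unfolding bs_limit_def
  proof (intro conjI allI impI)
    show "random_rooted_graph (M n \<Otimes>\<^sub>M uniform_count_measure {0..<int n})
        (\<lambda>(\<omega>, j). tridiagonal_graph n (T n \<omega>)) (\<lambda>(\<omega>, j). j)" if "n \<ge> 1" for n
      by (rule random_rooted_graph_tridiagonal[OF assms(5)[OF that] that])
    show "random_rooted_graph (uniform_measure lborel {0..1}) (laguerre_limit_graph \<beta> \<gamma>) (\<lambda>u. 0)"
      by (rule random_rooted_graph_laguerre)
  next
    fix r and K :: "int wgraph" and z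
    show "(\<lambda>n. measure (M n \<Otimes>\<^sub>M uniform_count_measure {0..<int n})
        {\<omega> \<in> space (M n \<Otimes>\<^sub>M uniform_count_measure {0..<int n}).
          isomorphic_rooted K z (graph_ball ((\<lambda>(\<omega>, j). tridiagonal_graph n (T n \<omega>)) \<omega>) ((\<lambda>(\<omega>, j). j) \<omega>) r)
            ((\<lambda>(\<omega>, j). j) \<omega>)})
      \<longlonglongrightarrow> measure (uniform_measure lborel {0..1})
        {u \<in> space (uniform_measure lborel {0..1::real}). isomorphic_rooted K z (graph_ball (laguerre_limit_graph \<beta> \<gamma> u) 0 r) 0}"
      unfolding case_prod_beta by (rule unweighted_limit[OF assms(5)])
  next
    fix F :: "int wgraph \<Rightarrow> int \<Rightarrow> real" assume F: "bounded_locally_continuous F"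
    show "(\<lambda>n. \<integral>\<omega>. F ((\<lambda>(\<omega>, j). tridiagonal_graph n (T n \<omega>)) \<omega>) ((\<lambda>(\<omega>, j). j) \<omega>)
          \<partial>(M n \<Otimes>\<^sub>M uniform_count_measure {0..<int n}))
        \<longlonglongrightarrow> (\<integral>u. F (laguerre_limit_graph \<beta> \<gamma> u) 0 \<partial>uniform_measure lborel {0..1::real})"
      unfolding case_prod_beta by (rule weighted_limit[OF assms(1,2) _ F]) (rule assms(5))
  qed
  show "expected_measure (uniform_measure lborel {0..1::real}) (laguerre_limit_graph \<beta> \<gamma>) (\<lambda>u. 0)
         = density lborel (\<lambda>x. ennreal
             (indicator {Lm..Lp} x * (sqrt ((x - Lm) * (Lp - x)) / (2 * pi * \<beta> * x))))"
    using expected_measure_laguerre[OF assms(1,2)] unfolding mp_density_def assms(3,4) .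
qed

end
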